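(* Let $(L,R)$, $(\beta_{j,n})$, $(\nu_t)$, $(X_j)$ be as in the context, let $\alpha\in(0,2)$ and assume Hypothesis $(\mathrm H_\alpha)$ of the context, and moreover $c_0:=c_0^++c_0^->0$. Let $H_t:=\max_{1\le j\le\nu_t}|\beta_{j,\nu_t}X_j|$. Then $e^{-\mu(\alpha)t}H_t$ converges in distribution, as $t\to+\infty$, to a random variable $H_\infty$ with \[ P\{H_\infty\le x\}=\begin{cases}\mathbb E\big[e^{-c_0|x|^{-\alpha}Z_\infty(\alpha)}\big] & x>0,\\ P\{Z_\infty(\alpha)=0\} & x=0,\\ 0 & x<0,\end{cases} \] where the law of $Z_\infty(\alpha)$ is the unique law of a positive random variable $Z$ with $\mathbb E[Z]=1$ solving the distributional fixed point equation $Z\overset{\mathcal L}{=}\Theta^{\mathcal S(\alpha)}(L^\alpha Z_1+R^\alpha Z_2)$.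
   Context: $(L,R)$ is a random vector with $L,R\ge 0$ and $P\{L>0\}+P\{R>0\}>1$. For $s\ge0$ set $\mathcal S(s):=\mathbb E[L^s+R^s]-1\in[-1,+\infty]$ (with $0^0=0$) and for $s>0$ set $\mu(s):=\mathcal S(s)/s$. Let $(L_n,R_n)_{n\ge1}$ be i.i.d. copies of $(L,R)$ and $(I_n)_{n\ge1}$ independent random variables, independent of $(L_n,R_n)_n$, with $I_n$ uniform on $\{1,\dots,n\}$. Define weights $\beta_{1,1}:=1$, $(\beta_{1,2},\beta_{2,2}):=(L_1,R_1)$ and for $n\ge2$: $(\beta_{1,n+1},\dots,\beta_{n+1,n+1}):=(\beta_{1,n},\dots,\beta_{I_n-1,n},L_n\beta_{I_n,n},R_n\beta_{I_n,n},\beta_{I_n+1,n},\dots,\beta_{n,n})$. $(\nu_t)_{t\ge0}$ is a Yule process started at $\nu_0=1$ (pure birth process with rate $n$ in state $n$), so $P\{\nu_t=n\}=e^{-t}(1-e^{-t})^{n-1}$. $(X_j)_{j\ge1}$ are i.i.d. real random variables with distribution function $F_0$. The families $(X_j)$, $(\nu_t)$ and $((L_n,R_n,I_n))_n$ are independent. Hypothesis $(\mathrm H_\alpha)$: $F_0$ satisfies $\lim_{x\to+\infty}x^\alpha(1-F_0(x))=c_0^+<\infty$ and $\lim_{x\to-\infty}|x|^\alpha F_0(x)=c_0^-<\infty$, and either (a) $\alpha\in(0,1)\cup(1,2)$, $c_0^++c_0^->0$, $\int x\,dF_0(x)=0$ when $\alpha>1$, and $\mu(\delta)<\mu(\alpha)<+\infty$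 for some $\delta>\alpha$; or (b) $\alpha=1$, $c_0^+=c_0^->0$, $\lim_{R\to+\infty}\int_{(-R,R)}x\,dF_0(x)=\gamma_0\in(-\infty,+\infty)$, and $\mu(\delta)<\mu(1)<+\infty$ for some $\delta>1$. In the fixed point equation, $Z,Z_1,Z_2$ are i.i.d., $\Theta$ is uniform on $(0,1)$, and $(Z,Z_1,Z_2)$, $\Theta$, $(L,R)$ are independent. *)

theory Defs
  imports "HOL-Probability.Probability"
begin

text \<open>Weights beta_{j,n}: the list betas LR I n has length n, entry (j-1) is beta_{j,n}.
  LR k = (L_k, R_k), I k = I_k (1-based indices).\<close>
fun betas :: "(nat \<Rightarrow> real \<times> real) \<Rightarrow> (nat \<Rightarrow> nat) \<Rightarrow> nat \<Rightarrow> real list" where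
  "betas LR I 0 = []"
| "betas LR I (Suc 0) = [1]"
| "betas LR I (Suc (Suc 0)) = [fst (LR 1), snd (LR 1)]"
| "betas LR I (Suc (Suc (Suc n))) =
     (let b = betas LR I (Suc (Suc n)); k = I (Suc (Suc n))
      in take (k - 1) b @ [fst (LR (Suc (Suc n))) * b ! (k - 1), snd (LR (Suc (Suc n))) * b ! (k - 1)]
         @ drop k b)"

text \<open>S(s) = E[L^s + R^s] - 1 (with 0 powr s = 0, i.e. 0^0 = 0), possibly +infinity.\<close>
definition calS :: "(real \<times> real) measure \<Rightarrow> real \<Rightarrow> ereal" where
  "calS Q s = enn2ereal (\<integral>\<^sup>+ p. ennreal (fst p powr s + snd p powr s) \<partial>Q) - 1"

definition mu :: "(real \<times> real) measure \<Rightarrow> real \<Rightarrow> ereal" where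
  "mu Q s = calS Q s / ereal s"

definition yule_trans :: "real \<Rightarrow> nat \<Rightarrow> nat \<Rightarrow> real" where
  "yule_trans u n m = (if 1 \<le> n \<and> n \<le> m
     then real ((m - 1) choose (n - 1)) * exp (- real n * u) * (1 - exp (- u)) ^ (m - n) else 0)"

fun yule_fdd :: "real \<Rightarrow> nat \<Rightarrow> real list \<Rightarrow> nat list \<Rightarrow> real" where
  "yule_fdd s n (t # ts) (m # ms) = yule_trans (t - s) n m * yule_fdd t m ts ms"
| "yule_fdd s n _ _ = 1"

text \<open>nu is (in law) a Yule process started at 1: its finite-dimensional distributions
  are those of the pure birth Markov chain with rate n in state n, nu_0 = 1.\<close>
definition yule_process :: "'a measure \<Rightarrow> (real \<Rightarrow> 'a \<Rightarrow> nat) \<Rightarrow> bool" where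
  "yule_process M nu \<longleftrightarrow>
     (\<forall>t\<ge>0. nu t \<in> measurable M (count_space UNIV)) \<and>
     (\<forall>ts ns. length ns = length ts \<and> sorted ts \<and> (\<forall>t\<in>set ts. 0 \<le> t) \<longrightarrow>
        measure M {\<omega>\<in>space M. \<forall>i<length ts. nu (ts ! i) \<omega> = ns ! i} = yule_fdd 0 1 ts ns)"

definition fam_events :: "'a measure \<Rightarrow> ('i \<Rightarrow> 'b measure) \<Rightarrow> ('i \<Rightarrow> 'a \<Rightarrow> 'b) \<Rightarrow> 'i set \<Rightarrow> 'a set set" where
  "fam_events M N Y J = sigma_sets (space M) (\<Union>j\<in>J. {Y j -` A \<inter> space M | A. A \<in> sets (N j)})"

definition Hproc :: "(nat \<Rightarrow> 'a \<Rightarrow> real \<times> real) \<Rightarrow> (nat \<Rightarrow> 'a \<Rightarrow> nat) \<Rightarrow> (nat \<Rightarrow> 'a \<Rightarrow> real)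
    \<Rightarrow> (real \<Rightarrow> 'a \<Rightarrow> nat) \<Rightarrow> real \<Rightarrow> 'a \<Rightarrow> real" where
  "Hproc LR I X nu t \<omega> = Max ((\<lambda>j. \<bar>betas (\<lambda>n. LR n \<omega>) (\<lambda>n. I n \<omega>) (nu t \<omega>) ! (j - 1) * X j \<omega>\<bar>) ` {1..nu t \<omega>})"

definition smoothing_fp :: "(real \<times> real) measure \<Rightarrow> real \<Rightarrow> real measure \<Rightarrow> bool" where
  "smoothing_fp Q a ZL \<longleftrightarrow> prob_space ZL \<and> sets ZL = sets borel \<and>
     (AE z in ZL. 0 \<le> z) \<and> integrable ZL (\<lambda>z. z) \<and> (\<integral>z. z \<partial>ZL) = 1 \<and>
     distr (uniform_measure lborel {0<..<1::real} \<Otimes>\<^sub>M (Q \<Otimes>\<^sub>M (ZL \<Otimes>\<^sub>M ZL))) borel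
        (\<lambda>(\<theta>, (l, r), (z1, z2)). \<theta> powr real_of_ereal (calS Q a) * (l powr a * z1 + r powr a * z2))
       = ZL"

definition Hlim_cdf :: "real \<Rightarrow> real \<Rightarrow> real measure \<Rightarrow> real \<Rightarrow> real" where
  "Hlim_cdf c0 a ZL x = (if x > 0 then (\<integral>z. exp (- c0 * x powr (- a) * z) \<partial>ZL)
     else if x = 0 then measure ZL {0} else 0)"

end

theory Submission
  imports Defs
begin

text \<open>
  Write \<open>w\<close> for the \<open>\<alpha>\<close>-th power of a weight and \<open>S\<close> for \<open>S(\<alpha>)\<close>. Let \<open>\<phi>\<close> be a bounded
  continuous solution of \<open>\<phi>(s) = E[\<phi>(s \<Theta>^S L^\<alpha>) \<phi>(s \<Theta>^S R^\<alpha>)]\<close>. The product of \<open>\<phi>(e^(- S t) w)\<close>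
  over the leaves at time \<open>t\<close> has mean \<open>\<phi>(1)\<close> for every \<open>t\<close>: with \<open>x = e^(- t)\<close>, the mean over
  trees with \<open>m\<close> splits satisfies \<open>f_m' = (m + 1) (f_(m+1) - f_m) / x\<close>, and the mixture of the
  \<open>f_m\<close> with the geometric weights of the Yule process telescopes. If \<open>g\<close> agrees with \<open>\<phi>\<close> to first
  order at \<open>0\<close>, the product of \<open>g(e^(- S t) w)\<close> has mean tending to \<open>\<phi>(1)\<close>, because
  \<open>\<bar>\<phi>(v) - g(v)\<bar> \<le> \<epsilon> v + C v^p\<close>, the mean of the sum of the \<open>e^(- S t) w\<close> is \<open>1\<close> and that of the sum
  of their \<open>p\<close>-th powers is \<open>e^((S(p \<alpha>) - p S) t)\<close>, which tends to \<open>0\<close> for a suitable \<open>p > 1\<close>.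

  If \<open>g\<close> belongs to a second solution, this gives uniqueness; if \<open>g(v) = P(\<bar>X\<bar> v^(1/\<alpha>) \<le> x)\<close> and
  \<open>\<phi>\<close> is a rescaled Laplace transform of the fixed point, it gives the limit law of the maximum.
  Existence follows by iterating the smoothing map from the point mass at \<open>1\<close>: characteristic
  functions contract in the distance \<open>sup \<bar>\<phi>(s) - \<psi>(s)\<bar> / \<bar>s\<bar>^p\<close>, and the mean-one laws are tight.
\<close>

text \<open>Only means of products over leaves are computed: neither a martingale nor an almost sure
  limit of the weights is constructed, and the law of Z enters through its transforms. This is why
  \<phi> is complex valued: characteristic functions serve existence and uniqueness, Laplace
  transforms serve the maximum. The factor \<Theta>^S stands for the first split: its time \<tau> is
  exponential, so e^(- \<tau>) is uniform. Differentiating the equation in the scale gives x d/dx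
  \<phi>(x^S) = E[\<phi>(x^S L^\<alpha>) \<phi>(x^S R^\<alpha>)] - \<phi>(x^S), and splitting a leaf
  of the tree changes the mean product by the same right-hand side. The exponent p is where the
  hypothesis on \<mu> is spent: E[L^s + R^s] is convex in s, so \<mu>(\<delta>) < \<mu>(\<alpha>)
  gives S(p \<alpha>) < p S whenever 1 < p and p \<alpha> \<le> \<delta>. The further restriction p
  \<le> 2 belongs to the Taylor bound \<bar>e^(i x) - 1 - i x\<bar> \<le> 2 \<bar>x\<bar>^p, which
  makes the distance between the first two iterates finite.\<close>

section \<open>The splitting tree of weights\<close>

text \<open>\<open>u i = (I\<^sub>i, (L\<^sub>i, R\<^sub>i))\<close>, and \<open>wts u m j\<close> is the weight \<open>\<beta>\<close> of leaf \<open>j\<close> (one-based) among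
  \<open>m + 1\<close> leaves. Unlike \<open>betas\<close>, it is a total function of its arguments, and the two agree only
  if \<open>1 \<le> I\<^sub>i \<le> i\<close>.\<close>

fun wts :: "(nat \<Rightarrow> nat \<times> (real \<times> real)) \<Rightarrow> nat \<Rightarrow> nat \<Rightarrow> real" where
  "wts u 0 j = 1"
| "wts u (Suc m) j =
     (if j < fst (u (Suc m)) then wts u m j
      else if j = fst (u (Suc m)) then fst (snd (u (Suc m))) * wts u m j
      else if j = Suc (fst (u (Suc m))) then snd (snd (u (Suc m))) * wts u m (j - 1)
      else wts u m (j - 1))"

lemma wts_cong: "(\<And>i. 1 \<le> i \<Longrightarrow> i \<le> m \<Longrightarrow> u i = v i) \<Longrightarrow> wts u m j = wts v m j"
proof (induction m arbitrary: j)
  case (Suc m)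
  then have "\<And>j. wts u m j = wts v m j" "u (Suc m) = v (Suc m)"
    by auto
  then show ?case by simp
qed simp

text \<open>Stated for a commutative monoid so that one proof serves both
  \<open>prod.split_leaf\<close>, for products over leaves, and \<open>sum.split_leaf\<close>, for
  power sums.\<close>

lemma (in comm_monoid_set) split_leaf:
  assumes k: "1 \<le> k" "k \<le> Suc m" and u: "u (Suc m) = (k, l, r)"
  shows "F (\<lambda>j. g (wts u (Suc m) j)) {1..Suc (Suc m)} =
    f (f (g (l * wts u m k)) (g (r * wts u m k))) (F (\<lambda>j. g (wts u m j)) ({1..Suc m} - {k}))"
proof -
  let ?h = "\<lambda>j. g (wts u (Suc m) j)" and ?w = "\<lambda>j. g (wts u m j)"
  have "{1..Suc (Suc m)} = {1..<k} \<union> ({k, Suc k} \<union> {Suc (Suc k)..Suc (Suc m)})"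
    using k by (auto simp: set_eq_iff)
  moreover have "Suc ` {Suc k..Suc m} = {Suc (Suc k)..Suc (Suc m)}"
    by (rule image_Suc_atLeastAtMost)
  ultimately have "F ?h {1..Suc (Suc m)} = F ?h ({1..<k} \<union> ({k, Suc k} \<union> Suc ` {Suc k..Suc m}))"
    by simp
  also have "\<dots> = f (F ?h {1..<k}) (F ?h ({k, Suc k} \<union> Suc ` {Suc k..Suc m}))"
    by (rule union_disjoint) (simp_all add: disjoint_iff)
  also have "F ?h ({k, Suc k} \<union> Suc ` {Suc k..Suc m}) =
      f (F ?h {k, Suc k}) (F ?h (Suc ` {Suc k..Suc m}))"
    by (rule union_disjoint) simp_all
  also have "F ?h {1..<k} = F ?w {1..<k}"
    by (rule cong) (simp_all add: u)
  also have "F ?h (Suc ` {Suc k..Suc m}) = F ?w {Suc k..Suc m}"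
    unfolding reindex[OF inj_Suc[of "{Suc k..Suc m}"]] by (rule cong) (simp_all add: u)
  also have "F ?h {k, Suc k} = f (g (l * wts u m k)) (g (r * wts u m k))"
    by (simp add: u)
  finally have "F ?h {1..Suc (Suc m)} = f (F ?w {1..<k}) (f (f (g (l * wts u m k)) (g (r * wts u m k))) (F ?w {Suc k..Suc m}))" .
  moreover have "{1..Suc m} - {k} = {1..<k} \<union> {Suc k..Suc m}"
    using k by auto
  moreover have "F ?w ({1..<k} \<union> {Suc k..Suc m}) = f (F ?w {1..<k}) (F ?w {Suc k..Suc m})"
    by (rule union_disjoint) (simp_all add: disjoint_iff)
  ultimately show ?thesis
    by (simp only: left_commute)
qed

lemma betas_wts:
  assumes "\<And>i. 1 \<le> i \<Longrightarrow> i \<le> m \<Longrightarrow> 1 \<le> I i \<and> I i \<le> i"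
  shows "length (betas LR I (Suc m)) = Suc m \<and>
    (\<forall>j\<in>{1..Suc m}. betas LR I (Suc m) ! (j - 1) = wts (\<lambda>i. (I i, LR i)) m j)"
  using assms
proof (induction m)
  case (Suc m)
  define b where "b = betas LR I (Suc m)"
  define k where "k = I (Suc m)"
  have k: "1 \<le> k" "k \<le> Suc m" using Suc.prems[of "Suc m"] by (auto simp: k_def)
  have len: "length b = Suc m" and
    b: "\<And>j. 1 \<le> j \<Longrightarrow> j \<le> Suc m \<Longrightarrow> b ! (j - 1) = wts (\<lambda>i. (I i, LR i)) m j"
    using Suc by (auto simp: b_def)
  \<comment> \<open>The list of two leaves has its own clause in \<open>betas\<close>; it fits the
    general form because the range condition forces \<open>I 1 = 1\<close>.\<close>
  have rec: "betas LR I (Suc (Suc m)) =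
     take (k - 1) b @ [fst (LR (Suc m)) * b ! (k - 1), snd (LR (Suc m)) * b ! (k - 1)] @ drop k b"
  proof (cases m)
    case 0
    then show ?thesis using k by (simp add: b_def)
  next
    case (Suc m')
    then show ?thesis by (simp add: b_def k_def Let_def)
  qed
  show ?case
  proof (intro conjI ballI)
    show "length (betas LR I (Suc (Suc m))) = Suc (Suc m)"
      unfolding rec using len k by auto
    fix j assume j: "j \<in> {1..Suc (Suc m)}"
    consider "j < k" | "j = k" | "j = Suc k" | "j > Suc k" by linarith
    then show "betas LR I (Suc (Suc m)) ! (j - 1) = wts (\<lambda>i. (I i, LR i)) (Suc m) j"
    proof cases
      case 1
      then show ?thesis using j k len b[of j] unfolding rec
        by (simp add: nth_append k_def[symmetric] less_diff_conv)
    next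
      case 2
      then show ?thesis using j k len b[of j] unfolding rec
        by (simp add: nth_append k_def[symmetric])
    next
      case 3
      then show ?thesis using j k len b[of k] unfolding rec
        by (cases k) (simp_all add: nth_append k_def[symmetric])
    next
      case 4
      then obtain i where i: "j = Suc (Suc (k + i))" using less_iff_Suc_add by auto
      obtain k' where k': "k = Suc k'" using k by (cases k) auto
      show ?thesis using j k len b[of "j - 1"] unfolding rec i
        by (simp add: nth_append k_def[symmetric] k' add.commute)
    qed
  qed
qed simp

section \<open>Laws of the weights and one-step recursions\<close>

definition node_law :: "(real \<times> real) measure \<Rightarrow> nat \<Rightarrow> (nat \<times> (real \<times> real)) measure" where
  "node_law Q i = measure_pmf (pmf_of_set {1..i}) \<Otimes>\<^sub>M Q"

definition Omega :: "(real \<times> real) measure \<Rightarrow> nat \<Rightarrow> (nat \<Rightarrow> nat \<times> (real \<times> real)) measure" where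
  "Omega Q m = PiM {1..m} (node_law Q)"

locale cascade = prob_space Q for Q :: "(real \<times> real) measure" +
  assumes sets_Q [measurable_cong]: "sets Q = sets borel"
begin

lemma sets_node_law [measurable_cong]: "sets (node_law Q i) = sets (count_space UNIV \<Otimes>\<^sub>M borel)"
  unfolding node_law_def by (intro sets_pair_measure_cong) (simp_all add: sets_Q)

lemma space_node_law [simp]: "space (node_law Q i) = UNIV"
  using sets_eq_imp_space_eq[OF sets_node_law] by (simp add: space_pair_measure)

lemma prob_space_node_law: "prob_space (node_law Q i)"
proof -
  interpret pair_prob_space "measure_pmf (pmf_of_set {1..i})" Q ..
  show ?thesis unfolding node_law_def by (rule prob_space_axioms)
qed

sublocale node: product_prob_space "node_law Q" UNIV
  by (rule product_prob_spaceI) (rule prob_space_node_law)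

lemma prob_space_Omega: "prob_space (Omega Q m)"
  unfolding Omega_def by (rule prob_space_PiM) (rule prob_space_node_law)

lemma wts_measurable [measurable]:
  "m \<le> n \<Longrightarrow> (\<lambda>u. wts u m j) \<in> borel_measurable (Omega Q n)"
proof (induction m arbitrary: j)
  case (Suc m)
  then have IH [measurable]: "\<And>j. (\<lambda>u. wts u m j) \<in> borel_measurable (Omega Q n)" by simp
  have c [measurable]: "(\<lambda>u. u (Suc m)) \<in> Omega Q n \<rightarrow>\<^sub>M count_space UNIV \<Otimes>\<^sub>M (borel \<Otimes>\<^sub>M borel)"
    unfolding Omega_def using Suc.prems
    by (subst measurable_cong_sets[OF refl, of _ "node_law Q (Suc m)"])
      (simp_all only: sets_node_law borel_prod, simp add: measurable_component_singleton)
  show ?case by simp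
qed simp

lemma nn_integral_node_law:
  assumes [measurable]: "f \<in> borel_measurable (node_law Q (Suc i))"
  shows "(\<integral>\<^sup>+y. f y \<partial>node_law Q (Suc i)) = (\<Sum>k=1..Suc i. \<integral>\<^sup>+q. f (k, q) \<partial>Q) / ennreal (Suc i)"
proof -
  have [measurable]: "f \<in> borel_measurable (measure_pmf (pmf_of_set {1..Suc i}) \<Otimes>\<^sub>M Q)"
    using assms by (simp add: node_law_def)
  have "(\<integral>\<^sup>+y. f y \<partial>node_law Q (Suc i)) = (\<integral>\<^sup>+k. \<integral>\<^sup>+q. f (k, q) \<partial>Q \<partial>measure_pmf (pmf_of_set {1..Suc i}))"
    unfolding node_law_def by (simp add: nn_integral_fst)
  also have "\<dots> = (\<Sum>k=1..Suc i. \<integral>\<^sup>+q. f (k, q) \<partial>Q) / ennreal (Suc i)"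
    by (subst nn_integral_pmf_of_set) (auto simp: ennreal_of_nat_eq_real_of_nat)
  finally show ?thesis .
qed

lemma integral_node_law:
  fixes f :: "_ \<Rightarrow> complex"
  assumes f: "f \<in> borel_measurable (node_law Q (Suc i))" "\<And>y. norm (f y) \<le> B"
  shows "(\<integral>y. f y \<partial>node_law Q (Suc i)) = (\<Sum>k=1..Suc i. \<integral>q. f (k, q) \<partial>Q) / of_nat (Suc i)"
proof -
  interpret P: pair_prob_space "measure_pmf (pmf_of_set {1..Suc i})" Q ..
  have [measurable]: "f \<in> borel_measurable (measure_pmf (pmf_of_set {1..Suc i}) \<Otimes>\<^sub>M Q)"
    using f by (simp add: node_law_def)
  have "(\<integral>y. f y \<partial>node_law Q (Suc i)) = (\<integral>k. \<integral>q. f (k, q) \<partial>Q \<partial>measure_pmf (pmf_of_set {1..Suc i}))"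
    unfolding node_law_def
    by (rule P.integral_fst'[symmetric]) (rule P.integrable_const_bound[of _ B]; simp add: f)
  also have "\<dots> = (\<Sum>k=1..Suc i. \<integral>q. f (k, q) \<partial>Q) / of_nat (Suc i)"
    by (subst integral_measure_pmf[of "{1..Suc i}"])
      (auto simp: sum_distrib_left scaleR_conv_of_real divide_inverse mult.commute simp del: sum.cl_ivl_Suc)
  finally show ?thesis .
qed

lemma nn_integral_Omega_Suc:
  assumes f: "f \<in> borel_measurable (Omega Q (Suc m))"
  shows "(\<integral>\<^sup>+u. f u \<partial>Omega Q (Suc m)) =
    (\<integral>\<^sup>+u. (\<Sum>k=1..Suc m. \<integral>\<^sup>+q. f (u(Suc m := (k, q))) \<partial>Q) / ennreal (Suc m) \<partial>Omega Q m)"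
proof -
  have f': "f \<in> borel_measurable (PiM (insert (Suc m) {1..m}) (node_law Q))"
    using f by (simp add: Omega_def atLeastAtMostSuc_conv)
  have "(\<integral>\<^sup>+u. f u \<partial>Omega Q (Suc m)) =
      (\<integral>\<^sup>+u. \<integral>\<^sup>+y. f (u(Suc m := y)) \<partial>node_law Q (Suc m) \<partial>Omega Q m)"
    unfolding Omega_def using node.product_nn_integral_insert[OF _ _ f']
    by (simp add: atLeastAtMostSuc_conv)
  also have "\<dots> = (\<integral>\<^sup>+u. (\<Sum>k=1..Suc m. \<integral>\<^sup>+q. f (u(Suc m := (k, q))) \<partial>Q) / ennreal (Suc m) \<partial>Omega Q m)"
  proof (intro nn_integral_cong nn_integral_node_law)
    fix u assume "u \<in> space (Omega Q m)"
    then show "(\<lambda>y. f (u(Suc m := y))) \<in> borel_measurable (node_law Q (Suc m))"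
      using f' by (intro measurable_compose[OF _ f'] measurable_fun_upd[of _ "{1..m}"])
        (auto simp: Omega_def)
  qed
  finally show ?thesis .
qed

lemma integral_Omega_Suc:
  fixes f :: "_ \<Rightarrow> complex"
  assumes f: "f \<in> borel_measurable (Omega Q (Suc m))" and B: "\<And>u. norm (f u) \<le> B"
  shows "(\<integral>u. f u \<partial>Omega Q (Suc m)) =
    (\<integral>u. (\<Sum>k=1..Suc m. \<integral>q. f (u(Suc m := (k, q))) \<partial>Q) / of_nat (Suc m) \<partial>Omega Q m)"
proof -
  interpret O: prob_space "Omega Q (Suc m)" by (rule prob_space_Omega)
  have f': "f \<in> borel_measurable (PiM (insert (Suc m) {1..m}) (node_law Q))"
    using f by (simp add: Omega_def atLeastAtMostSuc_conv)
  have "integrable (Omega Q (Suc m)) f"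
    using f B by (intro O.integrable_const_bound[of _ B]) auto
  then have int: "integrable (PiM (insert (Suc m) {1..m}) (node_law Q)) f"
    by (simp add: Omega_def atLeastAtMostSuc_conv)
  have "(\<integral>u. f u \<partial>Omega Q (Suc m)) =
      (\<integral>u. \<integral>y. f (u(Suc m := y)) \<partial>node_law Q (Suc m) \<partial>Omega Q m)"
    unfolding Omega_def using node.product_integral_insert[OF _ _ int]
    by (simp add: atLeastAtMostSuc_conv)
  also have "\<dots> = (\<integral>u. (\<Sum>k=1..Suc m. \<integral>q. f (u(Suc m := (k, q))) \<partial>Q) / of_nat (Suc m) \<partial>Omega Q m)"
  proof (intro Bochner_Integration.integral_cong refl integral_node_law[where B=B])
    fix u assume "u \<in> space (Omega Q m)"
    then show "(\<lambda>y. f (u(Suc m := y))) \<in> borel_measurable (node_law Q (Suc m))"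
      using f' by (intro measurable_compose[OF _ f'] measurable_fun_upd[of _ "{1..m}"])
        (auto simp: Omega_def)
  qed (rule B)
  finally show ?thesis .
qed

lemma wts_upd [simp]: "wts (u(Suc m := y)) m j = wts u m j"
  by (rule wts_cong) auto

section \<open>Mean products and mean power sums over the leaves\<close>

definition Eprod :: "nat \<Rightarrow> (real \<Rightarrow> complex) \<Rightarrow> complex" where
  "Eprod m g = (\<integral>u. (\<Prod>j=1..Suc m. g (wts u m j)) \<partial>Omega Q m)"

lemma Eprod_0: "Eprod 0 g = g 1"
proof -
  interpret O: prob_space "Omega Q 0" by (rule prob_space_Omega)
  show ?thesis by (simp add: Eprod_def O.prob_space)
qed

lemma prod_wts_bounded:
  fixes g :: "real \<Rightarrow> complex"
  assumes "\<And>b. norm (g b) \<le> 1"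
  shows "norm (\<Prod>j\<in>J. g (wts u m j)) \<le> 1"
  unfolding prod_norm[symmetric] by (rule prod_le_1) (simp add: assms)

lemma norm_Eprod_le_1:
  assumes "g \<in> borel_measurable borel" "\<And>b. norm (g b) \<le> 1"
  shows "norm (Eprod m g) \<le> 1"
proof -
  interpret O: prob_space "Omega Q m" by (rule prob_space_Omega)
  have "norm (Eprod m g) \<le> (\<integral>u. norm (\<Prod>j=1..Suc m. g (wts u m j)) \<partial>Omega Q m)"
    unfolding Eprod_def by (rule integral_norm_bound)
  also have "\<dots> \<le> (\<integral>u. 1 \<partial>Omega Q m)"
    using assms(1) prod_wts_bounded[of g, OF assms(2)]
    by (intro integral_mono O.integrable_const_bound[of _ 1]) (auto simp del: prod.cl_ivl_Suc)
  finally show ?thesis by (simp add: O.prob_space)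
qed

text \<open>The last split replaces the factor of one uniformly chosen leaf \<open>k\<close> and
  keeps the others. The result is a sum over \<open>k\<close> of products with one factor exchanged,
  the shape that the product rule gives for a derivative.\<close>

lemma Eprod_Suc:
  assumes g [measurable]: "g \<in> borel_measurable borel" and g1: "\<And>b. norm (g b) \<le> 1"
  shows "Eprod (Suc m) g = (\<integral>u. (\<Sum>k=1..Suc m. (\<integral>q. g (fst q * wts u m k) * g (snd q * wts u m k) \<partial>Q) *
     (\<Prod>j\<in>{1..Suc m}-{k}. g (wts u m j))) \<partial>Omega Q m) / of_nat (Suc m)"
proof -
  have "Eprod (Suc m) g = (\<integral>u. (\<Sum>k=1..Suc m. \<integral>q. (\<Prod>j=1..Suc (Suc m). g (wts (u(Suc m := (k, q))) (Suc m) j)) \<partial>Q)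
      / of_nat (Suc m) \<partial>Omega Q m)"
    unfolding Eprod_def using prod_wts_bounded[of g, OF g1]
    by (subst integral_Omega_Suc[where B=1]) (auto simp del: prod.cl_ivl_Suc sum.cl_ivl_Suc wts.simps)
  also have "\<dots> = (\<integral>u. (\<Sum>k=1..Suc m. (\<integral>q. g (fst q * wts u m k) * g (snd q * wts u m k) \<partial>Q) *
     (\<Prod>j\<in>{1..Suc m}-{k}. g (wts u m j))) / of_nat (Suc m) \<partial>Omega Q m)"
  proof (intro Bochner_Integration.integral_cong refl arg_cong2[where f="(/)"] sum.cong)
    fix u k assume k: "k \<in> {1..Suc m}"
    have "(\<Prod>j=1..Suc (Suc m). g (wts (u(Suc m := (k, q))) (Suc m) j)) =
      g (fst q * wts u m k) * g (snd q * wts u m k) * (\<Prod>j\<in>{1..Suc m}-{k}. g (wts u m j))" for q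
      using k by (subst prod.split_leaf[where k=k and l="fst q" and r="snd q"]) auto
    then show "(\<integral>q. (\<Prod>j=1..Suc (Suc m). g (wts (u(Suc m := (k, q))) (Suc m) j)) \<partial>Q) =
      (\<integral>q. g (fst q * wts u m k) * g (snd q * wts u m k) \<partial>Q) * (\<Prod>j\<in>{1..Suc m}-{k}. g (wts u m j))"
      by simp
  qed
  finally show ?thesis by simp
qed

definition Esum :: "nat \<Rightarrow> real \<Rightarrow> ennreal" where
  "Esum m s = (\<integral>\<^sup>+u. (\<Sum>j=1..Suc m. ennreal (wts u m j powr s)) \<partial>Omega Q m)"

text \<open>A split at leaf \<open>k\<close> turns \<open>w^s\<close> into
  \<open>(l^s + r^s) w^s\<close>, of mean \<open>c w^s\<close>, and keeps the \<open>m\<close> other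
  leaves. The factor results from averaging over the \<open>m + 1\<close> choices of
  \<open>k\<close>.\<close>

lemma Esum_Suc:
  assumes c: "(\<integral>\<^sup>+q. ennreal (fst q powr s + snd q powr s) \<partial>Q) = c"
  shows "Esum (Suc m) s = (c + of_nat m) / ennreal (Suc m) * Esum m s"
proof -
  let ?w = "\<lambda>u j. ennreal (wts u m j powr s)"
  have meas: "fst \<in> borel_measurable Q" "snd \<in> borel_measurable Q"
    by (simp_all add: measurable_cong_sets[OF sets_Q refl] borel_prod[symmetric])
  note [measurable] = meas
  have "Esum (Suc m) s = (\<integral>\<^sup>+u. (\<Sum>k=1..Suc m. \<integral>\<^sup>+q. (\<Sum>j=1..Suc (Suc m). ennreal (wts (u(Suc m := (k, q))) (Suc m) j powr s)) \<partial>Q)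
      / ennreal (Suc m) \<partial>Omega Q m)"
    unfolding Esum_def
    by (subst nn_integral_Omega_Suc) (auto simp del: sum.cl_ivl_Suc wts.simps)
  also have "\<dots> = (\<integral>\<^sup>+u. (c + of_nat m) / ennreal (Suc m) * (\<Sum>k=1..Suc m. ?w u k) \<partial>Omega Q m)"
  proof (intro nn_integral_cong)
    fix u
    have "(\<integral>\<^sup>+q. (\<Sum>j=1..Suc (Suc m). ennreal (wts (u(Suc m := (k, q))) (Suc m) j powr s)) \<partial>Q) =
        c * ?w u k + (\<Sum>j\<in>{1..Suc m}-{k}. ?w u j)" if k: "k \<in> {1..Suc m}" for k
    proof -
      have "(\<Sum>j=1..Suc (Suc m). ennreal (wts (u(Suc m := (k, q))) (Suc m) j powr s)) =
        ennreal (fst q powr s + snd q powr s) * ?w u k + (\<Sum>j\<in>{1..Suc m}-{k}. ?w u j)" for q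
        using k by (subst sum.split_leaf[where k=k and l="fst q" and r="snd q"])
          (auto simp: powr_mult ennreal_mult distrib_right)
      then show ?thesis using c
        by (simp add: nn_integral_add nn_integral_multc emeasure_space_1)
    qed
    then have "(\<Sum>k=1..Suc m. \<integral>\<^sup>+q. (\<Sum>j=1..Suc (Suc m). ennreal (wts (u(Suc m := (k, q))) (Suc m) j powr s)) \<partial>Q) =
      (\<Sum>k=1..Suc m. c * ?w u k + (\<Sum>j\<in>{1..Suc m}-{k}. ?w u j))"
      by (intro sum.cong) auto
    also have "\<dots> = c * (\<Sum>k=1..Suc m. ?w u k) + (\<Sum>k=1..Suc m. \<Sum>j\<in>{1..Suc m}-{k}. ?w u j)"
      by (simp only: sum.distrib sum_distrib_left)
    also have "(\<Sum>k=1..Suc m. \<Sum>j\<in>{1..Suc m}-{k}. ?w u j) = (\<Sum>k=1..Suc m. \<Sum>j\<in>{j\<in>{1..Suc m}. k \<noteq> j}. ?w u j)"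
      by (intro sum.cong) auto
    \<comment> \<open>Exchanging the sums counts how often leaf \<open>j\<close> is kept: for
      \<open>m\<close> of the \<open>m + 1\<close> choices of \<open>k\<close>.\<close>
    also have "\<dots> = (\<Sum>j=1..Suc m. \<Sum>k\<in>{k\<in>{1..Suc m}. k \<noteq> j}. ?w u j)"
      by (rule sum.swap_restrict) auto
    also have "\<dots> = (\<Sum>j=1..Suc m. of_nat m * ?w u j)"
    proof (intro sum.cong refl)
      fix j assume "j \<in> {1..Suc m}"
      moreover have "{k\<in>{1..Suc m}. k \<noteq> j} = {1..Suc m} - {j}" by auto
      ultimately show "(\<Sum>k\<in>{k\<in>{1..Suc m}. k \<noteq> j}. ?w u j) = of_nat m * ?w u j"
        by simp
    qed
    also have "\<dots> = of_nat m * (\<Sum>j=1..Suc m. ?w u j)"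
      by (simp only: sum_distrib_left)
    finally show "(\<Sum>k=1..Suc m. \<integral>\<^sup>+q. (\<Sum>j=1..Suc (Suc m). ennreal (wts (u(Suc m := (k, q))) (Suc m) j powr s)) \<partial>Q) / ennreal (Suc m) =
      (c + of_nat m) / ennreal (Suc m) * (\<Sum>k=1..Suc m. ?w u k)"
      by (simp only: distrib_right distrib_left divide_ennreal_def mult.assoc mult.commute mult.left_commute)
  qed
  also have "\<dots> = (c + of_nat m) / ennreal (Suc m) * Esum m s"
    unfolding Esum_def by (rule nn_integral_cmult) (auto simp del: sum.cl_ivl_Suc)
  finally show ?thesis .
qed

end

section \<open>Mixtures over the number of splits\<close>

lemma tendsto_integral_dominated:
  fixes f :: "real \<Rightarrow> 'a \<Rightarrow> 'b::{banach, second_countable_topology}"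
  assumes meas: "\<And>y. y \<in> S \<Longrightarrow> f y \<in> borel_measurable M" "g \<in> borel_measurable M"
    and lim: "\<And>w. w \<in> space M \<Longrightarrow> ((\<lambda>y. f y w) \<longlongrightarrow> g w) (at x within S)"
    and bound: "\<And>y w. y \<in> S \<Longrightarrow> w \<in> space M \<Longrightarrow> norm (f y w) \<le> B w"
    and B: "integrable M B"
  shows "((\<lambda>y. \<integral>w. f y w \<partial>M) \<longlongrightarrow> (\<integral>w. g w \<partial>M)) (at x within S)"
  unfolding tendsto_at_iff_sequentially comp_def
proof (intro allI impI)
  fix X assume X: "\<forall>i. X i \<in> S - {x}" "X \<longlonglongrightarrow> x"
  show "(\<lambda>i. \<integral>w. f (X i) w \<partial>M) \<longlonglongrightarrow> (\<integral>w. g w \<partial>M)"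
  proof (rule integral_dominated_convergence[where w=B])
    show "AE w in M. (\<lambda>i. f (X i) w) \<longlonglongrightarrow> g w"
      using lim X unfolding tendsto_at_iff_sequentially comp_def by (intro AE_I2) blast
    show "AE w in M. norm (f (X i) w) \<le> B w" for i
      using X bound by (intro AE_I2) blast
  qed (use meas X B in auto)
qed

lemma (in finite_measure) tendsto_integral_bounded:
  fixes f :: "real \<Rightarrow> 'a \<Rightarrow> 'b::{banach, second_countable_topology}"
  assumes "\<And>y. y \<in> S \<Longrightarrow> f y \<in> borel_measurable M" "g \<in> borel_measurable M"
    and "\<And>w. w \<in> space M \<Longrightarrow> ((\<lambda>y. f y w) \<longlongrightarrow> g w) (at x within S)"
    and "\<And>y w. y \<in> S \<Longrightarrow> w \<in> space M \<Longrightarrow> norm (f y w) \<le> B"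
  shows "((\<lambda>y. \<integral>w. f y w \<partial>M) \<longlongrightarrow> (\<integral>w. g w \<partial>M)) (at x within S)"
  using assms by (rule tendsto_integral_dominated) auto

text \<open>The mean value inequality on the convex set \<open>S\<close> bounds the difference
  quotients of \<open>f\<close> by \<open>B\<close>, so the remainder \<open>?G\<close> is bounded
  by \<open>2 * B\<close> uniformly and dominated convergence applies.\<close>

lemma (in finite_measure) has_vector_derivative_integral:
  fixes f :: "real \<Rightarrow> 'a \<Rightarrow> 'b::{banach, second_countable_topology}"
  assumes S: "convex S" "x \<in> S"
    and meas: "\<And>y. y \<in> S \<Longrightarrow> f y \<in> borel_measurable M" "f' x \<in> borel_measurable M"
    and int: "\<And>y. y \<in> S \<Longrightarrow> integrable M (f y)"
    and der: "\<And>y w. y \<in> S \<Longrightarrow> w \<in> space M \<Longrightarrow> ((\<lambda>y. f y w) has_vector_derivative f' y w) (at y within S)"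
    and bound: "\<And>y w. y \<in> S \<Longrightarrow> w \<in> space M \<Longrightarrow> norm (f' y w) \<le> B"
  shows "((\<lambda>y. \<integral>w. f y w \<partial>M) has_vector_derivative (\<integral>w. f' x w \<partial>M)) (at x within S)"
  unfolding has_vector_derivative_def has_derivative_within
proof (intro conjI bounded_linear_scaleR_left)
  let ?G = "\<lambda>y w. (1 / norm (y - x)) *\<^sub>R (f y w - (f x w + (y - x) *\<^sub>R f' x w))"
  have int': "integrable M (f' x)"
    using meas bound[OF S(2)] by (intro integrable_const_bound[of _ B]) auto
  have "((\<lambda>y. \<integral>w. ?G y w \<partial>M) \<longlongrightarrow> (\<integral>w. 0 \<partial>M)) (at x within S)"
  proof (rule tendsto_integral_bounded[where B="2 * B"])
    fix w assume w: "w \<in> space M"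
    show "((\<lambda>y. ?G y w) \<longlongrightarrow> 0) (at x within S)"
      using der[OF S(2) w] unfolding has_vector_derivative_def has_derivative_within by simp
    fix y assume y: "y \<in> S"
    have "norm (f y w - f x w) \<le> B * norm (y - x)"
    proof (rule differentiable_bound[OF S(1) _ _ y S(2)])
      fix z assume z: "z \<in> S"
      show "((\<lambda>y. f y w) has_derivative (\<lambda>h. h *\<^sub>R f' z w)) (at z within S)"
        using der[OF z w] by (simp add: has_vector_derivative_def)
      show "onorm (\<lambda>h. h *\<^sub>R f' z w) \<le> B"
        using bound[OF z w] by (intro onorm_le) (auto simp: mult.commute[of B] mult_left_mono)
    qed
    moreover have "norm ((y - x) *\<^sub>R f' x w) \<le> B * norm (y - x)"
      using bound[OF S(2) w] by (simp add: mult.commute[of B] mult_left_mono)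
    ultimately have "norm (f y w - (f x w + (y - x) *\<^sub>R f' x w)) \<le> 2 * B * norm (y - x)"
      using norm_triangle_ineq4[of "f y w - f x w" "(y - x) *\<^sub>R f' x w"]
      by (simp add: algebra_simps)
    moreover have "0 \<le> B" using bound[OF S(2) w] norm_ge_zero order_trans by blast
    ultimately show "norm (?G y w) \<le> 2 * B"
      unfolding norm_scaleR by (cases "y = x") (simp_all add: pos_divide_le_eq)
  qed (use meas S in auto)
  moreover have eq: "(\<integral>w. ?G y w \<partial>M) = (1 / norm (y - x)) *\<^sub>R
      ((\<integral>w. f y w \<partial>M) - ((\<integral>w. f x w \<partial>M) + (y - x) *\<^sub>R (\<integral>w. f' x w \<partial>M)))" if "y \<in> S" for y
    using int int' that S by simp
  ultimately show "((\<lambda>y. (1 / norm (y - x)) *\<^sub>R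
      ((\<integral>w. f y w \<partial>M) - ((\<integral>w. f x w \<partial>M) + (y - x) *\<^sub>R (\<integral>w. f' x w \<partial>M)))) \<longlongrightarrow> 0) (at x within S)"
    by (subst tendsto_cong[of _ "\<lambda>y. \<integral>w. ?G y w \<partial>M"])
      (auto simp only: eventually_at_filter eq integral_zero intro!: always_eventually)
qed

abbreviation unif01 :: "real measure" where
  "unif01 \<equiv> uniform_measure lborel {0<..<1}"

lemma integral_unif01:
  fixes f :: "real \<Rightarrow> 'b::{banach, second_countable_topology}"
  assumes [measurable]: "f \<in> borel_measurable borel"
  shows "(\<integral>\<theta>. f \<theta> \<partial>unif01) = (LINT \<theta>:{0<..<1}|lborel. f \<theta>)"
proof -
  have "unif01 = density lborel (\<lambda>x. ennreal (indicator {0<..<1} x))"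
    unfolding uniform_measure_def by (simp add: ennreal_indicator divide_ennreal_def)
  then show ?thesis
    by (simp add: integral_density set_lebesgue_integral_def)
qed

lemma prob_space_unif01: "prob_space unif01"
  by (rule prob_space_uniform_measure) auto

text \<open>The substitution \<open>v = x \<theta>\<close> shows that \<open>x \<phi>(c x^S)\<close>
  is the integral of \<open>\<psi>(c v^S)\<close> over \<open>{0<..<x}\<close>. The derivative of
  that integral is the integrand, and dividing by \<open>x\<close> gives the formula.\<close>

lemma integral_unif01_powr_has_derivative:
  fixes \<psi> :: "real \<Rightarrow> complex"
  assumes cont: "continuous_on UNIV \<psi>" and bound: "\<And>s. norm (\<psi> s) \<le> 1"
    and \<phi>: "\<And>s. \<phi> s = (\<integral>\<theta>. \<psi> (s * \<theta> powr S) \<partial>unif01)" and x: "0 < x"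
  shows "((\<lambda>x. \<phi> (c * x powr S)) has_vector_derivative
    ((\<psi> (c * x powr S) - \<phi> (c * x powr S)) /\<^sub>R x)) (at x)"
proof -
  let ?f = "\<lambda>v. \<psi> (c * v powr S)"
  have [measurable]: "\<psi> \<in> borel_measurable borel"
    using cont by (rule borel_measurable_continuous_onI)
  have int: "set_integrable lborel A ?f" if "A \<in> sets borel" "emeasure lborel A < \<infinity>" for A
    unfolding set_integrable_def using that bound
    by (intro integrableI_bounded_set[where A=A and B=1]) (auto split: split_indicator)
  have K: "y *\<^sub>R \<phi> (c * y powr S) = (LINT v:{0<..<y}|lborel. ?f v)" if y: "0 < y" for y
  proof -
    have "(LINT v:{0<..<y}|lborel. ?f v) =
        y *\<^sub>R (\<integral>\<theta>. indicator {0<..<y} (y * \<theta>) *\<^sub>R ?f (y * \<theta>) \<partial>lborel)"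
      unfolding set_lebesgue_integral_def
      using lborel_integral_real_affine[of y "\<lambda>v. indicator {0<..<y} v *\<^sub>R ?f v" 0] y by simp
    also have "(\<lambda>\<theta>. indicator {0<..<y} (y * \<theta>) *\<^sub>R ?f (y * \<theta>)) =
        (\<lambda>\<theta>. indicator {0<..<1} \<theta> *\<^sub>R \<psi> ((c * y powr S) * \<theta> powr S))"
      using y by (auto simp: fun_eq_iff powr_mult mult.assoc zero_less_mult_iff split: split_indicator)
    also have "(\<integral>\<theta>. indicator {0<..<1} \<theta> *\<^sub>R \<psi> ((c * y powr S) * \<theta> powr S) \<partial>lborel) = \<phi> (c * y powr S)"
      by (simp add: \<phi> integral_unif01 set_lebesgue_integral_def)
    finally show ?thesis ..
  qed
  \<comment> \<open>The fundamental theorem is applied from \<open>x / 2\<close> upwards, because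
    \<open>v powr S\<close> need not be continuous at \<open>0\<close>; the integral over
    \<open>{0<..?a}\<close> is a constant.\<close>
  let ?a = "x / 2" and ?b = "2 * x"
  have split: "y *\<^sub>R \<phi> (c * y powr S) = (LINT v:{0<..?a}|lborel. ?f v) + (LBINT v=?a..y. ?f v)"
    if y: "y \<in> {?a<..<?b}" for y
  proof -
    have "{0<..<y} = {0<..?a} \<union> {?a<..<y}" using x y by auto
    then have "(LINT v:{0<..<y}|lborel. ?f v) =
        (LINT v:{0<..?a}|lborel. ?f v) + (LINT v:{?a<..<y}|lborel. ?f v)"
      using x y by (simp only:) (rule set_integral_Un[OF _ int int], auto)
    also have "(LINT v:{?a<..<y}|lborel. ?f v) = (LBINT v=?a..y. ?f v)"
      using y by (simp add: interval_lebesgue_integral_def)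
    finally show ?thesis using K[of y] x y by simp
  qed
  have "continuous_on {?a..?b} ?f"
    using x by (intro continuous_intros continuous_on_compose2[OF cont]) auto
  then have "((\<lambda>y. LBINT v=?a..y. ?f v) has_vector_derivative ?f x) (at x within {?a..?b})"
    using x by (intro interval_integral_FTC2) auto
  then have "((\<lambda>y. LBINT v=?a..y. ?f v) has_vector_derivative ?f x) (at x within {?a<..<?b})"
    by (rule has_vector_derivative_within_subset) auto
  then have "((\<lambda>y. LBINT v=?a..y. ?f v) has_vector_derivative ?f x) (at x)"
    by (subst (asm) has_vector_derivative_within_open) (use x in auto)
  then have "((\<lambda>y. (LINT v:{0<..?a}|lborel. ?f v) + (LBINT v=?a..y. ?f v)) has_vector_derivative (0 + ?f x)) (at x)"
    by (intro derivative_intros)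
  then have D: "((\<lambda>y. y *\<^sub>R \<phi> (c * y powr S)) has_vector_derivative ?f x) (at x)"
    using x split
    by (auto intro: has_vector_derivative_transform_within_open[where S="{?a<..<?b}"])
  have "((\<lambda>y. inverse y *\<^sub>R (y *\<^sub>R \<phi> (c * y powr S))) has_vector_derivative
      (inverse x *\<^sub>R ?f x + (- (inverse x * inverse x)) *\<^sub>R (x *\<^sub>R \<phi> (c * x powr S)))) (at x)"
    using x by (intro has_vector_derivative_scaleR D derivative_eq_intros) auto
  moreover have "inverse x *\<^sub>R ?f x + (- (inverse x * inverse x)) *\<^sub>R (x *\<^sub>R \<phi> (c * x powr S)) =
      (?f x - \<phi> (c * x powr S)) /\<^sub>R x"
    using x by (simp add: algebra_simps)
  ultimately have "((\<lambda>y. inverse y *\<^sub>R (y *\<^sub>R \<phi> (c * y powr S))) has_vector_derivative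
      (?f x - \<phi> (c * x powr S)) /\<^sub>R x) (at x)" by simp
  then show ?thesis
    by (rule has_vector_derivative_transform_within_open[where S="{0<..}"]) (use x in auto)
qed

section \<open>Geometric mixtures of the mean products\<close>

context cascade begin

lemma fst_Q [measurable]: "fst \<in> borel_measurable Q" and snd_Q [measurable]: "snd \<in> borel_measurable Q"
  by (simp_all add: measurable_cong_sets[OF sets_Q refl] borel_prod[symmetric])

text \<open>With \<open>x = exp (- t)\<close>, a Yule process started at \<open>1\<close> has \<open>m\<close> splits at time \<open>t\<close> with
  probability \<open>x (1 - x)^m\<close>.\<close>

definition Emix :: "real \<Rightarrow> (real \<Rightarrow> complex) \<Rightarrow> complex" where
  "Emix x g = (\<Sum>m. of_real (x * (1 - x) ^ m) * Eprod m g)"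

lemma geometric_weights_sums: "0 < x \<Longrightarrow> x < 1 \<Longrightarrow> (\<lambda>m. x * (1 - x) ^ m) sums (1::real)"
  using sums_mult[OF geometric_sums[of "1 - x"], of x] by simp

lemma summable_Emix:
  assumes x: "0 < x" "x < 1" and g: "g \<in> borel_measurable borel" "\<And>b. norm (g b) \<le> 1"
  shows "summable (\<lambda>m. of_real (x * (1 - x) ^ m) * Eprod m g)"
proof (rule summable_comparison_test'[of "\<lambda>m. x * (1 - x) ^ m" 0])
  show "summable (\<lambda>m. x * (1 - x) ^ m)" using geometric_weights_sums[OF x] by (rule sums_summable)
  show "norm (of_real (x * (1 - x) ^ m) * Eprod m g) \<le> x * (1 - x) ^ m" for m
    unfolding norm_mult norm_of_real using norm_Eprod_le_1[OF g, of m] x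
    by (simp add: abs_mult mult_left_le)
qed

text \<open>The growth factors \<open>(1 + \<sigma> + m) / (m + 1)\<close> of
  \<open>Esum_Suc\<close> multiply to this quotient, starting from \<open>1\<close> for the tree
  without splits.\<close>

lemma Esum_eq:
  assumes c: "(\<integral>\<^sup>+q. ennreal (fst q powr s + snd q powr s) \<partial>Q) = ennreal (1 + \<sigma>)" "-1 < \<sigma>"
  shows "Esum m s = ennreal (pochhammer (1 + \<sigma>) m / fact m)"
proof (induction m)
  case 0
  interpret O: prob_space "Omega Q 0" by (rule prob_space_Omega)
  show ?case by (simp add: Esum_def O.emeasure_space_1)
next
  case (Suc m)
  have "Esum (Suc m) s = (ennreal (1 + \<sigma>) + of_nat m) / ennreal (Suc m) * ennreal (pochhammer (1 + \<sigma>) m / fact m)"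
    using Esum_Suc[OF c(1)] Suc by simp
  also have "ennreal (1 + \<sigma>) + of_nat m = ennreal (1 + \<sigma> + m)"
    using c(2) by (simp add: ennreal_of_nat_eq_real_of_nat)
  also have "\<dots> / ennreal (Suc m) * ennreal (pochhammer (1 + \<sigma>) m / fact m) =
      ennreal ((1 + \<sigma> + m) / Suc m * (pochhammer (1 + \<sigma>) m / fact m))"
    using c(2) pochhammer_nonneg[of "1 + \<sigma>" m]
    by (subst divide_ennreal) (auto simp flip: ennreal_mult)
  also have "(1 + \<sigma> + m) / Suc m * (pochhammer (1 + \<sigma>) m / fact m) = pochhammer (1 + \<sigma>) (Suc m) / fact (Suc m)"
    by (simp add: pochhammer_Suc mult.commute)
  finally show ?case .
qed

text \<open>Binomial series of \<open>x powr (- 1 - \<sigma>)\<close> in powers of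
  \<open>1 - x\<close>. With \<open>x = exp (- t)\<close> it shows that the expected power sum at
  time \<open>t\<close> of the Yule process is exactly \<open>exp (\<sigma> t)\<close>.\<close>

lemma pochhammer_mix_sums:
  fixes \<sigma> :: real
  assumes x: "0 < x" "x < 1"
  shows "(\<lambda>m. x * (1 - x) ^ m * (pochhammer (1 + \<sigma>) m / fact m)) sums (x powr (- \<sigma>))"
proof -
  have "(\<lambda>m. x * ((- 1 - \<sigma> gchoose m) * (x - 1) ^ m)) sums (x * (1 + (x - 1)) powr (- 1 - \<sigma>))"
    using x by (intro sums_mult gen_binomial_real) auto
  moreover have "(- 1 - \<sigma> gchoose m) * (x - 1) ^ m = (1 - x) ^ m * (pochhammer (1 + \<sigma>) m / fact m)" for m
    using power_mult_distrib[of "-1" "x - 1" m] by (simp add: gbinomial_pochhammer add.commute)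
  moreover have "x * (1 + (x - 1)) powr (- 1 - \<sigma>) = x powr (- \<sigma>)"
    using x powr_mult_base[of x "- 1 - \<sigma>"] by simp
  ultimately show ?thesis by (simp add: mult.assoc)
qed

text \<open>Two products with factors in the unit disc differ by at most the sum of the differences
  of their factors, which turns the pointwise bound into power sums.\<close>

lemma norm_Eprod_diff_le:
  assumes g: "g \<in> borel_measurable borel" "\<And>b. norm (g b) \<le> 1"
    and h: "h \<in> borel_measurable borel" "\<And>b. norm (h b) \<le> 1"
    and diff: "\<And>b. norm (g b - h b) \<le> e1 * b powr s1 + e2 * b powr s2" "0 \<le> e1" "0 \<le> e2"
    and c1: "(\<integral>\<^sup>+q. ennreal (fst q powr s1 + snd q powr s1) \<partial>Q) = ennreal (1 + \<sigma>1)" "-1 < \<sigma>1"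
    and c2: "(\<integral>\<^sup>+q. ennreal (fst q powr s2 + snd q powr s2) \<partial>Q) = ennreal (1 + \<sigma>2)" "-1 < \<sigma>2"
  shows "norm (Eprod m g - Eprod m h) \<le>
    e1 * (pochhammer (1 + \<sigma>1) m / fact m) + e2 * (pochhammer (1 + \<sigma>2) m / fact m)"
proof -
  interpret O: prob_space "Omega Q m" by (rule prob_space_Omega)
  note [measurable] = g(1) h(1)
  let ?P = "\<lambda>g u. \<Prod>j=1..Suc m. g (wts u m j)"
  have int: "integrable (Omega Q m) (?P g)" "integrable (Omega Q m) (?P h)"
    using prod_wts_bounded[of g, OF g(2)] prod_wts_bounded[of h, OF h(2)]
    by (auto intro!: O.integrable_const_bound[of _ 1] simp del: prod.cl_ivl_Suc)
  have "ennreal (norm (Eprod m g - Eprod m h)) = ennreal (norm (\<integral>u. ?P g u - ?P h u \<partial>Omega Q m))"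
    unfolding Eprod_def using int by simp
  also have "\<dots> \<le> (\<integral>\<^sup>+u. norm (?P g u - ?P h u) \<partial>Omega Q m)"
    using int by (intro integral_norm_bound_ennreal) auto
  also have "\<dots> \<le> (\<integral>\<^sup>+u. e1 * (\<Sum>j=1..Suc m. ennreal (wts u m j powr s1)) +
      e2 * (\<Sum>j=1..Suc m. ennreal (wts u m j powr s2)) \<partial>Omega Q m)"
  proof (intro nn_integral_mono)
    fix u
    have "norm (?P g u - ?P h u) \<le> (\<Sum>j=1..Suc m. norm (g (wts u m j) - h (wts u m j)))"
      by (rule norm_prod_diff) (auto simp: g h)
    also have "\<dots> \<le> (\<Sum>j=1..Suc m. e1 * wts u m j powr s1 + e2 * wts u m j powr s2)"
      by (intro sum_mono diff)
    also have "\<dots> = e1 * (\<Sum>j=1..Suc m. wts u m j powr s1) + e2 * (\<Sum>j=1..Suc m. wts u m j powr s2)"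
      by (simp only: sum.distrib sum_distrib_left)
    finally have "ennreal (norm (?P g u - ?P h u)) \<le>
        ennreal (e1 * (\<Sum>j=1..Suc m. wts u m j powr s1) + e2 * (\<Sum>j=1..Suc m. wts u m j powr s2))"
      by (rule ennreal_leI)
    also have "\<dots> = e1 * (\<Sum>j=1..Suc m. ennreal (wts u m j powr s1)) +
      e2 * (\<Sum>j=1..Suc m. ennreal (wts u m j powr s2))"
      using diff by (simp only: sum_ennreal powr_ge_zero) (simp add: ennreal_mult sum_nonneg)
    finally show "ennreal (norm (?P g u - ?P h u)) \<le> e1 * (\<Sum>j=1..Suc m. ennreal (wts u m j powr s1)) +
      e2 * (\<Sum>j=1..Suc m. ennreal (wts u m j powr s2))" .
  qed
  also have "\<dots> = e1 * Esum m s1 + e2 * Esum m s2"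
    unfolding Esum_def by (simp add: nn_integral_add nn_integral_cmult del: sum.cl_ivl_Suc)
  also have "\<dots> = ennreal (e1 * (pochhammer (1 + \<sigma>1) m / fact m) + e2 * (pochhammer (1 + \<sigma>2) m / fact m))"
    using pochhammer_nonneg[of "1 + \<sigma>1" m] pochhammer_nonneg[of "1 + \<sigma>2" m] c1(2) c2(2) diff
    unfolding Esum_eq[OF c1] Esum_eq[OF c2] by (simp flip: ennreal_mult)
  finally show ?thesis
    using c1(2) c2(2) diff by (subst (asm) ennreal_le_iff) (auto simp: pochhammer_nonneg)
qed

lemma norm_Emix_diff_le:
  assumes x: "0 < x" "x < 1"
    and g: "g \<in> borel_measurable borel" "\<And>b. norm (g b) \<le> 1"
    and h: "h \<in> borel_measurable borel" "\<And>b. norm (h b) \<le> 1"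
    and diff: "\<And>b. norm (g b - h b) \<le> e1 * b powr s1 + e2 * b powr s2" "0 \<le> e1" "0 \<le> e2"
    and c1: "(\<integral>\<^sup>+q. ennreal (fst q powr s1 + snd q powr s1) \<partial>Q) = ennreal (1 + \<sigma>1)" "-1 < \<sigma>1"
    and c2: "(\<integral>\<^sup>+q. ennreal (fst q powr s2 + snd q powr s2) \<partial>Q) = ennreal (1 + \<sigma>2)" "-1 < \<sigma>2"
  shows "norm (Emix x g - Emix x h) \<le> e1 * x powr (- \<sigma>1) + e2 * x powr (- \<sigma>2)"
proof -
  let ?p = "\<lambda>m. x * (1 - x) ^ m" and ?A = "\<lambda>\<sigma> m. pochhammer (1 + \<sigma>) m / fact m :: real"
  have "(\<lambda>m. e1 * (?p m * ?A \<sigma>1 m) + e2 * (?p m * ?A \<sigma>2 m)) sums (e1 * x powr (- \<sigma>1) + e2 * x powr (- \<sigma>2))"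
    by (intro sums_add sums_mult pochhammer_mix_sums x)
  moreover have "(\<lambda>m. of_real (?p m) * (Eprod m g - Eprod m h)) sums (Emix x g - Emix x h)"
    unfolding Emix_def right_diff_distrib
    by (intro sums_diff summable_sums summable_Emix x g h)
  moreover have "norm (of_real (?p m) * (Eprod m g - Eprod m h)) \<le> e1 * (?p m * ?A \<sigma>1 m) + e2 * (?p m * ?A \<sigma>2 m)" for m
  proof -
    have "norm (of_real (?p m) * (Eprod m g - Eprod m h)) = ?p m * norm (Eprod m g - Eprod m h)"
      unfolding norm_mult norm_of_real using x by (simp add: abs_mult)
    also have "\<dots> \<le> ?p m * (e1 * ?A \<sigma>1 m + e2 * ?A \<sigma>2 m)"
      using x by (intro mult_left_mono norm_Eprod_diff_le[OF g h diff c1 c2]) auto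
    finally show ?thesis by (simp add: algebra_simps)
  qed
  ultimately show ?thesis
    using norm_suminf_le[of "\<lambda>m. of_real (?p m) * (Eprod m g - Eprod m h)"
        "\<lambda>m. e1 * (?p m * ?A \<sigma>1 m) + e2 * (?p m * ?A \<sigma>2 m)"]
    by (simp add: sums_iff)
qed

end

section \<open>Invariance of multiplicative functionals\<close>

context cascade begin

definition split_phi :: "real \<Rightarrow> (real \<Rightarrow> complex) \<Rightarrow> real \<Rightarrow> complex" where
  "split_phi a \<phi> s = (\<integral>q. \<phi> (s * fst q powr a) * \<phi> (s * snd q powr a) \<partial>Q)"

lemma
  assumes cont: "continuous_on UNIV \<phi>" and bound: "\<And>s. norm (\<phi> s) \<le> 1"
  shows continuous_split_phi: "continuous_on UNIV (split_phi a \<phi>)"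
    and norm_split_phi_le_1: "norm (split_phi a \<phi> s) \<le> 1"
proof -
  have [measurable]: "\<phi> \<in> borel_measurable borel"
    using cont by (rule borel_measurable_continuous_onI)
  have le: "norm (\<phi> x * \<phi> y) \<le> 1" for x y
    using mult_mono[OF bound[of x] bound[of y]] by (simp add: norm_mult)
  have lim: "(\<phi> \<longlongrightarrow> \<phi> x) (at x)" for x
    using cont by (simp add: continuous_on_eq_continuous_at isCont_def)
  have "(split_phi a \<phi> \<longlongrightarrow> split_phi a \<phi> x) (at x)" for x
    unfolding split_phi_def
    by (rule tendsto_integral_bounded[where B=1])
      (auto intro!: le tendsto_intros isCont_tendsto_compose[where g=\<phi>] simp: isCont_def lim)
  then show "continuous_on UNIV (split_phi a \<phi>)"
    by (simp add: continuous_on_eq_continuous_at isCont_def)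
  have "norm (split_phi a \<phi> s) \<le> (\<integral>q. norm (\<phi> (s * fst q powr a) * \<phi> (s * snd q powr a)) \<partial>Q)"
    unfolding split_phi_def by (rule integral_norm_bound)
  also have "\<dots> \<le> (\<integral>q. 1 \<partial>Q)"
    using le by (intro integral_mono integrable_const_bound[of _ 1]) auto
  finally show "norm (split_phi a \<phi> s) \<le> 1" by (simp add: prob_space)
qed

text \<open>The fixed point equation for transforms. The bound by \<open>1\<close> keeps products
  over arbitrarily many leaves bounded, and continuity allows differentiation in the scale.\<close>

definition smoothing_eq :: "real \<Rightarrow> real \<Rightarrow> (real \<Rightarrow> complex) \<Rightarrow> bool" where
  "smoothing_eq a S \<phi> \<longleftrightarrow> continuous_on UNIV \<phi> \<and> (\<forall>s. norm (\<phi> s) \<le> 1) \<and>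
     (\<forall>s. \<phi> s = (\<integral>\<theta>. split_phi a \<phi> (s * \<theta> powr S) \<partial>unif01))"

text \<open>The product rule differentiates one leaf at a time, and the equation for
  \<open>\<phi>\<close> makes the derivative of that factor \<open>(?k - ?h) / x\<close>. By
  \<open>Eprod_Suc\<close>, exchanging \<open>?h\<close> for \<open>?k\<close> at a uniformly chosen
  leaf is in mean one further split.\<close>

lemma Eprod_smoothing_has_derivative:
  assumes eq: "smoothing_eq a S \<phi>" and x: "0 < x"
  defines "f \<equiv> \<lambda>m y. Eprod m (\<lambda>b. \<phi> (y powr S * b powr a))"
  shows "(f m has_vector_derivative (Suc m / x) *\<^sub>R (f (Suc m) x - f m x)) (at x)"
proof -
  interpret O: prob_space "Omega Q m" by (rule prob_space_Omega)
  have cont: "continuous_on UNIV \<phi>" and bound: "\<And>s. norm (\<phi> s) \<le> 1"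
    and fixp: "\<And>s. \<phi> s = (\<integral>\<theta>. split_phi a \<phi> (s * \<theta> powr S) \<partial>unif01)"
    using eq by (auto simp: smoothing_eq_def)
  let ?\<psi> = "split_phi a \<phi>"
  have \<psi>: "continuous_on UNIV ?\<psi>" "\<And>s. norm (?\<psi> s) \<le> 1"
    using continuous_split_phi norm_split_phi_le_1 cont bound by blast+
  note [measurable] = borel_measurable_continuous_onI[OF cont] borel_measurable_continuous_onI[OF \<psi>(1)]
  let ?h = "\<lambda>y b. \<phi> (y powr S * b powr a)" and ?k = "\<lambda>y b. ?\<psi> (y powr S * b powr a)"
  let ?R = "\<lambda>y u k. \<Prod>j\<in>{1..Suc m}-{k}. ?h y (wts u m j)"
  let ?F = "\<lambda>y u. \<Prod>j=1..Suc m. ?h y (wts u m j)"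
  let ?D = "\<lambda>y u. \<Sum>k=1..Suc m. ((?k y (wts u m k) - ?h y (wts u m k)) /\<^sub>R y) * ?R y u k"
  have bR: "norm (?R y u k) \<le> 1" and bF: "norm (?F y u) \<le> 1" for y u k
    by (rule prod_wts_bounded, rule bound)+
  have bk: "norm (z * ?R y u k) \<le> c" if "norm z \<le> c" for z y u k c
    using mult_mono[OF that bR[of y u k]] that by (simp add: norm_mult order_trans[OF norm_ge_zero that])
  \<comment> \<open>On \<open>{x/2<..}\<close> the factor \<open>1 / y\<close> is at most
    \<open>1 / (x / 2)\<close>, and each numerator has norm at most \<open>2\<close>; summed over
    the leaves this is \<open>B\<close>.\<close>
  have "((\<lambda>y. \<integral>u. ?F y u \<partial>Omega Q m) has_vector_derivative (\<integral>u. ?D x u \<partial>Omega Q m)) (at x within {x/2<..})"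
  proof (rule O.has_vector_derivative_integral[where B="real (Suc m) * (2 / (x / 2))"])
    fix y assume y: "y \<in> {x/2<..}"
    show "integrable (Omega Q m) (?F y)"
      using bF by (intro O.integrable_const_bound[of _ 1]) (auto simp del: prod.cl_ivl_Suc)
    fix u
    have d: "((\<lambda>y. ?h y b) has_derivative (\<lambda>h. h *\<^sub>R ((?k y b - ?h y b) /\<^sub>R y))) (at y within {x/2<..})" for b
      using integral_unif01_powr_has_derivative[OF \<psi> fixp, of y "b powr a"] x y
      by (auto simp: has_vector_derivative_def mult.commute intro: has_derivative_at_withinI)
    have "((\<lambda>y. ?F y u) has_derivative
        (\<lambda>h. \<Sum>k=1..Suc m. (h *\<^sub>R ((?k y (wts u m k) - ?h y (wts u m k)) /\<^sub>R y)) * ?R y u k)) (at y within {x/2<..})"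
      by (intro has_derivative_prod d)
    then show "((\<lambda>y. ?F y u) has_vector_derivative ?D y u) (at y within {x/2<..})"
      unfolding has_vector_derivative_def scaleR_sum_right by (simp only: mult_scaleR_left)
    have "norm (?D y u) \<le> (\<Sum>k=1..Suc m. 2 / (x / 2))"
    proof (rule order_trans[OF norm_sum sum_mono], rule bk)
      fix k
      have "norm (?k y (wts u m k) - ?h y (wts u m k)) \<le> 2"
        using norm_triangle_ineq4[of "?k y (wts u m k)" "?h y (wts u m k)"]
          bound[of "y powr S * wts u m k powr a"] \<psi>(2)[of "y powr S * wts u m k powr a"] by linarith
      then show "norm ((?k y (wts u m k) - ?h y (wts u m k)) /\<^sub>R y) \<le> 2 / (x / 2)"
        using x y frac_le[of 2 _ "x / 2" y]
        by (simp add: divide_inverse[symmetric] mult.commute[of "inverse _"] del: inverse_divide)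
    qed
    then show "norm (?D y u) \<le> real (Suc m) * (2 / (x / 2))" by simp
  qed (use x in \<open>auto simp del: prod.cl_ivl_Suc sum.cl_ivl_Suc\<close>)
  then have "((\<lambda>y. \<integral>u. ?F y u \<partial>Omega Q m) has_vector_derivative (\<integral>u. ?D x u \<partial>Omega Q m)) (at x)"
    by (subst (asm) has_vector_derivative_within_open) (use x in auto)
  moreover have "(\<lambda>y. \<integral>u. ?F y u \<partial>Omega Q m) = f m"
    by (simp add: f_def Eprod_def)
  moreover have "(\<integral>u. ?D x u \<partial>Omega Q m) = (Suc m / x) *\<^sub>R (f (Suc m) x - f m x)"
  proof -
    have int: "integrable (Omega Q m) (\<lambda>u. \<Sum>k=1..Suc m. ?k x (wts u m k) * ?R x u k)"
      using bk[OF \<psi>(2)] by (intro Bochner_Integration.integrable_sum O.integrable_const_bound[of _ 1]) auto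
    have intF: "integrable (Omega Q m) (?F x)"
      using bF by (intro O.integrable_const_bound[of _ 1]) (auto simp del: prod.cl_ivl_Suc)
    have "?D x u = (1 / x) *\<^sub>R ((\<Sum>k=1..Suc m. ?k x (wts u m k) * ?R x u k) - of_nat (Suc m) * ?F x u)" for u
    proof -
      have "?h x (wts u m k) * ?R x u k = ?F x u" if "k \<in> {1..Suc m}" for k
        using that by (subst prod.remove[of _ k]) auto
      then have "(\<Sum>k=1..Suc m. ?h x (wts u m k) * ?R x u k) = (\<Sum>k=1..Suc m. ?F x u)"
        by (intro sum.cong) auto
      also have "\<dots> = of_nat (Suc m) * ?F x u" by (simp del: prod.cl_ivl_Suc)
      finally have *: "(\<Sum>k=1..Suc m. ?h x (wts u m k) * ?R x u k) = of_nat (Suc m) * ?F x u" .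
      have "?D x u = (\<Sum>k=1..Suc m. (1 / x) *\<^sub>R (?k x (wts u m k) * ?R x u k - ?h x (wts u m k) * ?R x u k))"
        by (intro sum.cong refl) (simp add: divide_inverse left_diff_distrib)
      also have "\<dots> = (1 / x) *\<^sub>R ((\<Sum>k=1..Suc m. ?k x (wts u m k) * ?R x u k) - (\<Sum>k=1..Suc m. ?h x (wts u m k) * ?R x u k))"
        by (simp only: scaleR_sum_right[symmetric] sum_subtractf)
      finally show ?thesis unfolding * .
    qed
    then have "(\<integral>u. ?D x u \<partial>Omega Q m) = (\<integral>u. (1 / x) *\<^sub>R ((\<Sum>k=1..Suc m. ?k x (wts u m k) * ?R x u k) - of_nat (Suc m) * ?F x u) \<partial>Omega Q m)"
      by simp
    also have "\<dots> = (1 / x) *\<^sub>R ((\<integral>u. (\<Sum>k=1..Suc m. ?k x (wts u m k) * ?R x u k) \<partial>Omega Q m) - of_nat (Suc m) * (\<integral>u. ?F x u \<partial>Omega Q m))"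
      using int intF by (simp del: prod.cl_ivl_Suc sum.cl_ivl_Suc of_nat_Suc)
    also have "(\<integral>u. ?F x u \<partial>Omega Q m) = f m x" by (simp add: f_def Eprod_def)
    also have "(\<integral>u. (\<Sum>k=1..Suc m. ?k x (wts u m k) * ?R x u k) \<partial>Omega Q m) = of_nat (Suc m) * f (Suc m) x"
      unfolding f_def using bound
      by (subst Eprod_Suc) (auto simp: split_phi_def powr_mult mult.left_commute mult.assoc mult.commute simp del: prod.cl_ivl_Suc sum.cl_ivl_Suc of_nat_Suc)
    finally show ?thesis
      by (simp add: scaleR_conv_of_real right_diff_distrib del: of_nat_Suc)
  qed
  ultimately show ?thesis by simp
qed

theorem Emix_smoothing_invariant:
  assumes eq: "smoothing_eq a S \<phi>" and x: "0 < x" "x < 1"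
  shows "Emix x (\<lambda>b. \<phi> (x powr S * b powr a)) = \<phi> 1"
proof -
  have cont: "continuous_on UNIV \<phi>" and bound: "\<And>s. norm (\<phi> s) \<le> 1"
    using eq by (auto simp: smoothing_eq_def)
  note [measurable] = borel_measurable_continuous_onI[OF cont]
  define f where "f = (\<lambda>m y. Eprod m (\<lambda>b. \<phi> (y powr S * b powr a)))"
  have f1: "norm (f m y) \<le> 1" for m y
    unfolding f_def by (rule norm_Eprod_le_1) (auto simp: bound)
  define G where "G N y = (\<Sum>m<N. (y * (1 - y) ^ m) *\<^sub>R f m y)" for N y
  \<comment> \<open>The terms in \<open>f N\<close> that come from differentiating its weight and
    from the recursion cancel the previous remainder, so a single boundary term survives.\<close>
  have dG: "(G N has_vector_derivative (N * (1 - y) ^ (N - 1)) *\<^sub>R f N y) (at y)" if y: "0 < y" for N y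
  proof (induction N)
    case 0
    then show ?case by (simp add: G_def)
  next
    case (Suc N)
    have "((\<lambda>y. y * (1 - y) ^ N) has_real_derivative ((1 - y) ^ N - y * (N * (1 - y) ^ (N - 1)))) (at y)"
      by (auto intro!: derivative_eq_intros)
    then have "((\<lambda>y. (y * (1 - y) ^ N) *\<^sub>R f N y) has_vector_derivative
        ((y * (1 - y) ^ N) *\<^sub>R ((Suc N / y) *\<^sub>R (f (Suc N) y - f N y)) +
        ((1 - y) ^ N - y * (N * (1 - y) ^ (N - 1))) *\<^sub>R f N y)) (at y)"
      using Eprod_smoothing_has_derivative[OF eq y, of N, folded f_def]
      by (intro has_vector_derivative_scaleR) (simp_all add: f_def)
    note has_vector_derivative_add[OF Suc this]
    moreover have "(\<lambda>y. G N y + (y * (1 - y) ^ N) *\<^sub>R f N y) = G (Suc N)"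
      by (simp add: G_def fun_eq_iff)
    moreover have "(N * (1 - y) ^ (N - 1)) *\<^sub>R f N y + ((y * (1 - y) ^ N) *\<^sub>R ((Suc N / y) *\<^sub>R (f (Suc N) y - f N y)) +
        ((1 - y) ^ N - y * (N * (1 - y) ^ (N - 1))) *\<^sub>R f N y) = (Suc N * (1 - y) ^ (Suc N - 1)) *\<^sub>R f (Suc N) y"
    proof -
      have "N * (1 - y) ^ (N - 1) - y * (N * (1 - y) ^ (N - 1)) = N * (1 - y) ^ N"
        by (cases N) (auto simp: algebra_simps)
      then have *: "N * (1 - y) ^ (N - 1) = N * (1 - y) ^ N + y * (N * (1 - y) ^ (N - 1))" by simp
      have "(y * (1 - y) ^ N) *\<^sub>R ((Suc N / y) *\<^sub>R (f (Suc N) y - f N y)) = ((1 - y) ^ N * Suc N) *\<^sub>R (f (Suc N) y - f N y)"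
        using y by simp
      then show ?thesis
        by (subst *) (simp add: algebra_simps)
    qed
    ultimately show ?case by simp
  qed
  \<comment> \<open>At \<open>y = 1\<close> every weight except that of the tree without splits
    vanishes, so \<open>G N 1 = \<phi> 1\<close>. Between \<open>x\<close> and \<open>1\<close> the
    derivative is at most \<open>N * (1 - x) ^ (N - 1)\<close>, which leaves an error that vanishes
    as \<open>N\<close> grows.\<close>
  have "norm (G N x - \<phi> 1) \<le> N * (1 - x) ^ N" if N: "0 < N" for N
  proof -
    have "norm (G N x - G N 1) \<le> (N * (1 - x) ^ (N - 1)) * norm (x - 1)"
    proof (rule differentiable_bound[of "{x..1}"])
      fix y assume y: "y \<in> {x..1}"
      then show "(G N has_derivative (\<lambda>h. h *\<^sub>R ((N * (1 - y) ^ (N - 1)) *\<^sub>R f N y))) (at y within {x..1})"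
        using dG[of y N] x by (auto simp: has_vector_derivative_def intro: has_derivative_at_withinI)
      have "(1 - y) ^ (N - 1) * norm (f N y) \<le> (1 - x) ^ (N - 1) * 1"
        using y x by (intro mult_mono power_mono f1) auto
      then have "N * ((1 - y) ^ (N - 1) * norm (f N y)) \<le> N * ((1 - x) ^ (N - 1) * 1)"
        by (rule mult_left_mono) simp
      then have "norm ((N * (1 - y) ^ (N - 1)) *\<^sub>R f N y) \<le> N * (1 - x) ^ (N - 1)"
        using y by (simp add: mult.assoc)
      then show "onorm (\<lambda>h. h *\<^sub>R ((N * (1 - y) ^ (N - 1)) *\<^sub>R f N y)) \<le> N * (1 - x) ^ (N - 1)"
        by (intro onorm_le) (metis mult.commute mult_left_mono norm_ge_zero norm_scaleR real_norm_def)
    qed (use x in auto)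
    also have "\<dots> = N * (1 - x) ^ N"
      using N x by (cases N) auto
    also have "G N 1 = \<phi> 1"
    proof -
      obtain N' where N': "N = Suc N'" using N by (cases N) auto
      show ?thesis unfolding N' G_def by (subst sum.lessThan_Suc_shift) (simp add: f_def Eprod_0)
    qed
    finally show ?thesis .
  qed
  then have "\<forall>\<^sub>F N in sequentially. norm (G N x - \<phi> 1) \<le> N * (1 - x) ^ N"
    by (intro eventually_sequentiallyI[of 1]) auto
  then have "(\<lambda>N. G N x) \<longlonglongrightarrow> \<phi> 1"
    using powser_times_n_limit_0[of "1 - x"] x
    by (subst LIM_zero_iff[symmetric]) (auto intro: Lim_null_comparison)
  moreover have "(\<lambda>N. G N x) \<longlonglongrightarrow> Emix x (\<lambda>b. \<phi> (x powr S * b powr a))"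
    unfolding Emix_def G_def f_def scaleR_conv_of_real
    by (intro summable_LIMSEQ summable_Emix x) (auto simp: bound)
  ultimately show ?thesis by (rule LIMSEQ_unique[symmetric])
qed

end

section \<open>Asymptotics and uniqueness\<close>

text \<open>\<open>Sp\<close> is \<open>S(a p)\<close>. For \<open>a > 0\<close> the condition
  \<open>Sp < p * S\<close> says \<open>\<mu>(a p) < \<mu>(a)\<close>: after rescaling by
  \<open>exp (- S t)\<close>, the expected sum of \<open>p\<close>-th powers dies out. The cap
  \<open>p \<le> 2\<close> serves the second-order estimate of characteristic functions.\<close>

locale smoothing_cascade = cascade +
  fixes a S p Sp :: real
  assumes moment_a: "(\<integral>\<^sup>+q. ennreal (fst q powr a + snd q powr a) \<partial>Q) = ennreal (1 + S)" "-1 < S"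
    and moment_ap: "(\<integral>\<^sup>+q. ennreal (fst q powr (a * p) + snd q powr (a * p)) \<partial>Q) = ennreal (1 + Sp)" "-1 < Sp"
    and p: "1 < p" "p \<le> 2" and Sp: "Sp < p * S"
begin

theorem Emix_tendsto:
  assumes eq: "smoothing_eq a S \<phi>"
    and g [measurable]: "g \<in> borel_measurable borel" and g1: "\<And>b. norm (g b) \<le> 1"
    and g0: "g 0 = \<phi> 0" and lim: "((\<lambda>v. (\<phi> v - g v) /\<^sub>R v) \<longlongrightarrow> 0) (at_right 0)"
  shows "((\<lambda>x. Emix x (\<lambda>b. g (x powr S * b powr a))) \<longlongrightarrow> \<phi> 1) (at_right 0)"
proof (rule tendstoI)
  fix e :: real assume e: "0 < e"
  have cont: "continuous_on UNIV \<phi>" and \<phi>1: "\<And>s. norm (\<phi> s) \<le> 1"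
    using eq by (auto simp: smoothing_eq_def)
  note [measurable] = borel_measurable_continuous_onI[OF cont]
  obtain \<eta> where \<eta>: "0 < \<eta>" and small: "\<And>v. 0 < v \<Longrightarrow> v < \<eta> \<Longrightarrow> norm ((\<phi> v - g v) /\<^sub>R v) < e / 2"
    using tendstoD[OF lim, of "e / 2"] e unfolding eventually_at_right_field by auto
  \<comment> \<open>Beyond \<open>\<eta>\<close> the trivial bound \<open>2\<close> holds, and this
    \<open>C\<close> makes \<open>C * v powr p\<close> at least \<open>2\<close> there.\<close>
  define C where "C = 2 / \<eta> powr p"
  have C: "0 \<le> C" by (simp add: C_def)
  have bound: "norm (\<phi> v - g v) \<le> e / 2 * v + C * v powr p" if v: "0 \<le> v" for v
  proof -
    consider "v = 0" | "0 < v" "v < \<eta>" | "\<eta> \<le> v" using v by linarith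
    then show ?thesis
    proof cases
      case 2
      then have "norm (\<phi> v - g v) \<le> e / 2 * v" 
        using small[of v, unfolded norm_scaleR] by (simp add: inverse_eq_divide pos_divide_less_eq)
      then show ?thesis using C by (simp add: add_increasing2)
    next
      case 3
      have "norm (\<phi> v - g v) \<le> 2"
        using norm_triangle_ineq4[of "\<phi> v" "g v"] \<phi>1[of v] g1[of v] by linarith
      also have "2 \<le> C * v powr p"
        using 3 \<eta> p powr_mono2[of p \<eta> v] by (simp add: C_def field_simps)
      finally show ?thesis using e v by (simp add: add_increasing)
    qed (simp add: g0)
  qed
  have "((\<lambda>x::real. x powr (p * S - Sp)) \<longlongrightarrow> 0 powr (p * S - Sp)) (at_right 0)"
    using Sp by (intro tendsto_powr') (auto simp: eventually_at_filter)
  then have "((\<lambda>x. C * x powr (p * S - Sp)) \<longlongrightarrow> C * 0) (at_right 0)"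
    by (intro tendsto_mult tendsto_const) simp
  then have "\<forall>\<^sub>F x in at_right 0. C * x powr (p * S - Sp) < e / 2"
    using e by (intro order_tendstoD) auto
  moreover have "\<forall>\<^sub>F x in at_right 0. (x::real) \<in> {0<..<1}"
    by (rule eventually_at_right_real) simp
  ultimately show "\<forall>\<^sub>F x in at_right 0. dist (Emix x (\<lambda>b. g (x powr S * b powr a))) (\<phi> 1) < e"
  proof eventually_elim
    case (elim x)
    then have x: "0 < x" "x < 1" by auto
    have "norm (Emix x (\<lambda>b. \<phi> (x powr S * b powr a)) - Emix x (\<lambda>b. g (x powr S * b powr a))) \<le>
        (e / 2 * x powr S) * x powr (- S) + (C * x powr (S * p)) * x powr (- Sp)"
    proof (rule norm_Emix_diff_le[OF x _ _ _ _ _ _ _ moment_a moment_ap])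
      fix b :: real
      show "norm (\<phi> (x powr S * b powr a) - g (x powr S * b powr a)) \<le>
          (e / 2 * x powr S) * b powr a + (C * x powr (S * p)) * b powr (a * p)"
        using bound[of "x powr S * b powr a"] by (simp add: powr_mult powr_powr mult.assoc)
    qed (use e C \<phi>1 g1 in auto)
    \<comment> \<open>The scaling \<open>x powr S\<close> exactly compensates the growth of the
      first-order sum, so that term is \<open>e / 2\<close> for every \<open>x\<close>; the other
      one has the positive exponent \<open>p * S - Sp\<close>.\<close>
    also have "\<dots> = e / 2 + C * x powr (p * S - Sp)"
    proof -
      have "x powr S * x powr (- S) = 1"
        using x by (simp flip: powr_add)
      moreover have "x powr (S * p) * x powr (- Sp) = x powr (p * S - Sp)"
        by (simp add: mult.commute flip: powr_add)
      ultimately show ?thesis by (simp only: mult.assoc mult_1_right)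
    qed
    also have "\<dots> < e" using elim by simp
    finally show ?case
      unfolding Emix_smoothing_invariant[OF eq x] by (simp add: dist_norm norm_minus_commute)
  qed
qed

corollary smoothing_eq_unique:
  assumes "smoothing_eq a S \<phi>" "smoothing_eq a S \<phi>'" "\<phi>' 0 = \<phi> 0"
    and "((\<lambda>v. (\<phi> v - \<phi>' v) /\<^sub>R v) \<longlongrightarrow> 0) (at_right 0)"
  shows "\<phi> 1 = \<phi>' 1"
proof -
  have "((\<lambda>x. Emix x (\<lambda>b. \<phi>' (x powr S * b powr a))) \<longlongrightarrow> \<phi> 1) (at_right 0)"
    using assms(2) unfolding smoothing_eq_def
    by (intro Emix_tendsto assms(1,3,4)) (blast intro: borel_measurable_continuous_onI)+
  moreover have "\<forall>\<^sub>F x in at_right 0. Emix x (\<lambda>b. \<phi>' (x powr S * b powr a)) = \<phi>' 1"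
    using eventually_at_right_real[of 0 1] Emix_smoothing_invariant[OF assms(2)]
    by (auto elim: eventually_mono)
  ultimately have "((\<lambda>x::real. \<phi>' 1) \<longlongrightarrow> \<phi> 1) (at_right 0)"
    by (rule Lim_transform_eventually)
  then show ?thesis by (simp add: tendsto_const_iff)
qed

end

section \<open>Transforms of nonnegative laws along complex rays\<close>

definition nonneg_law :: "real measure \<Rightarrow> bool" where
  "nonneg_law Z \<longleftrightarrow> prob_space Z \<and> sets Z = sets borel \<and> (AE z in Z. 0 \<le> z)"

text \<open>Laplace transform along the ray through \<open>\<zeta>\<close>; \<open>\<zeta> = -1\<close> and \<open>\<zeta> = \<i> \<lambda>\<close> give the usual
  Laplace transform and the characteristic function. The absolute values make it a bounded
  function on all of \<open>\<real>\<close>, without any assumption on \<open>Z\<close>.\<close>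

definition ray :: "real measure \<Rightarrow> complex \<Rightarrow> real \<Rightarrow> complex" where
  "ray Z \<zeta> s = (\<integral>z. exp (\<zeta> * of_real (\<bar>s\<bar> * \<bar>z\<bar>)) \<partial>Z)"

lemma norm_exp_ray_le_1: "Re \<zeta> \<le> 0 \<Longrightarrow> 0 \<le> y \<Longrightarrow> norm (exp (\<zeta> * of_real y)) \<le> 1"
  by (simp add: mult_nonpos_nonneg)

text \<open>Mean value inequality on the closed left half-plane, which is convex and on which the
  derivative \<open>exp\<close> has norm at most \<open>1\<close>.\<close>

lemma norm_exp_minus_1_le:
  assumes "Re w \<le> 0"
  shows "norm (exp w - 1) \<le> norm w"
proof -
  have "convex {w. Re w \<le> 0}"
    using convex_halfspace_Re_le[of 0] by simp
  then have "norm (exp w - exp 0) \<le> 1 * norm (w - 0)"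
    by (rule field_differentiable_bound[where f'=exp]) (use assms in \<open>auto intro!: derivative_eq_intros\<close>)
  then show ?thesis by simp
qed

lemma ray_0: "prob_space Z \<Longrightarrow> ray Z \<zeta> 0 = 1"
  by (simp add: ray_def prob_space.prob_space)

lemma
  assumes Z: "prob_space Z" "sets Z = sets borel" and \<zeta>: "Re \<zeta> \<le> 0"
  shows continuous_ray: "continuous_on UNIV (ray Z \<zeta>)"
    and norm_ray_le_1: "norm (ray Z \<zeta> s) \<le> 1"
proof -
  interpret prob_space Z by fact
  note [measurable_cong] = Z(2)
  have "(ray Z \<zeta> \<longlongrightarrow> ray Z \<zeta> s) (at s)" for s
    unfolding ray_def using \<zeta>
    by (intro tendsto_integral_bounded[where B=1]) (auto intro!: tendsto_intros simp: mult_nonpos_nonneg)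
  then show "continuous_on UNIV (ray Z \<zeta>)"
    by (simp add: continuous_on_eq_continuous_at isCont_def)
  have "norm (ray Z \<zeta> s) \<le> (\<integral>z. norm (exp (\<zeta> * of_real (\<bar>s\<bar> * \<bar>z\<bar>))) \<partial>Z)"
    unfolding ray_def by (rule integral_norm_bound)
  also have "\<dots> \<le> (\<integral>z. 1 \<partial>Z)"
    using norm_exp_ray_le_1[OF \<zeta>] by (intro integral_mono integrable_const_bound[of _ 1]) auto
  finally show "norm (ray Z \<zeta> s) \<le> 1" by (simp add: prob_space)
qed

text \<open>This carries the normalisation of the mean into the transforms: laws of equal mean have
  transforms that agree to first order at \<open>0\<close>. The difference quotients are dominated
  by \<open>norm \<zeta> * \<bar>z\<bar>\<close>.\<close>

lemma ray_derivative:
  assumes Z: "nonneg_law Z" and \<zeta>: "Re \<zeta> \<le> 0" and int: "integrable Z (\<lambda>z. z)"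
  shows "((\<lambda>v. (ray Z \<zeta> v - 1) /\<^sub>R v) \<longlongrightarrow> \<zeta> * of_real (\<integral>z. z \<partial>Z)) (at_right 0)"
proof -
  interpret prob_space Z using Z by (simp add: nonneg_law_def)
  have [measurable_cong]: "sets Z = sets borel" using Z by (simp add: nonneg_law_def)
  let ?f = "\<lambda>v z. (exp (\<zeta> * of_real (\<bar>v\<bar> * \<bar>z\<bar>)) - 1) /\<^sub>R v"
  have "((\<lambda>v. \<integral>z. ?f v z \<partial>Z) \<longlongrightarrow> (\<integral>z. \<zeta> * of_real \<bar>z\<bar> \<partial>Z)) (at_right 0)"
  proof (rule tendsto_integral_dominated[where B="\<lambda>z. norm \<zeta> * \<bar>z\<bar>"])
    fix z :: real
    let ?c = "\<zeta> * of_real \<bar>z\<bar>"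
    have "((\<lambda>w. exp (?c * w)) has_field_derivative ?c) (at 0)"
      by (auto intro!: derivative_eq_intros)
    then have "((\<lambda>w. (exp (?c * w) - 1) / w) \<longlongrightarrow> ?c) (at 0)"
      by (simp add: has_field_derivative_iff)
    moreover have "filterlim complex_of_real (at 0) (at_right 0)"
      by (auto simp: filterlim_at eventually_at_filter intro!: tendsto_eq_intros)
    ultimately have "((\<lambda>v. (exp (?c * of_real v) - 1) / of_real v) \<longlongrightarrow> ?c) (at_right 0)"
      by (rule filterlim_compose)
    then show "((\<lambda>v. ?f v z) \<longlongrightarrow> ?c) (at_right 0)"
      by (rule tendsto_cong[THEN iffD1, rotated]) (auto simp: eventually_at_filter ac_simps scaleR_conv_of_real divide_inverse intro!: always_eventually)
  next
    fix v z :: real assume v: "v \<in> {0<..}"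
    have "norm (exp (\<zeta> * of_real (\<bar>v\<bar> * \<bar>z\<bar>)) - 1) \<le> norm (\<zeta> * of_real (\<bar>v\<bar> * \<bar>z\<bar>))"
      using \<zeta> by (intro norm_exp_minus_1_le) (simp add: mult_nonpos_nonneg)
    then have "norm (exp (\<zeta> * of_real (\<bar>v\<bar> * \<bar>z\<bar>)) - 1) \<le> (norm \<zeta> * \<bar>z\<bar>) * v"
      using v by (simp add: norm_mult ac_simps)
    then show "norm (?f v z) \<le> norm \<zeta> * \<bar>z\<bar>"
      unfolding norm_scaleR using v by (simp add: inverse_eq_divide pos_divide_le_eq)
  next
    show "integrable Z (\<lambda>z. norm \<zeta> * \<bar>z\<bar>)"
      using int by (intro integrable_mult_right integrable_abs)
  qed measurable
  moreover have "(\<integral>z. \<zeta> * of_real \<bar>z\<bar> \<partial>Z) = \<zeta> * of_real (\<integral>z. z \<partial>Z)"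
  proof -
    have "(\<integral>z. \<bar>z\<bar> \<partial>Z) = (\<integral>z. z \<partial>Z)"
      using Z by (intro integral_cong_AE) (auto simp: nonneg_law_def)
    then show ?thesis using int by simp
  qed
  moreover have "(\<integral>z. ?f v z \<partial>Z) = (ray Z \<zeta> v - 1) /\<^sub>R v" for v
  proof -
    have "integrable Z (\<lambda>z. exp (\<zeta> * of_real (\<bar>v\<bar> * \<bar>z\<bar>)))"
      using norm_exp_ray_le_1[OF \<zeta>] by (intro integrable_const_bound[of _ 1]) auto
    then show ?thesis by (simp add: ray_def prob_space)
  qed
  ultimately show ?thesis by (simp only:)
qed


section \<open>The smoothing map and the uniqueness of its fixed point\<close>

definition smoothing_map :: "(real \<times> real) measure \<Rightarrow> real \<Rightarrow> real \<Rightarrow> real measure \<Rightarrow> real measure" where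
  "smoothing_map Q a S Z = distr (unif01 \<Otimes>\<^sub>M (Q \<Otimes>\<^sub>M (Z \<Otimes>\<^sub>M Z))) borel
     (\<lambda>(\<theta>, (l, r), (z1, z2)). \<theta> powr S * (l powr a * z1 + r powr a * z2))"

context cascade begin

lemma smoothing_map_measurable:
  assumes [measurable_cong]: "sets Z = sets borel"
  shows "(\<lambda>(\<theta>, (l, r), (z1, z2)). \<theta> powr S * (l powr a * z1 + r powr a * z2))
    \<in> borel_measurable (unif01 \<Otimes>\<^sub>M (Q \<Otimes>\<^sub>M (Z \<Otimes>\<^sub>M Z)))"
  by (simp add: split_beta')

text \<open>On this event the absolute value in \<open>ray\<close> distributes over the two terms of
  the smoothing map, and the image is nonnegative.\<close>

lemma AE_smoothing_nonneg:
  assumes Z: "nonneg_law Z"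
  shows "AE w in unif01 \<Otimes>\<^sub>M (Q \<Otimes>\<^sub>M (Z \<Otimes>\<^sub>M Z)). 0 \<le> fst (snd (snd w)) \<and> 0 \<le> snd (snd (snd w))"
proof -
  interpret Z: prob_space Z using Z by (simp add: nonneg_law_def)
  interpret U: prob_space unif01 by (rule prob_space_unif01)
  interpret ZZ: pair_prob_space Z Z ..
  interpret QZ: pair_prob_space Q "Z \<Otimes>\<^sub>M Z" ..
  interpret P: pair_prob_space unif01 "Q \<Otimes>\<^sub>M (Z \<Otimes>\<^sub>M Z)" ..
  have [measurable_cong]: "sets Z = sets borel" using Z by (simp add: nonneg_law_def)
  have z: "AE z in Z. 0 \<le> z" using Z by (simp add: nonneg_law_def)
  then have "AE z in Z \<Otimes>\<^sub>M Z. 0 \<le> fst z \<and> 0 \<le> snd z"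
    by (intro ZZ.AE_pair_measure) auto
  then have "AE w in Q \<Otimes>\<^sub>M (Z \<Otimes>\<^sub>M Z). 0 \<le> fst (snd w) \<and> 0 \<le> snd (snd w)"
    by (intro QZ.AE_pair_measure) auto
  then have *: "AE \<theta> in unif01. AE w in Q \<Otimes>\<^sub>M (Z \<Otimes>\<^sub>M Z).
      0 \<le> fst (snd (snd (\<theta>, w))) \<and> 0 \<le> snd (snd (snd (\<theta>, w)))"
    by simp
  show ?thesis
    by (rule P.AE_pair_measure[OF _ *]) measurable
qed

lemma nonneg_law_smoothing_map:
  assumes Z: "nonneg_law Z"
  shows "nonneg_law (smoothing_map Q a S Z)"
proof -
  interpret Z: prob_space Z using Z by (simp add: nonneg_law_def)
  interpret U: prob_space unif01 by (rule prob_space_unif01)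
  interpret ZZ: pair_prob_space Z Z ..
  interpret QZ: pair_prob_space Q "Z \<Otimes>\<^sub>M Z" ..
  interpret P: pair_prob_space unif01 "Q \<Otimes>\<^sub>M (Z \<Otimes>\<^sub>M Z)" ..
  have sZ [measurable_cong]: "sets Z = sets borel" using Z by (simp add: nonneg_law_def)
  note m = smoothing_map_measurable[OF sZ, of S a]
  have "prob_space (smoothing_map Q a S Z)"
    unfolding smoothing_map_def by (rule P.prob_space_distr[OF m])
  moreover have "AE z in smoothing_map Q a S Z. 0 \<le> z"
    unfolding smoothing_map_def
    by (subst AE_distr_iff[OF m], simp, rule eventually_mono[OF AE_smoothing_nonneg[OF Z]]) auto
  moreover have "sets (smoothing_map Q a S Z) = sets borel"
    by (simp add: smoothing_map_def)
  ultimately show ?thesis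
    by (simp add: nonneg_law_def)
qed

text \<open>Given \<open>\<theta>\<close> and the pair of weights, the exponential of the sum splits
  into a factor in \<open>z1\<close> and a factor in \<open>z2\<close>, which are
  independent.\<close>

lemma ray_smoothing_map:
  assumes Z: "nonneg_law Z" and \<zeta>: "Re \<zeta> \<le> 0"
  shows "ray (smoothing_map Q a S Z) \<zeta> s = (\<integral>\<theta>. split_phi a (ray Z \<zeta>) (s * \<theta> powr S) \<partial>unif01)"
proof -
  interpret Z: prob_space Z using Z by (simp add: nonneg_law_def)
  interpret U: prob_space unif01 by (rule prob_space_unif01)
  interpret ZZ: pair_prob_space Z Z ..
  interpret QZ: pair_prob_space Q "Z \<Otimes>\<^sub>M Z" ..
  interpret P: pair_prob_space unif01 "Q \<Otimes>\<^sub>M (Z \<Otimes>\<^sub>M Z)" ..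
  have sZ [measurable_cong]: "sets Z = sets borel" using Z by (simp add: nonneg_law_def)
  let ?e = "\<lambda>y. exp (\<zeta> * of_real y)"
  \<comment> \<open>With \<open>\<bar>z1\<bar>\<close> and \<open>\<bar>z2\<bar>\<close> in separate
    terms this integrand factors and is bounded everywhere; it equals the original one almost
    everywhere.\<close>
  let ?F = "\<lambda>w. ?e (\<bar>s\<bar> * (fst w powr S * (fst (fst (snd w)) powr a * \<bar>fst (snd (snd w))\<bar> + snd (fst (snd w)) powr a * \<bar>snd (snd (snd w))\<bar>)))"
  have F1: "norm (?F w) \<le> 1" for w
    by (rule norm_exp_ray_le_1[OF \<zeta>]) simp
  let ?T = "\<lambda>(\<theta>, (l, r), (z1, z2)). \<theta> powr S * (l powr a * z1 + r powr a * z2)"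
  have "ray (smoothing_map Q a S Z) \<zeta> s = (\<integral>w. ?e (\<bar>s\<bar> * \<bar>?T w\<bar>) \<partial>(unif01 \<Otimes>\<^sub>M (Q \<Otimes>\<^sub>M (Z \<Otimes>\<^sub>M Z))))"
    unfolding ray_def smoothing_map_def
    by (rule integral_distr[OF smoothing_map_measurable[OF sZ]]) measurable
  also have "\<dots> = (\<integral>w. ?F w \<partial>(unif01 \<Otimes>\<^sub>M (Q \<Otimes>\<^sub>M (Z \<Otimes>\<^sub>M Z))))"
  proof (rule integral_cong_AE)
    show "AE w in unif01 \<Otimes>\<^sub>M (Q \<Otimes>\<^sub>M (Z \<Otimes>\<^sub>M Z)). ?e (\<bar>s\<bar> * \<bar>?T w\<bar>) = ?F w"
      by (rule eventually_mono[OF AE_smoothing_nonneg[OF Z]]) (auto simp: abs_mult)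
  qed (simp_all add: split_beta')
  also have "\<dots> = (\<integral>\<theta>. \<integral>w. ?F (\<theta>, w) \<partial>(Q \<Otimes>\<^sub>M (Z \<Otimes>\<^sub>M Z)) \<partial>unif01)"
    by (rule P.integral_fst'[symmetric], rule P.integrable_const_bound[of _ 1]) (use F1 in auto)
  also have "\<dots> = (\<integral>\<theta>. split_phi a (ray Z \<zeta>) (s * \<theta> powr S) \<partial>unif01)"
  proof (intro Bochner_Integration.integral_cong refl)
    fix \<theta> :: real
    have "(\<integral>w. ?F (\<theta>, w) \<partial>(Q \<Otimes>\<^sub>M (Z \<Otimes>\<^sub>M Z))) = (\<integral>q. \<integral>z. ?F (\<theta>, q, z) \<partial>(Z \<Otimes>\<^sub>M Z) \<partial>Q)"
      by (rule QZ.integral_fst'[symmetric], rule QZ.integrable_const_bound[of _ 1]) (use F1 in auto)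
    also have "\<dots> = split_phi a (ray Z \<zeta>) (s * \<theta> powr S)"
      unfolding split_phi_def
    proof (intro Bochner_Integration.integral_cong refl)
      fix q :: "real \<times> real"
      have "(\<integral>z. ?F (\<theta>, q, z) \<partial>(Z \<Otimes>\<^sub>M Z)) = (\<integral>z1. \<integral>z2. ?F (\<theta>, q, z1, z2) \<partial>Z \<partial>Z)"
        by (rule ZZ.integral_fst'[symmetric], rule ZZ.integrable_const_bound[of _ 1]) (use F1 in auto)
      also have "\<dots> = (\<integral>z1. \<integral>z2. ?e (\<bar>s * \<theta> powr S * fst q powr a\<bar> * \<bar>z1\<bar>) * ?e (\<bar>s * \<theta> powr S * snd q powr a\<bar> * \<bar>z2\<bar>) \<partial>Z \<partial>Z)"
        by (simp add: abs_mult exp_add[symmetric] algebra_simps)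
      also have "\<dots> = ray Z \<zeta> (s * \<theta> powr S * fst q powr a) * ray Z \<zeta> (s * \<theta> powr S * snd q powr a)"
        unfolding ray_def by simp
      finally show "(\<integral>z. ?F (\<theta>, q, z) \<partial>(Z \<Otimes>\<^sub>M Z)) =
          ray Z \<zeta> (s * \<theta> powr S * fst q powr a) * ray Z \<zeta> (s * \<theta> powr S * snd q powr a)" .
    qed
    finally show "(\<integral>w. ?F (\<theta>, w) \<partial>(Q \<Otimes>\<^sub>M (Z \<Otimes>\<^sub>M Z))) = split_phi a (ray Z \<zeta>) (s * \<theta> powr S)" .
  qed
  finally show ?thesis .
qed

lemma smoothing_eq_ray:
  assumes "nonneg_law Z" "Re \<zeta> \<le> 0" "smoothing_map Q a S Z = Z"
  shows "smoothing_eq a S (ray Z \<zeta>)"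
  unfolding smoothing_eq_def
  using assms continuous_ray[of Z \<zeta>] norm_ray_le_1[of Z \<zeta>] ray_smoothing_map[OF assms(1,2), of a S]
  by (simp add: nonneg_law_def)

end

lemma nonneg_law_real_distribution: "nonneg_law Z \<Longrightarrow> real_distribution Z"
  using sets_eq_imp_space_eq[of Z borel]
  by (simp add: nonneg_law_def real_distribution_def real_distribution_axioms_def)

lemma char_eq_ray:
  assumes "nonneg_law Z"
  shows "char Z t = ray Z (\<i> * of_real t) 1"
proof -
  have [measurable_cong]: "sets Z = sets borel" using assms by (simp add: nonneg_law_def)
  show ?thesis unfolding char_def ray_def
    using assms by (intro integral_cong_AE) (auto simp: nonneg_law_def mult.assoc elim!: eventually_mono)
qed

context smoothing_cascade begin

text \<open>The argument \<open>t\<close> of the characteristic function is put into the ray,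
  \<open>\<zeta> = \<i> t\<close>, so comparing two solutions at the single point \<open>1\<close>
  is enough. Both have slope \<open>\<zeta>\<close> at \<open>0\<close> because both means are
  \<open>1\<close>.\<close>

theorem smoothing_fixed_point_unique:
  assumes Z1: "nonneg_law Z1" "integrable Z1 (\<lambda>z. z)" "(\<integral>z. z \<partial>Z1) = 1" "smoothing_map Q a S Z1 = Z1"
    and Z2: "nonneg_law Z2" "integrable Z2 (\<lambda>z. z)" "(\<integral>z. z \<partial>Z2) = 1" "smoothing_map Q a S Z2 = Z2"
  shows "Z1 = Z2"
proof (rule Levy_uniqueness)
  show "real_distribution Z1" "real_distribution Z2"
    using Z1 Z2 by (auto intro: nonneg_law_real_distribution)
  show "char Z1 = char Z2"
  proof
    fix t
    let ?\<zeta> = "\<i> * of_real t"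
    have "((\<lambda>v. (ray Z1 ?\<zeta> v - 1) /\<^sub>R v - (ray Z2 ?\<zeta> v - 1) /\<^sub>R v) \<longlongrightarrow> ?\<zeta> - ?\<zeta>) (at_right 0)"
      using ray_derivative[of Z1 ?\<zeta>] ray_derivative[of Z2 ?\<zeta>] Z1 Z2 by (intro tendsto_diff) auto
    then have "((\<lambda>v. (ray Z1 ?\<zeta> v - ray Z2 ?\<zeta> v) /\<^sub>R v) \<longlongrightarrow> 0) (at_right 0)"
      by (simp add: scaleR_diff_right[symmetric])
    then have "ray Z1 ?\<zeta> 1 = ray Z2 ?\<zeta> 1"
      using smoothing_eq_unique[OF smoothing_eq_ray[OF Z1(1) _ Z1(4), of ?\<zeta>] smoothing_eq_ray[OF Z2(1) _ Z2(4), of ?\<zeta>]] Z1(1) Z2(1)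
      by (simp add: ray_0 nonneg_law_def)
    then show "char Z1 t = char Z2 t"
      using Z1 Z2 by (simp add: char_eq_ray)
  qed
qed

end

section \<open>Existence of the fixed point\<close>

lemma nn_integral_unif01_powr:
  assumes "-1 < d"
  shows "(\<integral>\<^sup>+\<theta>. ennreal (\<theta> powr d) \<partial>unif01) = ennreal (1 / (1 + d))"
proof -
  have "(\<integral>\<^sup>+\<theta>. ennreal (\<theta> powr d) \<partial>unif01) = (\<integral>\<^sup>+\<theta>. ennreal (\<theta> powr d) * indicator {0<..<1} \<theta> \<partial>lborel)"
    by (subst nn_integral_uniform_measure) (auto simp: divide_ennreal_def)
  also have "\<dots> = (\<integral>\<^sup>+\<theta>. indicator {0..1} \<theta> * \<theta> powr d \<partial>lborel)"
    by (intro nn_integral_cong_AE)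
      (use AE_lborel_singleton[of 0] AE_lborel_singleton[of 1] in eventually_elim, auto split: split_indicator)
  also have "\<dots> = ennreal (1 / (1 + d))"
    using nn_integral_has_integral_lebesgue[OF _ has_integral_powr_from_0[OF assms, of 1]]
    by (simp add: add.commute)
  finally show ?thesis .
qed

lemma add_powr_le:
  fixes u v :: real
  assumes "0 \<le> u" "0 \<le> v" "0 \<le> p"
  shows "(u + v) powr p \<le> 2 powr p * (u powr p + v powr p)"
proof -
  have "(u + v) powr p \<le> (2 * max u v) powr p"
    using assms by (intro powr_mono2) auto
  also have "\<dots> = 2 powr p * max u v powr p" by (rule powr_mult)
  also have "max u v powr p \<le> u powr p + v powr p" by (auto simp: max_def)
  finally show ?thesis by simp
qed

text \<open>For \<open>\<bar>x\<bar> \<le> 1\<close> the quadratic Taylor bound lies below the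
  right-hand side, for larger \<open>\<bar>x\<bar>\<close> the linear one does; hence the range of
  \<open>p\<close>.\<close>

lemma norm_iexp_minus_linear_le:
  assumes p: "1 \<le> p" "p \<le> 2"
  shows "norm (iexp x - (1 + \<i> * x)) \<le> 2 * \<bar>x\<bar> powr p"
proof (cases "\<bar>x\<bar> \<le> 1")
  case True
  have "norm (iexp x - (1 + \<i> * x)) \<le> \<bar>x\<bar> ^ 2 / 2"
    using iexp_approx1[of x 1] by (simp add: numeral_2_eq_2)
  also have "\<dots> \<le> 2 * \<bar>x\<bar> powr 2"
    by (cases "x = 0") (auto simp: powr_numeral)
  also have "\<dots> \<le> 2 * \<bar>x\<bar> powr p"
    using True p by (intro mult_left_mono powr_mono') auto
  finally show ?thesis .
next
  case False
  have "norm (iexp x - (1 + \<i> * x)) \<le> 2 * \<bar>x\<bar>"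
    using iexp_approx2[of x 1] by simp
  also have "\<dots> \<le> 2 * \<bar>x\<bar> powr p"
    using False p powr_mono[of 1 p "\<bar>x\<bar>"] by simp
  finally show ?thesis .
qed

lemma ray_char: "nonneg_law Z \<Longrightarrow> ray Z (\<i> * of_real t) s = char Z (t * \<bar>s\<bar>)"
  by (subst char_eq_ray) (auto simp: ray_def mult_ac)

context cascade begin

lemma nn_integral_smoothing_map:
  assumes Z: "prob_space Z" and sZ [measurable_cong]: "sets Z = sets borel" and f [measurable]: "f \<in> borel_measurable borel"
  shows "(\<integral>\<^sup>+z. f z \<partial>smoothing_map Q a S Z) =
    (\<integral>\<^sup>+\<theta>. \<integral>\<^sup>+q. \<integral>\<^sup>+z1. \<integral>\<^sup>+z2. f (\<theta> powr S * (fst q powr a * z1 + snd q powr a * z2)) \<partial>Z \<partial>Z \<partial>Q \<partial>unif01)"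
proof -
  interpret Z: prob_space Z by fact
  interpret U: prob_space unif01 by (rule prob_space_unif01)
  interpret ZZ: pair_prob_space Z Z ..
  interpret QZ: pair_prob_space Q "Z \<Otimes>\<^sub>M Z" ..
  interpret P: pair_prob_space unif01 "Q \<Otimes>\<^sub>M (Z \<Otimes>\<^sub>M Z)" ..
  let ?F = "\<lambda>w. f (fst w powr S * (fst (fst (snd w)) powr a * fst (snd (snd w)) + snd (fst (snd w)) powr a * snd (snd (snd w))))"
  have "(\<integral>\<^sup>+z. f z \<partial>smoothing_map Q a S Z) = (\<integral>\<^sup>+w. ?F w \<partial>(unif01 \<Otimes>\<^sub>M (Q \<Otimes>\<^sub>M (Z \<Otimes>\<^sub>M Z))))"
    unfolding smoothing_map_def
    by (subst nn_integral_distr[OF smoothing_map_measurable[OF sZ]]) (simp_all add: split_beta')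
  also have "\<dots> = (\<integral>\<^sup>+\<theta>. \<integral>\<^sup>+w. ?F (\<theta>, w) \<partial>(Q \<Otimes>\<^sub>M (Z \<Otimes>\<^sub>M Z)) \<partial>unif01)"
    by (rule QZ.nn_integral_fst[symmetric]) measurable
  also have "\<dots> = (\<integral>\<^sup>+\<theta>. \<integral>\<^sup>+q. \<integral>\<^sup>+z. ?F (\<theta>, q, z) \<partial>(Z \<Otimes>\<^sub>M Z) \<partial>Q \<partial>unif01)"
    by (rule nn_integral_cong, rule ZZ.nn_integral_fst[symmetric], simp)
  also have "\<dots> = (\<integral>\<^sup>+\<theta>. \<integral>\<^sup>+q. \<integral>\<^sup>+z1. \<integral>\<^sup>+z2. ?F (\<theta>, q, z1, z2) \<partial>Z \<partial>Z \<partial>Q \<partial>unif01)"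
    by (rule nn_integral_cong, rule nn_integral_cong, rule Z.nn_integral_fst[symmetric], simp)
  finally show ?thesis by simp
qed

end

context smoothing_cascade begin

text \<open>The mean \<open>1 / (1 + S)\<close> of \<open>\<Theta>^S\<close> cancels the mean
  \<open>1 + S\<close> of \<open>L^a + R^a\<close>: the exponent of \<open>\<Theta>\<close> is the
  one that preserves means.\<close>

lemma mean_smoothing_map:
  assumes Z: "nonneg_law Z" and mean: "(\<integral>\<^sup>+z. ennreal z \<partial>Z) = 1"
  shows "(\<integral>\<^sup>+z. ennreal z \<partial>smoothing_map Q a S Z) = 1"
proof -
  interpret Z: prob_space Z using Z by (simp add: nonneg_law_def)
  have sZ [measurable_cong]: "sets Z = sets borel" using Z by (simp add: nonneg_law_def)
  have "(\<integral>\<^sup>+z. ennreal z \<partial>smoothing_map Q a S Z) =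
      (\<integral>\<^sup>+\<theta>. \<integral>\<^sup>+q. \<integral>\<^sup>+z1. \<integral>\<^sup>+z2. ennreal (\<theta> powr S * (fst q powr a * z1 + snd q powr a * z2)) \<partial>Z \<partial>Z \<partial>Q \<partial>unif01)"
    by (rule nn_integral_smoothing_map) (auto simp: sZ Z.prob_space_axioms)
  also have "\<dots> = (\<integral>\<^sup>+\<theta>. \<integral>\<^sup>+q. \<integral>\<^sup>+z1. \<integral>\<^sup>+z2. ennreal (\<theta> powr S) * (ennreal (fst q powr a) * ennreal z1 + ennreal (snd q powr a) * ennreal z2) \<partial>Z \<partial>Z \<partial>Q \<partial>unif01)"
  proof (rule nn_integral_cong, rule nn_integral_cong)
    fix \<theta> :: real and q :: "real \<times> real"
    have z: "AE z in Z. 0 \<le> z" using Z by (simp add: nonneg_law_def)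
    have "AE z1 in Z. (\<integral>\<^sup>+z2. ennreal (\<theta> powr S * (fst q powr a * z1 + snd q powr a * z2)) \<partial>Z) =
        (\<integral>\<^sup>+z2. ennreal (\<theta> powr S) * (ennreal (fst q powr a) * ennreal z1 + ennreal (snd q powr a) * ennreal z2) \<partial>Z)"
      using z
    proof eventually_elim
      case (elim z1)
      show ?case
        by (intro nn_integral_cong_AE eventually_mono[OF z])
          (use elim in \<open>simp add: ennreal_mult\<close>)
    qed
    then show "(\<integral>\<^sup>+z1. \<integral>\<^sup>+z2. ennreal (\<theta> powr S * (fst q powr a * z1 + snd q powr a * z2)) \<partial>Z \<partial>Z) =
        (\<integral>\<^sup>+z1. \<integral>\<^sup>+z2. ennreal (\<theta> powr S) * (ennreal (fst q powr a) * ennreal z1 + ennreal (snd q powr a) * ennreal z2) \<partial>Z \<partial>Z)"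
      by (rule nn_integral_cong_AE)
  qed
  also have "\<dots> = (\<integral>\<^sup>+\<theta>. \<integral>\<^sup>+q. ennreal (\<theta> powr S) * ennreal (fst q powr a + snd q powr a) \<partial>Q \<partial>unif01)"
    by (simp add: nn_integral_cmult nn_integral_add mean Z.emeasure_space_1)
  also have "\<dots> = ennreal (1 / (1 + S)) * ennreal (1 + S)"
    using moment_a by (simp add: nn_integral_cmult nn_integral_multc nn_integral_unif01_powr)
  also have "\<dots> = 1"
    using moment_a(2) by (simp flip: ennreal_mult)
  finally show ?thesis .
qed

text \<open>Applied to the point mass at \<open>1\<close>, so that the first step of the iteration
  has finite length in the distance weighted by \<open>\<bar>s\<bar>^p\<close>.\<close>

lemma p_moment_smoothing_map:
  assumes Z: "nonneg_law Z" and fin: "(\<integral>\<^sup>+z. ennreal (z powr p) \<partial>Z) < \<infinity>"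
  shows "(\<integral>\<^sup>+z. ennreal (z powr p) \<partial>smoothing_map Q a S Z) < \<infinity>"
proof -
  interpret Z: prob_space Z using Z by (simp add: nonneg_law_def)
  have sZ [measurable_cong]: "sets Z = sets borel" using Z by (simp add: nonneg_law_def)
  define m where "m = (\<integral>\<^sup>+z. ennreal (z powr p) \<partial>Z)"
  have pS: "-1 < p * S" using moment_ap(2) Sp by linarith
  have z: "AE z in Z. 0 \<le> z" using Z by (simp add: nonneg_law_def)
  have "(\<integral>\<^sup>+z. ennreal (z powr p) \<partial>smoothing_map Q a S Z) =
      (\<integral>\<^sup>+\<theta>. \<integral>\<^sup>+q. \<integral>\<^sup>+z1. \<integral>\<^sup>+z2. ennreal ((\<theta> powr S * (fst q powr a * z1 + snd q powr a * z2)) powr p) \<partial>Z \<partial>Z \<partial>Q \<partial>unif01)"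
    by (rule nn_integral_smoothing_map) (auto simp: sZ Z.prob_space_axioms)
  also have "\<dots> \<le> (\<integral>\<^sup>+\<theta>. \<integral>\<^sup>+q. \<integral>\<^sup>+z1. \<integral>\<^sup>+z2. ennreal (2 powr p) * (ennreal (\<theta> powr (p * S)) *
      (ennreal (fst q powr (a * p)) * ennreal (z1 powr p) + ennreal (snd q powr (a * p)) * ennreal (z2 powr p))) \<partial>Z \<partial>Z \<partial>Q \<partial>unif01)"
  proof (rule nn_integral_mono, rule nn_integral_mono)
    fix \<theta> :: real and q :: "real \<times> real"
    have "AE z1 in Z. (\<integral>\<^sup>+z2. ennreal ((\<theta> powr S * (fst q powr a * z1 + snd q powr a * z2)) powr p) \<partial>Z) \<le>
      (\<integral>\<^sup>+z2. ennreal (2 powr p) * (ennreal (\<theta> powr (p * S)) *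
      (ennreal (fst q powr (a * p)) * ennreal (z1 powr p) + ennreal (snd q powr (a * p)) * ennreal (z2 powr p))) \<partial>Z)"
      using z
    proof eventually_elim
      case (elim z1)
      show ?case
      proof (intro nn_integral_mono_AE eventually_mono[OF z])
        fix z2 :: real assume "0 \<le> z2"
        then have "(fst q powr a * z1 + snd q powr a * z2) powr p \<le>
            2 powr p * (fst q powr (a * p) * z1 powr p + snd q powr (a * p) * z2 powr p)"
          using add_powr_le[of "fst q powr a * z1" "snd q powr a * z2" p] elim p
          by (simp add: powr_mult powr_powr)
        then have "(\<theta> powr S * (fst q powr a * z1 + snd q powr a * z2)) powr p \<le>
            \<theta> powr (p * S) * (2 powr p * (fst q powr (a * p) * z1 powr p + snd q powr (a * p) * z2 powr p))"
          by (simp add: powr_mult[of "\<theta> powr S"] powr_powr mult.commute[of S] mult_left_mono)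
        then show "ennreal ((\<theta> powr S * (fst q powr a * z1 + snd q powr a * z2)) powr p) \<le>
          ennreal (2 powr p) * (ennreal (\<theta> powr (p * S)) *
          (ennreal (fst q powr (a * p)) * ennreal (z1 powr p) + ennreal (snd q powr (a * p)) * ennreal (z2 powr p)))"
          by (simp add: ennreal_leI mult.left_commute flip: ennreal_mult ennreal_plus)
      qed
    qed
    then show "(\<integral>\<^sup>+z1. \<integral>\<^sup>+z2. ennreal ((\<theta> powr S * (fst q powr a * z1 + snd q powr a * z2)) powr p) \<partial>Z \<partial>Z) \<le>
      (\<integral>\<^sup>+z1. \<integral>\<^sup>+z2. ennreal (2 powr p) * (ennreal (\<theta> powr (p * S)) *
      (ennreal (fst q powr (a * p)) * ennreal (z1 powr p) + ennreal (snd q powr (a * p)) * ennreal (z2 powr p))) \<partial>Z \<partial>Z)"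
      by (rule nn_integral_mono_AE)
  qed
  also have "\<dots> = ennreal (2 powr p) * (ennreal (1 / (1 + p * S)) * (ennreal (1 + Sp) * m))"
  proof -
    have "(\<integral>\<^sup>+q. ennreal (fst q powr (a * p)) * m + ennreal (snd q powr (a * p)) * m \<partial>Q) = ennreal (1 + Sp) * m"
      unfolding moment_ap(1)[symmetric]
      by (subst nn_integral_multc[symmetric]) (auto simp: distrib_right intro!: nn_integral_cong)
    then show ?thesis
      by (simp add: nn_integral_cmult nn_integral_add nn_integral_multc Z.emeasure_space_1 m_def[symmetric]
        nn_integral_unif01_powr[OF pS])
  qed
  also have "\<dots> < \<infinity>"
    using fin by (simp add: m_def[symmetric] ennreal_mult_less_top)
  finally show ?thesis .
qed

text \<open>The product of \<open>E[\<Theta>^(p S)]\<close> and \<open>E[L^(a p) + R^(a p)]\<close>;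
  the condition \<open>Sp < p * S\<close> puts it below \<open>1\<close>.\<close>

definition \<kappa> :: real where "\<kappa> = (1 + Sp) / (1 + p * S)"

lemma \<kappa>_bounds: "0 < \<kappa>" "\<kappa> < 1"
  using moment_ap(2) Sp by (auto simp: \<kappa>_def)

text \<open>Replacing one factor at a time bounds the difference of the two products by the
  differences at \<open>s L^a\<close> and \<open>s R^a\<close>. Homogeneity of
  \<open>\<bar>s\<bar>^p\<close> then pulls out the two moments whose product is
  \<open>\<kappa>\<close>.\<close>

lemma smoothing_contraction:
  assumes meas [measurable]: "\<phi> \<in> borel_measurable borel" "\<phi>' \<in> borel_measurable borel"
    and 1: "\<And>s. norm (\<phi> s) \<le> 1" "\<And>s. norm (\<phi>' s) \<le> 1"
    and diff: "\<And>s. norm (\<phi> s - \<phi>' s) \<le> C * \<bar>s\<bar> powr p"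
  shows "norm ((\<integral>\<theta>. split_phi a \<phi> (s * \<theta> powr S) \<partial>unif01) - (\<integral>\<theta>. split_phi a \<phi>' (s * \<theta> powr S) \<partial>unif01))
    \<le> C * \<kappa> * \<bar>s\<bar> powr p"
proof -
  interpret U: prob_space unif01 by (rule prob_space_unif01)
  have pS: "-1 < p * S" using moment_ap(2) Sp by linarith
  have "integrable Q (\<lambda>q. fst q powr (a * p) + snd q powr (a * p)) \<and>
      (\<integral>q. fst q powr (a * p) + snd q powr (a * p) \<partial>Q) = 1 + Sp"
    using moment_ap by (subst nn_integral_eq_integrable[symmetric]) auto
  then have intQ: "integrable Q (\<lambda>q. fst q powr (a * p) + snd q powr (a * p))"
    and IQ: "(\<integral>q. fst q powr (a * p) + snd q powr (a * p) \<partial>Q) = 1 + Sp" by auto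
  have "integrable unif01 (\<lambda>\<theta>. \<theta> powr (p * S)) \<and> (\<integral>\<theta>. \<theta> powr (p * S) \<partial>unif01) = 1 / (1 + p * S)"
    using pS nn_integral_unif01_powr[OF pS] by (subst nn_integral_eq_integrable[symmetric]) auto
  then have intU: "integrable unif01 (\<lambda>\<theta>. \<theta> powr (p * S))"
    and IU: "(\<integral>\<theta>. \<theta> powr (p * S) \<partial>unif01) = 1 / (1 + p * S)" by auto
  have le1: "norm (\<phi> x * \<phi> y) \<le> 1" "norm (\<phi>' x * \<phi>' y) \<le> 1" for x y
    using mult_mono[OF 1(1)[of x] 1(1)[of y]] mult_mono[OF 1(2)[of x] 1(2)[of y]] by (auto simp: norm_mult)
  have split: "norm (split_phi a \<phi> s - split_phi a \<phi>' s) \<le> C * (1 + Sp) * \<bar>s\<bar> powr p" for s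
  proof -
    have int: "integrable Q (\<lambda>q. \<phi> (s * fst q powr a) * \<phi> (s * snd q powr a))"
      "integrable Q (\<lambda>q. \<phi>' (s * fst q powr a) * \<phi>' (s * snd q powr a))"
      using le1 by (auto intro!: integrable_const_bound[of _ 1])
    have "norm (split_phi a \<phi> s - split_phi a \<phi>' s) =
        norm (\<integral>q. \<phi> (s * fst q powr a) * \<phi> (s * snd q powr a) - \<phi>' (s * fst q powr a) * \<phi>' (s * snd q powr a) \<partial>Q)"
      unfolding split_phi_def using int by simp
    also have "\<dots> \<le> (\<integral>q. norm (\<phi> (s * fst q powr a) * \<phi> (s * snd q powr a) - \<phi>' (s * fst q powr a) * \<phi>' (s * snd q powr a)) \<partial>Q)"
      by (rule integral_norm_bound)
    also have "\<dots> \<le> (\<integral>q. C * \<bar>s\<bar> powr p * (fst q powr (a * p) + snd q powr (a * p)) \<partial>Q)"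
    proof (rule integral_mono)
      fix q :: "real \<times> real"
      let ?u = "s * fst q powr a" and ?v = "s * snd q powr a"
      have "\<phi> ?u * \<phi> ?v - \<phi>' ?u * \<phi>' ?v = \<phi> ?u * (\<phi> ?v - \<phi>' ?v) + (\<phi> ?u - \<phi>' ?u) * \<phi>' ?v"
        by (simp add: algebra_simps)
      then have "norm (\<phi> ?u * \<phi> ?v - \<phi>' ?u * \<phi>' ?v) \<le> norm (\<phi> ?u) * norm (\<phi> ?v - \<phi>' ?v) + norm (\<phi> ?u - \<phi>' ?u) * norm (\<phi>' ?v)"
        by (simp only:) (rule order_trans[OF norm_triangle_ineq], simp only: norm_mult order_refl)
      also have "\<dots> \<le> 1 * (C * \<bar>?v\<bar> powr p) + (C * \<bar>?u\<bar> powr p) * 1"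
        by (intro add_mono mult_mono 1 diff) (auto intro: order_trans[OF norm_ge_zero diff])
      also have "\<dots> = C * \<bar>s\<bar> powr p * (fst q powr (a * p) + snd q powr (a * p))"
        by (simp add: abs_mult powr_mult powr_powr algebra_simps)
      finally show "norm (\<phi> ?u * \<phi> ?v - \<phi>' ?u * \<phi>' ?v) \<le> C * \<bar>s\<bar> powr p * (fst q powr (a * p) + snd q powr (a * p))" .
    qed (use int intQ in auto)
    also have "\<dots> = C * (1 + Sp) * \<bar>s\<bar> powr p"
      by (simp add: IQ)
    finally show ?thesis .
  qed
  have meas_split [measurable]: "split_phi a \<phi> \<in> borel_measurable borel" "split_phi a \<phi>' \<in> borel_measurable borel"
    unfolding split_phi_def by measurable
  have b1: "norm (split_phi a \<psi> s) \<le> 1" if [measurable]: "\<psi> \<in> borel_measurable borel"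
    and "\<And>x y. norm (\<psi> x * \<psi> y) \<le> 1" for \<psi> s
  proof -
    have "norm (split_phi a \<psi> s) \<le> (\<integral>q. norm (\<psi> (s * fst q powr a) * \<psi> (s * snd q powr a)) \<partial>Q)"
      unfolding split_phi_def by (rule integral_norm_bound)
    also have "\<dots> \<le> (\<integral>q. 1 \<partial>Q)"
      using that(2) by (intro integral_mono integrable_const_bound[of _ 1]) auto
    finally show ?thesis by (simp add: prob_space)
  qed
  have int: "integrable unif01 (\<lambda>\<theta>. split_phi a \<phi> (s * \<theta> powr S))" "integrable unif01 (\<lambda>\<theta>. split_phi a \<phi>' (s * \<theta> powr S))"
    using b1[OF meas(1) le1(1)] b1[OF meas(2) le1(2)] by (auto intro!: U.integrable_const_bound[of _ 1])
  then have "norm ((\<integral>\<theta>. split_phi a \<phi> (s * \<theta> powr S) \<partial>unif01) - (\<integral>\<theta>. split_phi a \<phi>' (s * \<theta> powr S) \<partial>unif01)) =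
      norm (\<integral>\<theta>. split_phi a \<phi> (s * \<theta> powr S) - split_phi a \<phi>' (s * \<theta> powr S) \<partial>unif01)"
    by simp
  also have "\<dots> \<le> (\<integral>\<theta>. norm (split_phi a \<phi> (s * \<theta> powr S) - split_phi a \<phi>' (s * \<theta> powr S)) \<partial>unif01)"
    by (rule integral_norm_bound)
  also have "\<dots> \<le> (\<integral>\<theta>. (C * (1 + Sp) * \<bar>s\<bar> powr p) * \<theta> powr (p * S) \<partial>unif01)"
  proof (rule integral_mono)
    fix \<theta> :: real
    show "norm (split_phi a \<phi> (s * \<theta> powr S) - split_phi a \<phi>' (s * \<theta> powr S)) \<le> (C * (1 + Sp) * \<bar>s\<bar> powr p) * \<theta> powr (p * S)"
      using split[of "s * \<theta> powr S"] by (simp add: abs_mult powr_mult powr_powr mult_ac)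
  qed (use int intU in auto)
  also have "\<dots> = C * \<kappa> * \<bar>s\<bar> powr p"
    by (simp add: IU \<kappa>_def)
  finally show ?thesis .
qed

end

lemma nonneg_law_mean:
  assumes Z: "nonneg_law Z" and c: "0 \<le> c"
  shows "(\<integral>\<^sup>+z. ennreal z \<partial>Z) = ennreal c \<longleftrightarrow> integrable Z (\<lambda>z. z) \<and> (\<integral>z. z \<partial>Z) = c"
proof -
  have [measurable_cong]: "sets Z = sets borel" using Z by (simp add: nonneg_law_def)
  show ?thesis
    using Z c by (intro nn_integral_eq_integrable) (auto simp: nonneg_law_def)
qed

section \<open>Iterates of the smoothing map and their limit\<close>

context smoothing_cascade begin

primrec iter_law :: "nat \<Rightarrow> real measure" where
  "iter_law 0 = return borel 1"
| "iter_law (Suc k) = smoothing_map Q a S (iter_law k)"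

lemma nonneg_iter_law: "nonneg_law (iter_law k)"
proof (induction k)
  case 0
  show ?case by (auto simp: nonneg_law_def prob_space_return AE_return)
qed (simp add: nonneg_law_smoothing_map)

lemma sets_iter_law [measurable_cong]: "sets (iter_law k) = sets borel"
  using nonneg_iter_law[of k] by (simp add: nonneg_law_def)

lemma mean_iter_law: "(\<integral>\<^sup>+z. ennreal z \<partial>iter_law k) = 1"
proof (induction k)
  case 0
  show ?case by (simp add: nn_integral_return)
qed (simp add: mean_smoothing_map nonneg_iter_law)

lemma integrable_iter_law: "integrable (iter_law k) (\<lambda>z. z)" "(\<integral>z. z \<partial>iter_law k) = 1"
  using nonneg_law_mean[OF nonneg_iter_law, of 1 k] mean_iter_law[of k] by auto

lemma ray_linear_approx:
  assumes Z: "nonneg_law Z" and mean: "integrable Z (\<lambda>z. z)" "(\<integral>z. z \<partial>Z) = 1" and int: "integrable Z (\<lambda>z. z powr p)"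
  shows "norm (ray Z (\<i> * of_real t) s - (1 + \<i> * of_real (t * \<bar>s\<bar>))) \<le> 2 * (\<integral>z. z powr p \<partial>Z) * \<bar>t * s\<bar> powr p"
proof -
  interpret Z: real_distribution Z by (rule nonneg_law_real_distribution[OF Z])
  let ?u = "t * \<bar>s\<bar>"
  have int_e: "integrable Z (\<lambda>z. iexp (?u * z))"
    by (intro Z.integrable_const_bound[of _ 1]) auto
  have "ray Z (\<i> * of_real t) s - (1 + \<i> * ?u) = (\<integral>z. iexp (?u * z) - (1 + \<i> * (?u * z)) \<partial>Z)"
    using int_e mean(1) by (simp add: ray_char[OF Z] char_def mean(2) Z.prob_space del: Z.space_eq_univ)
  also have "norm \<dots> \<le> (\<integral>z. norm (iexp (?u * z) - (1 + \<i> * (?u * z))) \<partial>Z)"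
    by (rule integral_norm_bound)
  also have "\<dots> \<le> (\<integral>z. 2 * (\<bar>t * s\<bar> powr p * z powr p) \<partial>Z)"
  proof (rule integral_mono_AE)
    show "AE z in Z. norm (iexp (?u * z) - (1 + \<i> * (?u * z))) \<le> 2 * (\<bar>t * s\<bar> powr p * z powr p)"
    proof (rule eventually_mono)
      show "AE z in Z. 0 \<le> z" using Z by (simp add: nonneg_law_def)
      fix z :: real assume "0 \<le> z"
      then show "norm (iexp (?u * z) - (1 + \<i> * (?u * z))) \<le> 2 * (\<bar>t * s\<bar> powr p * z powr p)"
        using norm_iexp_minus_linear_le[of p "?u * z"] p by (simp add: abs_mult powr_mult)
    qed
  qed (use int_e mean int in auto)
  finally show ?thesis by (simp add: mult_ac)
qed

text \<open>The factor \<open>2\<close> comes from \<open>norm_iexp_minus_linear_le\<close>; the two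
  \<open>p\<close>-th moments are those of the first iterate and of the point mass at
  \<open>1\<close>.\<close>

definition approx_const :: real where
  "approx_const = 2 * ((\<integral>z. z powr p \<partial>iter_law 1) + 1)"

text \<open>At the start both transforms share the linear part
  \<open>1 + \<i> t \<bar>s\<bar>\<close>, since both means are \<open>1\<close>, so their
  difference is of order \<open>\<bar>s\<bar>^p\<close>. Every further step gains a factor
  \<open>\<kappa>\<close>.\<close>

lemma ray_iter_law_step:
  "norm (ray (iter_law (Suc k)) (\<i> * of_real t) s - ray (iter_law k) (\<i> * of_real t) s) \<le>
    approx_const * \<bar>t\<bar> powr p * \<kappa> ^ k * \<bar>s\<bar> powr p"
proof (induction k arbitrary: s)
  case 0
  have fin: "(\<integral>\<^sup>+z. ennreal (z powr p) \<partial>iter_law 1) < \<infinity>"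
    using p_moment_smoothing_map[OF nonneg_iter_law[of 0]] by (simp add: nn_integral_return)
  have int1: "integrable (iter_law 1) (\<lambda>z. z powr p)"
    using fin by (intro integrableI_bounded) (auto simp del: iter_law.simps)
  have int0: "integrable (iter_law 0) (\<lambda>z. z powr p)"
    by (intro integrableI_bounded) (auto simp: nn_integral_return)
  let ?L = "1 + \<i> * of_real (t * \<bar>s\<bar>)"
  have "norm (ray (iter_law 1) (\<i> * of_real t) s - ray (iter_law 0) (\<i> * of_real t) s) \<le>
      norm (ray (iter_law 1) (\<i> * of_real t) s - ?L) + norm (ray (iter_law 0) (\<i> * of_real t) s - ?L)"
    using norm_triangle_ineq4[of "ray (iter_law 1) (\<i> * of_real t) s - ?L" "ray (iter_law 0) (\<i> * of_real t) s - ?L"]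
    by (simp only: diff_diff_eq2 diff_add_cancel)
  also have "\<dots> \<le> 2 * (\<integral>z. z powr p \<partial>iter_law 1) * \<bar>t * s\<bar> powr p + 2 * (\<integral>z. z powr p \<partial>iter_law 0) * \<bar>t * s\<bar> powr p"
    by (intro add_mono ray_linear_approx nonneg_iter_law integrable_iter_law int0 int1)
  also have "\<dots> = approx_const * \<bar>t\<bar> powr p * \<kappa> ^ 0 * \<bar>s\<bar> powr p"
    by (simp add: approx_const_def integral_return abs_mult powr_mult algebra_simps del: iter_law.simps(2))
  finally show ?case by simp
next
  case (Suc k)
  have meas: "ray (iter_law k) (\<i> * of_real t) \<in> borel_measurable borel" for k
    using nonneg_iter_law[of k]
    by (intro borel_measurable_continuous_onI continuous_ray) (auto simp: nonneg_law_def)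
  have le1: "norm (ray (iter_law k) (\<i> * of_real t) s) \<le> 1" for k s
    using nonneg_iter_law[of k] by (intro norm_ray_le_1) (auto simp: nonneg_law_def)
  have eq: "ray (iter_law (Suc k)) (\<i> * of_real t) s =
      (\<integral>\<theta>. split_phi a (ray (iter_law k) (\<i> * of_real t)) (s * \<theta> powr S) \<partial>unif01)" for k s
    using ray_smoothing_map[OF nonneg_iter_law, of "\<i> * of_real t"] by simp
  show ?case
    using smoothing_contraction[OF meas meas le1 le1 Suc.IH, of s] unfolding eq[of "Suc k"] eq[of k]
    by (simp add: eq mult_ac)
qed

text \<open>The steps are geometric, hence summable. The second conclusion compares the limit with
  the initial law, whose transform is \<open>iexp\<close>; since \<open>p > 1\<close> it fixes the
  derivative of \<open>\<phi>\<close> at \<open>0\<close>, from which the mean of the limit law is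
  recovered.\<close>

lemma char_iter_law_converges:
  obtains \<phi> where "\<And>t. (\<lambda>k. char (iter_law k) t) \<longlonglongrightarrow> \<phi> t"
    and "\<And>t. norm (\<phi> t - iexp t) \<le> approx_const / (1 - \<kappa>) * \<bar>t\<bar> powr p"
proof -
  let ?c = "\<lambda>k t. char (iter_law k) t"
  have step: "norm (?c (Suc k) t - ?c k t) \<le> approx_const * \<bar>t\<bar> powr p * \<kappa> ^ k" for k t
    using ray_iter_law_step[of k t 1] by (simp add: ray_char nonneg_iter_law del: iter_law.simps)
  have geo: "(\<lambda>k. approx_const * \<bar>t\<bar> powr p * \<kappa> ^ k) sums (approx_const * \<bar>t\<bar> powr p * (1 / (1 - \<kappa>)))" for t
    using \<kappa>_bounds by (intro sums_mult geometric_sums) auto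
  have sum: "summable (\<lambda>k. ?c (Suc k) t - ?c k t)" for t
    using summable_comparison_test'[OF sums_summable[OF geo] step] .
  define \<phi> where "\<phi> t = ?c 0 t + (\<Sum>k. ?c (Suc k) t - ?c k t)" for t
  have "(\<lambda>n. ?c 0 t + (\<Sum>k<n. ?c (Suc k) t - ?c k t)) \<longlonglongrightarrow> \<phi> t" for t
    unfolding \<phi>_def by (intro tendsto_add tendsto_const summable_LIMSEQ sum)
  then have 1: "(\<lambda>n. ?c n t) \<longlonglongrightarrow> \<phi> t" for t
    using sum_lessThan_telescope[of "\<lambda>k. ?c k t" for t] by (simp del: iter_law.simps)
  have "norm (\<phi> t - iexp t) \<le> approx_const / (1 - \<kappa>) * \<bar>t\<bar> powr p" for t
  proof -
    have "?c 0 t = iexp t" by (simp add: char_def integral_return)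
    then have "norm (\<phi> t - iexp t) = norm (\<Sum>k. ?c (Suc k) t - ?c k t)"
      by (simp add: \<phi>_def)
    also have "\<dots> \<le> (\<Sum>k. approx_const * \<bar>t\<bar> powr p * \<kappa> ^ k)"
      by (rule norm_suminf_le[OF step sums_summable[OF geo]])
    finally show ?thesis using sums_unique[OF geo[of t]] by (simp add: mult_ac)
  qed
  with 1 show thesis by (rule that)
qed

text \<open>By Markov's inequality and mean \<open>1\<close>, the mass above \<open>2 / e\<close> is
  at most \<open>e / 2\<close>. The left end is \<open>-1\<close> because the interval is open there
  and has to contain \<open>0\<close>.\<close>

lemma tight_iter_law: "tight iter_law"
  unfolding tight_def
proof (intro conjI allI impI)
  show "real_distribution (iter_law n)" for n
    by (rule nonneg_law_real_distribution[OF nonneg_iter_law])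
  fix e :: real assume e: "0 < e"
  show "\<exists>a b. a < b \<and> (\<forall>n. 1 - e < measure (iter_law n) {a<..b})"
  proof (rule exI[of _ "-1"], rule exI[of _ "2 / e"], intro conjI allI)
    show "-1 < 2 / e" using e by (simp add: order.strict_trans1[of _ 0])
    fix n
    interpret I: real_distribution "iter_law n" by (rule nonneg_law_real_distribution[OF nonneg_iter_law])
    have nn: "AE z in iter_law n. 0 \<le> z" using nonneg_iter_law by (simp add: nonneg_law_def)
    have "I.prob {z \<in> space (iter_law n). z \<ge> 2 / e} \<le> (\<integral>z. z \<partial>iter_law n) / (2 / e)"
      using e nn by (intro integral_Markov_inequality_measure[where A="{}"] integrable_iter_law) auto
    also have "\<dots> < e" using e by (simp add: integrable_iter_law)
    finally have "I.prob {2 / e..} < e" by (simp add: atLeast_def)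
    moreover have "1 - I.prob {2 / e..} \<le> I.prob {-1<..2 / e}"
    proof -
      have "1 - I.prob {2 / e..} = I.prob (UNIV - {2 / e..})"
        using I.prob_compl[of "{2 / e..}"] by simp
      also have "\<dots> \<le> I.prob {-1<..2 / e}"
        using nn by (intro I.finite_measure_mono_AE) (auto elim!: eventually_mono)
      finally show ?thesis .
    qed
    ultimately show "1 - e < I.prob {-1<..2 / e}" by linarith
  qed
qed

theorem smoothing_fixed_point_exists:
  obtains Z where "nonneg_law Z" "integrable Z (\<lambda>z. z)" "(\<integral>z. z \<partial>Z) = 1" "smoothing_map Q a S Z = Z"
proof -
  obtain \<phi> where lim: "\<And>t. (\<lambda>k. char (iter_law k) t) \<longlonglongrightarrow> \<phi> t"
    and close: "\<And>t. norm (\<phi> t - iexp t) \<le> approx_const / (1 - \<kappa>) * \<bar>t\<bar> powr p"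
    by (rule char_iter_law_converges) blast
  \<comment> \<open>Tightness gives a limit law along a subsequence, but its characteristic function
    is the limit \<open>\<phi>\<close> of the full sequence.\<close>
  obtain r Z where r: "strict_mono (r :: nat \<Rightarrow> nat)" and Z: "real_distribution Z" and "weak_conv_m (iter_law \<circ> id \<circ> r) Z"
    using tight_imp_convergent_subsubsequence[OF tight_iter_law strict_mono_id] by blast
  then have weak: "weak_conv_m (\<lambda>n. iter_law (r n)) Z" by (simp add: comp_def)
  interpret Z: real_distribution Z by fact
  have rd: "real_distribution (iter_law n)" for n
    by (rule nonneg_law_real_distribution[OF nonneg_iter_law])
  have "(\<lambda>n. char (iter_law (r n)) t) \<longlonglongrightarrow> char Z t" for t
    by (rule levy_continuity1[OF rd Z weak])
  moreover have "(\<lambda>n. char (iter_law (r n)) t) \<longlonglongrightarrow> \<phi> t" for t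
    using LIMSEQ_subseq_LIMSEQ[OF lim r] by (simp add: comp_def)
  ultimately have char_Z: "char Z t = \<phi> t" for t
    by (rule LIMSEQ_unique)
  have conv: "(\<lambda>n. integral\<^sup>L (iter_law (r n)) f) \<longlonglongrightarrow> integral\<^sup>L Z f"
    if "\<And>x. isCont f x" "\<And>x. norm (f x) \<le> B" for f :: "real \<Rightarrow> real" and B
    by (rule weak_conv_imp_integral_bdd_continuous_conv[OF rd Z weak that])
  have nn: "AE z in iter_law n. 0 \<le> z" for n using nonneg_iter_law by (simp add: nonneg_law_def)
  \<comment> \<open>A bounded continuous test function that is zero exactly on the nonnegative
    half-line detects mass below \<open>0\<close>.\<close>
  have nonneg: "AE z in Z. 0 \<le> z"
  proof -
    let ?f = "\<lambda>z::real. min 1 (max 0 (- z))"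
    have "(\<integral>z. ?f z \<partial>iter_law (r n)) = 0" for n
      by (rule integral_eq_zero_AE) (use nn[of "r n"] in \<open>auto elim!: eventually_mono\<close>)
    moreover have "(\<lambda>n. \<integral>z. ?f z \<partial>iter_law (r n)) \<longlonglongrightarrow> (\<integral>z. ?f z \<partial>Z)"
      by (rule conv[of ?f 1]) (auto intro!: continuous_intros)
    ultimately have "(\<lambda>n. 0) \<longlonglongrightarrow> (\<integral>z. ?f z \<partial>Z)" by (simp only:)
    then have "(\<integral>z. ?f z \<partial>Z) = 0" by (simp only: LIMSEQ_const_iff)
    moreover have "integrable Z ?f" by (rule Z.integrable_const_bound[of _ 1]) auto
    ultimately have "AE z in Z. ?f z = 0"
      by (subst (asm) integral_nonneg_eq_0_iff_AE) auto
    then show ?thesis by (rule eventually_mono) (auto simp: min_def max_def split: if_splits)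
  qed
  have law: "nonneg_law Z"
    using nonneg Z.prob_space_axioms by (simp add: nonneg_law_def)
  \<comment> \<open>Bounded truncations pass to the weak limit; monotone convergence then bounds the
    mean by \<open>1\<close>.\<close>
  have int: "integrable Z (\<lambda>z. z)"
  proof -
    have le: "(\<integral>z. min (real K) (max 0 z) \<partial>Z) \<le> 1" for K :: nat
    proof (rule LIMSEQ_le_const2[OF conv[of _ "real K"]])
      have "(\<integral>z. min (real K) (max 0 z) \<partial>iter_law n) \<le> (\<integral>z. z \<partial>iter_law n)" for n
      proof (rule integral_mono_AE)
        interpret I: real_distribution "iter_law n" by (rule rd)
        show "integrable (iter_law n) (\<lambda>z. min (real K) (max 0 z))"
          by (rule I.integrable_const_bound[of _ "real K"]) auto
        show "AE z in iter_law n. min (real K) (max 0 z) \<le> z"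
          using nn[of n] by (auto elim!: eventually_mono)
      qed (rule integrable_iter_law)
      then show "\<exists>N. \<forall>n\<ge>N. (\<integral>z. min (real K) (max 0 z) \<partial>iter_law (r n)) \<le> 1"
        by (simp add: integrable_iter_law)
    qed (auto intro!: continuous_intros)
    have sup: "(SUP K::nat. ennreal (min (real K) (max 0 z))) = ennreal z" for z
    proof (rule antisym)
      show "(SUP K::nat. ennreal (min (real K) (max 0 z))) \<le> ennreal z"
        by (rule SUP_least) (auto simp: max_def min_def ennreal_neg intro: ennreal_leI)
      obtain K :: nat where "z \<le> real K" using real_arch_simple by blast
      then have "ennreal z \<le> ennreal (min (real K) (max 0 z))" by (intro ennreal_leI) auto
      then show "ennreal z \<le> (SUP K::nat. ennreal (min (real K) (max 0 z)))"
        by (rule order_trans) (rule SUP_upper, simp)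
    qed
    have "(\<integral>\<^sup>+z. ennreal z \<partial>Z) = (\<integral>\<^sup>+z. (SUP K::nat. ennreal (min (real K) (max 0 z))) \<partial>Z)"
      by (simp only: sup)
    also have "\<dots> = (SUP K::nat. \<integral>\<^sup>+z. ennreal (min (real K) (max 0 z)) \<partial>Z)"
      by (rule nn_integral_monotone_convergence_SUP) (auto simp: incseq_def le_fun_def intro!: ennreal_leI)
    also have "\<dots> \<le> 1"
    proof (rule SUP_least)
      fix K :: nat
      have "(\<integral>\<^sup>+z. ennreal (min (real K) (max 0 z)) \<partial>Z) = ennreal (\<integral>z. min (real K) (max 0 z) \<partial>Z)"
        by (intro nn_integral_eq_integral Z.integrable_const_bound[of _ "real K"]) auto
      then show "(\<integral>\<^sup>+z. ennreal (min (real K) (max 0 z)) \<partial>Z) \<le> 1"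
        using le[of K] by (simp add: ennreal_leI flip: ennreal_1)
    qed
    finally have "(\<integral>\<^sup>+z. ennreal z \<partial>Z) \<le> 1" .
    moreover have "(\<integral>\<^sup>+z. ennreal (norm z) \<partial>Z) = (\<integral>\<^sup>+z. ennreal z \<partial>Z)"
      using nonneg by (intro nn_integral_cong_AE) (auto elim!: eventually_mono)
    ultimately show ?thesis
      by (intro integrableI_bounded) (auto simp: le_less_trans[OF _ ennreal_one_less_top])
  qed
  \<comment> \<open>Weak convergence alone could lose mean. Equality holds because the
    characteristic function of \<open>Z\<close> is within a constant times
    \<open>\<bar>t\<bar>^p\<close> of \<open>iexp t\<close>, hence has the same derivative at
    \<open>0\<close>.\<close>
  have mean: "(\<integral>z. z \<partial>Z) = 1"
  proof -
    let ?d = "\<lambda>s. (ray Z \<i> s - 1) /\<^sub>R s - (ray (iter_law 0) \<i> s - 1) /\<^sub>R s"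
    have "(?d \<longlongrightarrow> \<i> * of_real (\<integral>z. z \<partial>Z) - \<i> * of_real (\<integral>z. z \<partial>iter_law 0)) (at_right 0)"
      by (intro tendsto_diff ray_derivative law int nonneg_iter_law integrable_iter_law) simp_all
    moreover have "(?d \<longlongrightarrow> 0) (at_right 0)"
    proof (rule Lim_null_comparison)
      let ?C = "approx_const / (1 - \<kappa>)"
      show "\<forall>\<^sub>F s in at_right 0. norm (?d s) \<le> ?C * s powr (p - 1)"
        unfolding eventually_at_filter
      proof (intro always_eventually allI impI)
        fix s :: real assume s: "s \<noteq> 0" "s \<in> {0<..}"
        have "ray Z \<i> s = \<phi> s" using ray_char[OF law, of 1 s] s by (simp add: char_Z)
        moreover have "ray (iter_law 0) \<i> s = iexp s"
          using ray_char[OF nonneg_iter_law, of 0 1 s] s by (simp add: char_def integral_return)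
        ultimately have "?d s = (\<phi> s - iexp s) /\<^sub>R s"
          by (simp only: scaleR_diff_right[symmetric]) simp
        then have "norm (?d s) = norm (\<phi> s - iexp s) / s"
          using s by (simp only: norm_scaleR) (simp add: divide_inverse mult.commute)
        also have "\<dots> \<le> ?C * s powr p / s"
          using close[of s] s by (intro divide_right_mono) auto
        also have "\<dots> = ?C * s powr (p - 1)"
          using s by (simp add: powr_diff)
        finally show "norm (?d s) \<le> ?C * s powr (p - 1)" .
      qed
      have "((\<lambda>s::real. s powr (p - 1)) \<longlongrightarrow> 0 powr (p - 1)) (at_right 0)"
        using p by (intro tendsto_powr') (auto simp: eventually_at_filter)
      then show "((\<lambda>s. ?C * s powr (p - 1)) \<longlongrightarrow> 0) (at_right 0)"
        by (intro tendsto_mult_right_zero) simp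
    qed
    ultimately have "\<i> * of_real (\<integral>z. z \<partial>Z) - \<i> * of_real (\<integral>z. z \<partial>iter_law 0) = 0"
      by (rule tendsto_unique[OF trivial_limit_at_right_real])
    then show ?thesis
      using integrable_iter_law(2)[of 0] by (simp flip: right_diff_distrib of_real_diff del: iter_law.simps)
  qed
  \<comment> \<open>The transform of \<open>iter_law (Suc k)\<close> converges both to that of the
    image of \<open>Z\<close>, by dominated convergence in \<open>ray_smoothing_map\<close>, and to
    that of \<open>Z\<close> itself.\<close>
  have "smoothing_map Q a S Z = Z"
  proof (rule Levy_uniqueness)
    have law': "nonneg_law (smoothing_map Q a S Z)" by (rule nonneg_law_smoothing_map[OF law])
    show "real_distribution (smoothing_map Q a S Z)" "real_distribution Z"
      using law law' by (auto intro: nonneg_law_real_distribution)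
    show "char (smoothing_map Q a S Z) = char Z"
    proof
      fix t
      let ?\<zeta> = "\<i> * complex_of_real t"
      interpret U: prob_space unif01 by (rule prob_space_unif01)
      have ray_lim: "(\<lambda>k. ray (iter_law k) ?\<zeta> s) \<longlonglongrightarrow> ray Z ?\<zeta> s" for s
        using lim[of "t * \<bar>s\<bar>"] by (simp add: ray_char[OF law] ray_char[OF nonneg_iter_law] char_Z)
      have law_k: "nonneg_law (iter_law k)" for k by (rule nonneg_iter_law)
      have meas: "ray W ?\<zeta> \<in> borel_measurable borel" and le1: "norm (ray W ?\<zeta> s) \<le> 1"
        and c: "continuous_on UNIV (ray W ?\<zeta>)" if "nonneg_law W" for W s
        using that by (auto intro!: borel_measurable_continuous_onI continuous_ray norm_ray_le_1 simp: nonneg_law_def)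
      note [measurable] = meas[OF law] meas[OF law_k]
      have split_lim: "(\<lambda>k. split_phi a (ray (iter_law k) ?\<zeta>) s) \<longlonglongrightarrow> split_phi a (ray Z ?\<zeta>) s" for s
        unfolding split_phi_def
      proof (rule integral_dominated_convergence[where w="\<lambda>_. 1"])
        show "AE q in Q. norm (ray (iter_law k) ?\<zeta> (s * fst q powr a) * ray (iter_law k) ?\<zeta> (s * snd q powr a)) \<le> 1" for k
          using mult_mono[OF le1[OF law_k[of k]] le1[OF law_k[of k]]] by (intro AE_I2) (auto simp: norm_mult)
      qed (auto intro!: tendsto_mult ray_lim)
      have s1: "norm (split_phi a (ray W ?\<zeta>) s) \<le> 1" and [measurable]: "split_phi a (ray W ?\<zeta>) \<in> borel_measurable borel"
        if "nonneg_law W" for W s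
        using norm_split_phi_le_1[OF c[OF that] le1[OF that]] continuous_split_phi[OF c[OF that] le1[OF that]]
        by (auto intro: borel_measurable_continuous_onI)
      have "(\<lambda>k. \<integral>\<theta>. split_phi a (ray (iter_law k) ?\<zeta>) (1 * \<theta> powr S) \<partial>unif01) \<longlonglongrightarrow>
          (\<integral>\<theta>. split_phi a (ray Z ?\<zeta>) (1 * \<theta> powr S) \<partial>unif01)"
        by (rule integral_dominated_convergence[where w="\<lambda>_. 1"]) (use law law_k in \<open>auto intro!: split_lim s1\<close>)
      then have "(\<lambda>k. ray (iter_law (Suc k)) ?\<zeta> 1) \<longlonglongrightarrow> ray (smoothing_map Q a S Z) ?\<zeta> 1"
        by (simp add: ray_smoothing_map law law_k)
      moreover have "(\<lambda>k. ray (iter_law (Suc k)) ?\<zeta> 1) \<longlonglongrightarrow> ray Z ?\<zeta> 1"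
        by (rule LIMSEQ_Suc[OF ray_lim])
      ultimately have "ray (smoothing_map Q a S Z) ?\<zeta> 1 = ray Z ?\<zeta> 1"
        by (rule LIMSEQ_unique)
      then show "char (smoothing_map Q a S Z) t = char Z t"
        using char_eq_ray[OF law] char_eq_ray[OF law'] by simp
    qed
  qed
  with law int mean show thesis by (rule that)
qed

end

section \<open>Independence and the law of the maximum\<close>

text \<open>The empty index set, which occurs for the tree without splits, is treated apart: its
  product is a one-point space.\<close>

lemma (in prob_space) distr_restrict_indep_vars:
  assumes indep: "indep_vars N Y J" and law: "\<And>i. i \<in> J \<Longrightarrow> distr M (N i) (Y i) = N i"
  shows "distr M (PiM J N) (\<lambda>\<omega>. \<lambda>i\<in>J. Y i \<omega>) = PiM J N"
proof (cases "J = {}")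
  case True
  show ?thesis
  proof (rule measure_eqI)
    fix A assume "A \<in> sets (distr M (PiM J N) (\<lambda>\<omega>. \<lambda>i\<in>J. Y i \<omega>))"
    then have "A = {} \<or> A = {\<lambda>_. undefined}" using True by (auto simp: PiM_empty)
    then show "emeasure (distr M (PiM J N) (\<lambda>\<omega>. \<lambda>i\<in>J. Y i \<omega>)) A = emeasure (PiM J N) A"
    proof
      assume A: "A = {\<lambda>_. undefined}"
      have "emeasure (distr M (PiM J N) (\<lambda>\<omega>. \<lambda>i\<in>J. Y i \<omega>)) A = emeasure M (space M)"
        using True A by (subst emeasure_distr) (auto simp: PiM_empty restrict_def intro!: arg_cong[where f="emeasure M"])
      then show ?thesis using True A by (simp add: emeasure_space_1 PiM_empty)
    qed simp
  qed (simp add: True)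
next
  case False
  have rv: "random_variable (N i) (Y i)" if "i \<in> J" for i
    using indep that by (simp add: indep_vars_def2)
  have "distr M (PiM J N) (\<lambda>\<omega>. \<lambda>i\<in>J. Y i \<omega>) = PiM J (\<lambda>i. distr M (N i) (Y i))"
    using indep indep_vars_iff_distr_eq_PiM'[OF False, where M'=N and X=Y] rv by simp
  also have "\<dots> = PiM J N"
    by (rule PiM_cong) (auto simp: law)
  finally show ?thesis .
qed

lemma Int_stable_sigma_sets: "A \<subseteq> Pow \<Omega> \<Longrightarrow> Int_stable (sigma_sets \<Omega> A)"
proof -
  assume "A \<subseteq> Pow \<Omega>"
  then interpret sigma_algebra \<Omega> "sigma_sets \<Omega> A" by (rule sigma_algebra_sigma_sets)
  show ?thesis by (auto simp: Int_stable_def)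
qed

lemma fam_events_Pow: "fam_events M N Y J \<subseteq> Pow (space M)"
  unfolding fam_events_def by (intro subsetI PowI sigma_sets_into_sp) auto

lemma Int_stable_fam_events: "Int_stable (fam_events M N Y J)"
  unfolding fam_events_def by (rule Int_stable_sigma_sets) auto

lemma measurable_fam_events:
  assumes "j \<in> J" "Y j \<in> M \<rightarrow>\<^sub>M N j" "fam_events M N Y J \<subseteq> sets M'" "space M' = space M"
  shows "Y j \<in> M' \<rightarrow>\<^sub>M N j"
proof (rule measurableI)
  fix A assume "A \<in> sets (N j)"
  then have "Y j -` A \<inter> space M \<in> fam_events M N Y J"
    unfolding fam_events_def using assms(1) by (intro sigma_sets.Basic) auto
  then show "Y j -` A \<inter> space M' \<in> sets M'" using assms by auto
next
  fix x assume "x \<in> space M'"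
  then show "Y j x \<in> space (N j)" using measurable_space[OF assms(2)] assms(4) by simp
qed

text \<open>It suffices to test rectangles, which generate the product and are stable under
  intersection. There the probability factors first between the two families, then within each, and
  the factors are regrouped by index.\<close>

lemma (in prob_space) indep_vars_Pair:
  assumes Y: "indep_vars N1 Y J" and Z: "indep_vars N2 Z J"
    and YZ: "indep_set (fam_events M N1 Y J) (fam_events M N2 Z J)"
  shows "indep_vars (\<lambda>i. N1 i \<Otimes>\<^sub>M N2 i) (\<lambda>i \<omega>. (Y i \<omega>, Z i \<omega>)) J"
proof -
  let ?U = "\<lambda>i \<omega>. (Y i \<omega>, Z i \<omega>)"
  let ?G = "\<lambda>i. {a \<times> b | a b. a \<in> sets (N1 i) \<and> b \<in> sets (N2 i)}"
  let ?E = "\<lambda>i. {?U i -` A \<inter> space M | A. A \<in> ?G i}"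
  have rvY [measurable]: "random_variable (N1 i) (Y i)" and rvZ [measurable]: "random_variable (N2 i) (Z i)"
    if "i \<in> J" for i using Y Z that by (auto simp: indep_vars_def2)
  have rv: "random_variable (N1 i \<Otimes>\<^sub>M N2 i) (?U i)" if "i \<in> J" for i
    using that by simp
  have E: "\<exists>a b. a \<in> sets (N1 i) \<and> b \<in> sets (N2 i) \<and> A = (Y i -` a \<inter> space M) \<inter> (Z i -` b \<inter> space M)"
    if "A \<in> ?E i" for A i using that by auto
  have stable: "Int_stable (?E i)" for i
  proof (rule Int_stableI)
    fix A B assume "A \<in> ?E i" "B \<in> ?E i"
    then obtain a b a' b' where *: "a \<in> sets (N1 i)" "b \<in> sets (N2 i)" "a' \<in> sets (N1 i)" "b' \<in> sets (N2 i)"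
      "A = ?U i -` (a \<times> b) \<inter> space M" "B = ?U i -` (a' \<times> b') \<inter> space M"
      by auto
    then have "A \<inter> B = ?U i -` ((a \<inter> a') \<times> (b \<inter> b')) \<inter> space M" by auto
    with * show "A \<inter> B \<in> ?E i" by blast
  qed
  have "indep_sets ?E J"
  proof (rule indep_setsI)
    fix i assume i: "i \<in> J"
    show "?E i \<subseteq> events"
    proof
      fix A assume "A \<in> ?E i"
      then obtain a b where "a \<in> sets (N1 i)" "b \<in> sets (N2 i)" "A = ?U i -` (a \<times> b) \<inter> space M" by blast
      then show "A \<in> events" using measurable_sets[OF rv[OF i], of "a \<times> b"] by simp
    qed
  next
    fix A K assume K: "K \<noteq> {}" "K \<subseteq> J" "finite K" and A: "\<forall>j\<in>K. A j \<in> ?E j"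
    have "\<forall>j\<in>K. \<exists>a b. a \<in> sets (N1 j) \<and> b \<in> sets (N2 j) \<and> A j = (Y j -` a \<inter> space M) \<inter> (Z j -` b \<inter> space M)"
      using A by (intro ballI E) blast
    from bchoice[OF this] obtain a where "\<forall>j\<in>K. \<exists>b. a j \<in> sets (N1 j) \<and> b \<in> sets (N2 j) \<and>
        A j = (Y j -` a j \<inter> space M) \<inter> (Z j -` b \<inter> space M)" ..
    from bchoice[OF this] obtain b where ab: "\<And>j. j \<in> K \<Longrightarrow> a j \<in> sets (N1 j) \<and> b j \<in> sets (N2 j) \<and>
        A j = (Y j -` a j \<inter> space M) \<inter> (Z j -` b j \<inter> space M)" by blast
    let ?a = "\<lambda>j. Y j -` a j \<inter> space M" and ?b = "\<lambda>j. Z j -` b j \<inter> space M"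
    have fam: "?a j \<in> fam_events M N1 Y J" "?b j \<in> fam_events M N2 Z J" if "j \<in> K" for j
      using ab[OF that] that K(2) unfolding fam_events_def by (auto intro!: sigma_sets.Basic)
    interpret SY: sigma_algebra "space M" "fam_events M N1 Y J"
      unfolding fam_events_def by (rule sigma_algebra_sigma_sets) auto
    interpret SZ: sigma_algebra "space M" "fam_events M N2 Z J"
      unfolding fam_events_def by (rule sigma_algebra_sigma_sets) auto
    have "(\<Inter>j\<in>K. ?a j) \<in> fam_events M N1 Y J" "(\<Inter>j\<in>K. ?b j) \<in> fam_events M N2 Z J"
      by (rule SY.finite_INT SZ.finite_INT; use K fam in blast)+
    then have "prob ((\<Inter>j\<in>K. ?a j) \<inter> (\<Inter>j\<in>K. ?b j)) = prob (\<Inter>j\<in>K. ?a j) * prob (\<Inter>j\<in>K. ?b j)"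
      by (rule indep_setD[OF YZ])
    also have "prob (\<Inter>j\<in>K. ?a j) = (\<Prod>j\<in>K. prob (?a j))"
      using Y ab K unfolding indep_vars_def2 by (intro indep_setsD[of _ J]) auto
    also have "prob (\<Inter>j\<in>K. ?b j) = (\<Prod>j\<in>K. prob (?b j))"
      using Z ab K unfolding indep_vars_def2 by (intro indep_setsD[of _ J]) auto
    also have "(\<Prod>j\<in>K. prob (?a j)) * (\<Prod>j\<in>K. prob (?b j)) = (\<Prod>j\<in>K. prob (A j))"
      unfolding prod.distrib[symmetric]
    proof (rule prod.cong)
      fix j assume j: "j \<in> K"
      then show "prob (?a j) * prob (?b j) = prob (A j)"
        using ab[OF j] indep_setD[OF YZ fam[OF j]] by simp
    qed simp
    also have "(\<Inter>j\<in>K. ?a j) \<inter> (\<Inter>j\<in>K. ?b j) = (\<Inter>j\<in>K. A j)"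
      using ab K by auto
    finally show "prob (\<Inter>j\<in>K. A j) = (\<Prod>j\<in>K. prob (A j))" .
  qed
  then have "indep_sets (\<lambda>i. sigma_sets (space M) (?E i)) J"
    by (rule indep_sets_sigma) (rule stable)
  moreover have "sigma_sets (space M) (?E i) = {?U i -` A \<inter> space M | A. A \<in> sets (N1 i \<Otimes>\<^sub>M N2 i)}"
    if "i \<in> J" for i
  proof -
    have "?U i \<in> space M \<rightarrow> space (N1 i) \<times> space (N2 i)"
      using measurable_space[OF rvY[OF that]] measurable_space[OF rvZ[OF that]] by auto
    from sigma_sets_vimage_commute[OF this] show ?thesis
      by (simp only: sets_pair_measure)
  qed
  ultimately have "indep_sets (\<lambda>i. {?U i -` A \<inter> space M | A. A \<in> sets (N1 i \<Otimes>\<^sub>M N2 i)}) J"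
    by (simp cong: indep_sets_cong)
  then show ?thesis
    unfolding indep_vars_def2 using rv by blast
qed

text \<open>Measurability of the maximum is needed on the null event that some \<open>I\<^sub>n\<close> is out of range as
  well, because the probability space need not be complete.\<close>

lemma betas_entry_measurable_Suc:
  assumes LR: "\<And>n. 1 \<le> n \<Longrightarrow> LR n \<in> borel_measurable M"
    and IH: "(\<forall>j. (\<lambda>\<omega>. betas (\<lambda>n. LR n \<omega>) \<iota> (Suc (Suc n)) ! j) \<in> borel_measurable M) \<and>
      (\<exists>len. \<forall>\<omega>. length (betas (\<lambda>n. LR n \<omega>) \<iota> (Suc (Suc n))) = len)"
  shows "(\<forall>j. (\<lambda>\<omega>. betas (\<lambda>n. LR n \<omega>) \<iota> (Suc (Suc (Suc n))) ! j) \<in> borel_measurable M) \<and>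
    (\<exists>len. \<forall>\<omega>. length (betas (\<lambda>n. LR n \<omega>) \<iota> (Suc (Suc (Suc n)))) = len)"
proof -
  let ?n = "Suc (Suc n)"
  let ?b = "\<lambda>\<omega>. betas (\<lambda>n. LR n \<omega>) \<iota> ?n" and ?k = "\<iota> ?n"
  obtain len where len: "\<And>\<omega>. length (?b \<omega>) = len" and [measurable]: "\<And>j. (\<lambda>\<omega>. ?b \<omega> ! j) \<in> borel_measurable M"
    using IH by blast
  have LRn [measurable]: "LR ?n \<in> M \<rightarrow>\<^sub>M (borel \<Otimes>\<^sub>M borel)" using LR[of ?n] by (simp add: borel_prod)
  have step: "betas (\<lambda>n. LR n \<omega>) \<iota> (Suc ?n) =
      take (?k - Suc 0) (?b \<omega>) @ [fst (LR ?n \<omega>) * ?b \<omega> ! (?k - Suc 0), snd (LR ?n \<omega>) * ?b \<omega> ! (?k - Suc 0)] @ drop ?k (?b \<omega>)" for \<omega>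
    by (simp add: Let_def)
  define l where "l = min len (?k - Suc 0)"
  have lt: "length (take (?k - Suc 0) (?b \<omega>)) = l" for \<omega> by (simp only: length_take len l_def)
  \<comment> \<open>The index \<open>?k\<close> may be \<open>0\<close> or exceed the length. Past
    the end, \<open>nth\<close> reads \<open>[] ! i\<close>, a value that does not depend on
    \<open>\<omega>\<close>, so such entries are measurable too.\<close>
  have eq: "betas (\<lambda>n. LR n \<omega>) \<iota> (Suc ?n) ! j =
      (if j < l then ?b \<omega> ! j
       else if j = l then fst (LR ?n \<omega>) * ?b \<omega> ! (?k - Suc 0)
       else if j = Suc l then snd (LR ?n \<omega>) * ?b \<omega> ! (?k - Suc 0)
       else if ?k \<le> len then ?b \<omega> ! (?k + (j - Suc (Suc l)))
       else [] ! (j - Suc (Suc l)))" for \<omega> j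
  proof -
    have d: "drop ?k (?b \<omega>) ! i = (if ?k \<le> len then ?b \<omega> ! (?k + i) else [] ! i)" for i
      using len[of \<omega>] by (auto simp del: betas.simps)
    consider "j < l" | "j = l" | "j = Suc l" | "j \<ge> Suc (Suc l)" by linarith
    then show ?thesis
    proof cases
      case 1
      then have "take (?k - Suc 0) (?b \<omega>) ! j = ?b \<omega> ! j" by (intro nth_take) (simp add: l_def)
      with 1 show ?thesis unfolding step by (simp add: nth_append lt del: betas.simps length_take nth_take)
    next
      case 4
      then obtain i where "j = Suc (Suc (l + i))" using nat_le_iff_add by auto
      then show ?thesis unfolding step by (simp add: nth_append lt d del: betas.simps length_take nth_take nth_drop)
    qed (simp_all add: step nth_append lt del: betas.simps length_take)
  qed
  show ?thesis
  proof (intro conjI allI exI)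
    show "(\<lambda>\<omega>. betas (\<lambda>n. LR n \<omega>) \<iota> (Suc ?n) ! j) \<in> borel_measurable M" for j
      unfolding eq by measurable
    show "length (betas (\<lambda>n. LR n \<omega>) \<iota> (Suc ?n)) = l + (2 + (len - ?k))" for \<omega>
      unfolding step by (simp add: lt len del: betas.simps length_take)
  qed
qed

text \<open>The indices \<open>\<iota>\<close> are held fixed and only the pairs are random, which
  makes the length of the list deterministic. Random indices are reinserted in
  \<open>betas_measurable\<close>.\<close>

lemma betas_entry_measurable:
  assumes LR: "\<And>n. 1 \<le> n \<Longrightarrow> LR n \<in> borel_measurable M"
  shows "(\<forall>j. (\<lambda>\<omega>. betas (\<lambda>n. LR n \<omega>) \<iota> n ! j) \<in> borel_measurable M) \<and>
    (\<exists>len. \<forall>\<omega>. length (betas (\<lambda>n. LR n \<omega>) \<iota> n) = len)"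
proof (induction n rule: induct_nat_012)
  case (ge2 n)
  show ?case
  proof (cases n)
    case 0
    have LR1 [measurable]: "LR (Suc 0) \<in> M \<rightarrow>\<^sub>M (borel \<Otimes>\<^sub>M borel)" using LR[of 1] by (simp add: borel_prod)
    have "[x, y] ! j = (if j = 0 then x else if j = 1 then y else [] ! (j - 2))" for x y :: real and j
      by (auto simp: nth_Cons split: nat.split)
    then show ?thesis using 0 by simp
  next
    case (Suc n')
    then show ?thesis using betas_entry_measurable_Suc[OF LR, where n=n' and \<iota>=\<iota>] ge2(2) by simp
  qed
qed auto

section \<open>The random families and their independence\<close>

locale cascade_process = prob_space M + Q: cascade Q + PX: prob_space PX
  for M :: "'a measure" and Q :: "(real \<times> real) measure" and PX :: "real measure" +
  fixes LR :: "nat \<Rightarrow> 'a \<Rightarrow> real \<times> real" and I :: "nat \<Rightarrow> 'a \<Rightarrow> nat"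
    and nu :: "real \<Rightarrow> 'a \<Rightarrow> nat" and X :: "nat \<Rightarrow> 'a \<Rightarrow> real"
  assumes LR_rv: "\<And>n. n \<ge> 1 \<Longrightarrow> LR n \<in> borel_measurable M"
    and LR_law: "\<And>n. n \<ge> 1 \<Longrightarrow> distr M borel (LR n) = Q"
    and LR_indep: "indep_vars (\<lambda>_. borel) LR {1..}"
    and I_rv: "\<And>n. n \<ge> 1 \<Longrightarrow> I n \<in> M \<rightarrow>\<^sub>M count_space UNIV"
    and I_law: "\<And>n. n \<ge> 1 \<Longrightarrow> distr M (count_space UNIV) (I n) = measure_pmf (pmf_of_set {1..n})"
    and I_indep: "indep_vars (\<lambda>_. count_space UNIV) I {1..}"
    and nu_yule: "yule_process M nu"
    and sets_PX [measurable_cong]: "sets PX = sets borel"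
    and X_rv: "\<And>j. j \<ge> 1 \<Longrightarrow> X j \<in> borel_measurable M"
    and X_law: "\<And>j. j \<ge> 1 \<Longrightarrow> distr M borel (X j) = PX"
    and X_indep: "indep_vars (\<lambda>_. borel) X {1..}"
    and blocks_indep: "indep_sets
        (\<lambda>k::nat. if k = 0 then fam_events M (\<lambda>_. borel) X {1..}
                  else if k = 1 then fam_events M (\<lambda>_. count_space UNIV) nu {0..}
                  else if k = 2 then fam_events M (\<lambda>_. borel) LR {1..}
                  else fam_events M (\<lambda>_. count_space UNIV) I {1..}) {0..3}"
begin

definition block :: "nat \<Rightarrow> 'a set set" where
  "block k = (if k = 0 then fam_events M (\<lambda>_. borel) X {1..}
     else if k = 1 then fam_events M (\<lambda>_. count_space UNIV) nu {0..}
     else if k = 2 then fam_events M (\<lambda>_. borel) LR {1..}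
     else fam_events M (\<lambda>_. count_space UNIV) I {1..})"

definition blocks :: "nat set \<Rightarrow> 'a measure" where
  "blocks K = sigma (space M) (\<Union>k\<in>K. block k)"

lemma block_Pow: "(\<Union>k\<in>K. block k) \<subseteq> Pow (space M)"
  unfolding block_def by (intro UN_least) (simp add: fam_events_Pow)

lemma sets_blocks: "sets (blocks K) = sigma_sets (space M) (\<Union>k\<in>K. block k)"
  and space_blocks [simp]: "space (blocks K) = space M"
  unfolding blocks_def using block_Pow[of K] by (simp_all add: space_measure_of_conv)

lemma block_subset_blocks: "k \<in> K \<Longrightarrow> block k \<subseteq> sets (blocks K)"
  unfolding sets_blocks by (auto intro: sigma_sets.Basic)

text \<open>Disjoint groups of independent families that are stable under intersection generate
  independent sigma-algebras; the two groups are indexed by \<open>bool\<close>.\<close>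

lemma prob_blocks_Int:
  assumes K: "K1 \<subseteq> {0..3}" "K2 \<subseteq> {0..3}" "K1 \<inter> K2 = {}"
    and AB: "A \<in> sets (blocks K1)" "B \<in> sets (blocks K2)"
  shows "prob (A \<inter> B) = prob A * prob B"
proof -
  have "indep_sets (\<lambda>b. sigma_sets (space M) (\<Union>k\<in>(if b then K1 else K2). block k)) (UNIV :: bool set)"
  proof (rule indep_sets_collect_sigma)
    have "indep_sets block {0..3}"
      using blocks_indep unfolding block_def .
    then show "indep_sets block (\<Union>b\<in>UNIV. if b then K1 else K2)"
      using K by (elim indep_sets_mono_index[rotated]) auto
    show "Int_stable (block k)" for k
      by (simp add: block_def Int_stable_fam_events)
    show "disjoint_family_on (\<lambda>b. if b then K1 else K2) UNIV"
      using K by (auto simp: disjoint_family_on_def)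
  qed
  then have "prob (\<Inter>b\<in>UNIV. if b then A else B) = (\<Prod>b\<in>UNIV. prob (if b then A else B))"
    using AB unfolding sets_blocks by (intro indep_setsD[of _ UNIV]) auto
  then show ?thesis by (simp add: UNIV_bool Int_commute mult.commute)
qed

lemma blocks_events: "k \<le> 3 \<Longrightarrow> block k \<subseteq> events"
  using blocks_indep unfolding indep_sets_def block_def by auto

lemma LR_blocks:
  assumes "1 \<le> n" "2 \<in> K"
  shows "LR n \<in> blocks K \<rightarrow>\<^sub>M borel"
proof -
  have *: "fam_events M (\<lambda>_. borel) LR {1..} \<subseteq> sets (blocks K)"
    using block_subset_blocks[OF assms(2)] unfolding block_def by simp
  show ?thesis
    by (rule measurable_fam_events[where Y=LR, OF _ LR_rv[OF assms(1)] * space_blocks]) (use assms in simp)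
qed

lemma I_blocks:
  assumes "1 \<le> n" "3 \<in> K"
  shows "I n \<in> blocks K \<rightarrow>\<^sub>M count_space UNIV"
proof -
  have *: "fam_events M (\<lambda>_. count_space UNIV) I {1..} \<subseteq> sets (blocks K)"
    using block_subset_blocks[OF assms(2)] unfolding block_def by simp
  show ?thesis
    by (rule measurable_fam_events[where Y=I, OF _ I_rv[OF assms(1)] * space_blocks]) (use assms in simp)
qed

lemma X_blocks:
  assumes "1 \<le> n" "0 \<in> K"
  shows "X n \<in> blocks K \<rightarrow>\<^sub>M borel"
proof -
  have *: "fam_events M (\<lambda>_. borel) X {1..} \<subseteq> sets (blocks K)"
    using block_subset_blocks[OF assms(2)] unfolding block_def by simp
  show ?thesis
    by (rule measurable_fam_events[where Y=X, OF _ X_rv[OF assms(1)] * space_blocks]) (use assms in simp)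
qed

lemma nu_rv: "0 \<le> t \<Longrightarrow> nu t \<in> M \<rightarrow>\<^sub>M count_space UNIV"
  using nu_yule by (simp add: yule_process_def)

lemma nu_blocks:
  assumes "0 \<le> t" "1 \<in> K"
  shows "nu t \<in> blocks K \<rightarrow>\<^sub>M count_space UNIV"
proof -
  have *: "fam_events M (\<lambda>_. count_space UNIV) nu {0..} \<subseteq> sets (blocks K)"
    using block_subset_blocks[OF assms(2)] unfolding block_def by simp
  show ?thesis
    by (rule measurable_fam_events[where Y=nu, OF _ nu_rv[OF assms(1)] * space_blocks]) (use assms in simp)
qed

definition U :: "nat \<Rightarrow> 'a \<Rightarrow> nat \<times> (real \<times> real)" where
  "U i \<omega> = (I i \<omega>, LR i \<omega>)"

lemma U_measurable:
  assumes "1 \<le> i" "{2, 3} \<subseteq> K"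
  shows "U i \<in> blocks K \<rightarrow>\<^sub>M node_law Q i"
proof -
  have "U i \<in> blocks K \<rightarrow>\<^sub>M (count_space UNIV \<Otimes>\<^sub>M borel)"
    unfolding U_def using assms by (intro measurable_Pair I_blocks LR_blocks) auto
  then show ?thesis by (simp add: measurable_cong_sets[OF refl Q.sets_node_law])
qed

lemma U_rv: "1 \<le> i \<Longrightarrow> U i \<in> M \<rightarrow>\<^sub>M node_law Q i"
  unfolding U_def measurable_cong_sets[OF refl Q.sets_node_law] by (intro measurable_Pair I_rv LR_rv)

lemma U_law: "1 \<le> i \<Longrightarrow> distr M (node_law Q i) (U i) = node_law Q i"
proof -
  assume i: "1 \<le> i"
  let ?p = "measure_pmf (pmf_of_set {1..i})"
  note [measurable] = U_rv[OF i] I_rv[OF i] LR_rv[OF i]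
  have "?p \<Otimes>\<^sub>M Q = distr M (node_law Q i) (U i)"
  proof (rule pair_measure_eqI)
    show "sigma_finite_measure ?p" "sigma_finite_measure Q"
      by (auto intro: prob_space_imp_sigma_finite measure_pmf.prob_space_axioms Q.prob_space_axioms)
    show "sets (?p \<Otimes>\<^sub>M Q) = sets (distr M (node_law Q i) (U i))"
      by (simp only: sets_distr node_law_def)
    fix A B assume A: "A \<in> sets ?p" and B: "B \<in> sets Q"
    then have B': "B \<in> sets borel" by (simp add: Q.sets_Q)
    have AB: "A \<times> B \<in> sets (node_law Q i)" using A B by (simp add: node_law_def)
    have "prob ((I i -` A \<inter> space M) \<inter> (LR i -` B \<inter> space M)) = prob (I i -` A \<inter> space M) * prob (LR i -` B \<inter> space M)"
      using measurable_sets[OF I_blocks[OF i, of "{3}"], of A] measurable_sets[OF LR_blocks[OF i, of "{2}"], of B] B'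
      by (intro prob_blocks_Int[of "{3}" "{2}"]) (auto simp: space_blocks)
    moreover have "emeasure ?p A = emeasure M (I i -` A \<inter> space M)"
      using I_law[OF i, symmetric] by (simp add: emeasure_distr)
    moreover have "emeasure Q B = emeasure M (LR i -` B \<inter> space M)"
      using B' by (subst LR_law[OF i, symmetric]) (simp add: emeasure_distr)
    moreover have "emeasure (distr M (node_law Q i) (U i)) (A \<times> B) = emeasure M ((I i -` A \<inter> space M) \<inter> (LR i -` B \<inter> space M))"
      using AB by (subst emeasure_distr) (auto simp: U_def intro!: arg_cong[where f="emeasure M"])
    ultimately show "emeasure ?p A * emeasure Q B = emeasure (distr M (node_law Q i) (U i)) (A \<times> B)"
      by (simp add: emeasure_eq_measure ennreal_mult)
  qed
  then show ?thesis by (simp add: node_law_def)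
qed

lemma U_indep: "indep_vars (node_law Q) U {1..}"
proof -
  have "indep_vars (\<lambda>i. count_space UNIV \<Otimes>\<^sub>M borel) (\<lambda>i \<omega>. (I i \<omega>, LR i \<omega>)) {1..}"
  proof (rule indep_vars_Pair[OF I_indep LR_indep], rule indep_setI)
    have 3: "fam_events M (\<lambda>_. count_space UNIV) I {1..} = block 3" and 2: "fam_events M (\<lambda>_. borel) LR {1..} = block 2"
      by (simp_all add: block_def)
    show "fam_events M (\<lambda>_. count_space UNIV) I {1..} \<subseteq> events" "fam_events M (\<lambda>_. borel) LR {1..} \<subseteq> events"
      unfolding 2 3 by (rule blocks_events, simp)+
    show "prob (A \<inter> B) = prob A * prob B"
      if "A \<in> fam_events M (\<lambda>_. count_space UNIV) I {1..}" "B \<in> fam_events M (\<lambda>_. borel) LR {1..}" for A B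
      using that block_subset_blocks[of 3 "{3}"] block_subset_blocks[of 2 "{2}"] unfolding 2 3
      by (intro prob_blocks_Int[of "{3}" "{2}"]) auto
  qed
  then show ?thesis
    unfolding indep_vars_def2 U_def measurable_cong_sets[OF refl Q.sets_node_law] Q.sets_node_law .
qed

definition V :: "nat \<Rightarrow> 'a \<Rightarrow> nat \<Rightarrow> nat \<times> (real \<times> real)" where
  "V m \<omega> = (\<lambda>i\<in>{1..m}. U i \<omega>)"

definition W :: "nat \<Rightarrow> 'a \<Rightarrow> nat \<Rightarrow> real" where
  "W n \<omega> = (\<lambda>j\<in>{1..n}. X j \<omega>)"

definition PXn :: "nat \<Rightarrow> (nat \<Rightarrow> real) measure" where
  "PXn n = PiM {1..n} (\<lambda>_. PX)"

lemma V_law: "distr M (Omega Q m) (V m) = Omega Q m"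
  unfolding V_def Omega_def
  by (rule distr_restrict_indep_vars) (auto intro!: U_law indep_vars_subset[OF U_indep])

lemma W_law: "distr M (PXn n) (W n) = PXn n"
proof -
  have "indep_vars (\<lambda>_. PX) X {1..}"
    using X_indep unfolding indep_vars_def2 measurable_cong_sets[OF refl sets_PX] sets_PX .
  moreover have "distr M PX (X j) = PX" if "1 \<le> j" for j
    using X_law[OF that] distr_cong[OF refl sets_PX, of M "X j" "X j"] by simp
  ultimately show ?thesis
    unfolding W_def PXn_def by (intro distr_restrict_indep_vars) (auto intro: indep_vars_subset)
qed

lemma V_blocks: "{2, 3} \<subseteq> K \<Longrightarrow> V m \<in> blocks K \<rightarrow>\<^sub>M Omega Q m"
  unfolding V_def Omega_def by (intro measurable_restrict U_measurable) auto

lemma W_blocks: "0 \<in> K \<Longrightarrow> W n \<in> blocks K \<rightarrow>\<^sub>M PXn n"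
  unfolding W_def PXn_def
  by (intro measurable_restrict) (auto simp: measurable_cong_sets[OF refl sets_PX] intro: X_blocks)

lemma V_rv [measurable]: "V m \<in> M \<rightarrow>\<^sub>M Omega Q m"
  unfolding V_def Omega_def by (intro measurable_restrict U_rv) auto

lemma W_rv [measurable]: "W n \<in> M \<rightarrow>\<^sub>M PXn n"
  unfolding W_def PXn_def
  by (intro measurable_restrict) (auto simp: measurable_cong_sets[OF refl sets_PX] intro: X_rv)

lemma VW_law: "distr M (Omega Q m \<Otimes>\<^sub>M PXn n) (\<lambda>\<omega>. (V m \<omega>, W n \<omega>)) = Omega Q m \<Otimes>\<^sub>M PXn n"
proof (rule pair_measure_eqI[symmetric])
  show "sigma_finite_measure (Omega Q m)" "sigma_finite_measure (PXn n)"
    by (auto simp: PXn_def intro!: prob_space_imp_sigma_finite Q.prob_space_Omega prob_space_PiM PX.prob_space_axioms)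
  show "sets (Omega Q m \<Otimes>\<^sub>M PXn n) = sets (distr M (Omega Q m \<Otimes>\<^sub>M PXn n) (\<lambda>\<omega>. (V m \<omega>, W n \<omega>)))"
    by simp
  fix A B assume A [measurable]: "A \<in> sets (Omega Q m)" and B [measurable]: "B \<in> sets (PXn n)"
  have "prob ((V m -` A \<inter> space M) \<inter> (W n -` B \<inter> space M)) = prob (V m -` A \<inter> space M) * prob (W n -` B \<inter> space M)"
    using measurable_sets[OF V_blocks[of "{2, 3}" m] A] measurable_sets[OF W_blocks[of "{0}" n] B]
    by (intro prob_blocks_Int[of "{2, 3}" "{0}"]) (auto simp: space_blocks)
  moreover have "emeasure (Omega Q m) A = emeasure M (V m -` A \<inter> space M)"
    by (subst V_law[symmetric]) (simp add: emeasure_distr)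
  moreover have "emeasure (PXn n) B = emeasure M (W n -` B \<inter> space M)"
    by (subst W_law[symmetric]) (simp add: emeasure_distr)
  moreover have "emeasure (distr M (Omega Q m \<Otimes>\<^sub>M PXn n) (\<lambda>\<omega>. (V m \<omega>, W n \<omega>))) (A \<times> B) =
      emeasure M ((V m -` A \<inter> space M) \<inter> (W n -` B \<inter> space M))"
    by (subst emeasure_distr) (auto intro!: arg_cong[where f="emeasure M"])
  ultimately show "emeasure (Omega Q m) A * emeasure (PXn n) B =
      emeasure (distr M (Omega Q m \<Otimes>\<^sub>M PXn n) (\<lambda>\<omega>. (V m \<omega>, W n \<omega>))) (A \<times> B)"
    by (simp add: emeasure_eq_measure ennreal_mult)
qed

section \<open>Exact law of the maximum at a fixed time\<close>

definition cover :: "real \<Rightarrow> real \<Rightarrow> real" where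
  "cover c b = measure PX {y. \<bar>b * y\<bar> \<le> c}"

lemma cover_measurable [measurable]: "cover c \<in> borel_measurable borel"
proof -
  have "{w \<in> space (borel \<Otimes>\<^sub>M PX). \<bar>fst w * snd w\<bar> \<le> c} \<in> sets (borel \<Otimes>\<^sub>M PX)"
    by measurable
  then have "(\<lambda>b. emeasure PX (Pair b -` {w \<in> space (borel \<Otimes>\<^sub>M PX). \<bar>fst w * snd w\<bar> \<le> c})) \<in> borel_measurable borel"
    by (rule PX.measurable_emeasure_Pair)
  moreover have "Pair b -` {w \<in> space (borel \<Otimes>\<^sub>M PX). \<bar>fst w * snd w\<bar> \<le> c} = {y. \<bar>b * y\<bar> \<le> c}" for b
    using sets_eq_imp_space_eq[OF sets_PX] by (auto simp: space_pair_measure)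
  ultimately show ?thesis
    unfolding cover_def measure_def by simp
qed

lemma cover_bounds: "0 \<le> cover c b" "cover c b \<le> 1"
  by (simp_all add: cover_def)

definition below :: "real \<Rightarrow> nat \<Rightarrow> ((nat \<Rightarrow> nat \<times> (real \<times> real)) \<times> (nat \<Rightarrow> real)) set" where
  "below c m = {w \<in> space (Omega Q m \<Otimes>\<^sub>M PXn (Suc m)). \<forall>j\<in>{1..Suc m}. \<bar>wts (fst w) m j * snd w j\<bar> \<le> c}"

lemma below_sets [measurable]: "below c m \<in> sets (Omega Q m \<Otimes>\<^sub>M PXn (Suc m))"
proof -
  have [measurable]: "(\<lambda>w. wts (fst w) m j) \<in> borel_measurable (Omega Q m \<Otimes>\<^sub>M PXn (Suc m))" for j
    by (rule measurable_compose[OF measurable_fst]) simp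
  have [measurable]: "(\<lambda>w. snd w j) \<in> borel_measurable (Omega Q m \<Otimes>\<^sub>M PXn (Suc m))" if "j \<in> {1..Suc m}" for j
    using that measurable_component_singleton[of j "{1..Suc m}" "\<lambda>_. PX"]
    by (intro measurable_compose[OF measurable_snd]) (simp add: PXn_def measurable_cong_sets[OF refl sets_PX])
  show ?thesis unfolding below_def by (rule sets.sets_Collect_finite_All') auto
qed

text \<open>Given the weights, the \<open>m + 1\<close> variables are independent, so the
  conditional probability that no leaf exceeds \<open>c\<close> is a product of values of
  \<open>cover\<close>.\<close>

lemma prob_below:
  "complex_of_real (prob ((\<lambda>\<omega>. (V m \<omega>, W (Suc m) \<omega>)) -` below c m \<inter> space M)) = Q.Eprod m (\<lambda>b. of_real (cover c b))"
proof -
  interpret PXP: product_prob_space "\<lambda>_::nat. PX" UNIV by (rule product_prob_spaceI) (rule PX.prob_space_axioms)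
  interpret PXn: prob_space "PXn (Suc m)" unfolding PXn_def by (intro prob_space_PiM PX.prob_space_axioms)
  interpret O: prob_space "Omega Q m" by (rule Q.prob_space_Omega)
  let ?P = "\<lambda>u. \<Prod>j=1..Suc m. cover c (wts u m j)"
  have int: "integrable (Omega Q m) ?P" and nonneg: "\<And>u. 0 \<le> ?P u"
  proof -
    show nn: "0 \<le> ?P u" for u by (intro prod_nonneg) (simp add: cover_bounds)
    have "?P u \<le> 1" for u by (intro prod_le_1) (simp add: cover_bounds)
    then show "integrable (Omega Q m) ?P"
      using nn by (intro O.integrable_const_bound[of _ 1] AE_I2) (simp_all del: prod.cl_ivl_Suc)
  qed
  have "ennreal (prob ((\<lambda>\<omega>. (V m \<omega>, W (Suc m) \<omega>)) -` below c m \<inter> space M)) =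
      emeasure (distr M (Omega Q m \<Otimes>\<^sub>M PXn (Suc m)) (\<lambda>\<omega>. (V m \<omega>, W (Suc m) \<omega>))) (below c m)"
    by (simp add: emeasure_distr emeasure_eq_measure)
  also have "\<dots> = (\<integral>\<^sup>+u. emeasure (PXn (Suc m)) (Pair u -` below c m) \<partial>Omega Q m)"
    unfolding VW_law by (rule PXn.emeasure_pair_measure_alt[OF below_sets])
  also have "\<dots> = (\<integral>\<^sup>+u. ennreal (?P u) \<partial>Omega Q m)"
  proof (rule nn_integral_cong)
    fix u assume u: "u \<in> space (Omega Q m)"
    let ?A = "\<lambda>j. {y. \<bar>wts u m j * y\<bar> \<le> c}"
    have "Pair u -` below c m = PiE {1..Suc m} ?A"
      using u sets_eq_imp_space_eq[OF sets_PX]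
      by (auto simp: below_def PXn_def space_pair_measure space_PiM PiE_def Pi_def extensional_def)
    also have "emeasure (PXn (Suc m)) \<dots> = (\<Prod>j=1..Suc m. emeasure PX (?A j))"
      unfolding PXn_def by (rule PXP.emeasure_PiM) (auto simp: sets_PX)
    also have "\<dots> = (\<Prod>j=1..Suc m. ennreal (cover c (wts u m j)))"
      by (simp add: cover_def PX.emeasure_eq_measure)
    also have "\<dots> = ennreal (?P u)"
      by (rule prod_ennreal) (rule cover_bounds)
    finally show "emeasure (PXn (Suc m)) (Pair u -` below c m) = ennreal (?P u)" .
  qed
  also have "\<dots> = ennreal (\<integral>u. ?P u \<partial>Omega Q m)"
    using int nonneg by (intro nn_integral_eq_integral) auto
  finally have "prob ((\<lambda>\<omega>. (V m \<omega>, W (Suc m) \<omega>)) -` below c m \<inter> space M) = (\<integral>u. ?P u \<partial>Omega Q m)"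
    using nonneg by (subst (asm) ennreal_inj) (auto intro!: integral_nonneg_AE)
  then show ?thesis
    unfolding Q.Eprod_def by (simp del: prod.cl_ivl_Suc flip: of_real_prod)
qed

lemma prob_nu: 
  assumes "0 \<le> t"
  shows "prob {\<omega> \<in> space M. nu t \<omega> = 0} = 0"
    and "prob {\<omega> \<in> space M. nu t \<omega> = Suc m} = exp (- t) * (1 - exp (- t)) ^ m"
proof -
  have "prob {\<omega> \<in> space M. nu t \<omega> = n} = yule_trans t 1 n" for n
    using nu_yule[unfolded yule_process_def, THEN conjunct2, rule_format, of "[n]" "[t]"] assms by simp
  then show "prob {\<omega> \<in> space M. nu t \<omega> = 0} = 0"
    "prob {\<omega> \<in> space M. nu t \<omega> = Suc m} = exp (- t) * (1 - exp (- t)) ^ m"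
    by (auto simp: yule_trans_def)
qed

lemma prob_nu_below:
  assumes t: "0 \<le> t"
  shows "prob ({\<omega> \<in> space M. nu t \<omega> = n} \<inter> ((\<lambda>\<omega>. (V m \<omega>, W (Suc m) \<omega>)) -` below c m \<inter> space M)) =
    prob {\<omega> \<in> space M. nu t \<omega> = n} * prob ((\<lambda>\<omega>. (V m \<omega>, W (Suc m) \<omega>)) -` below c m \<inter> space M)"
proof (rule prob_blocks_Int[of "{1}" "{0, 2, 3}"])
  have "nu t -` {n} \<inter> space (blocks {1}) \<in> sets (blocks {1})"
    by (rule measurable_sets[OF nu_blocks[OF t]]) auto
  moreover have "nu t -` {n} \<inter> space (blocks {1}) = {\<omega> \<in> space M. nu t \<omega> = n}"
    by (auto simp: space_blocks)
  ultimately show "{\<omega> \<in> space M. nu t \<omega> = n} \<in> sets (blocks {1})" by simp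
  have "(\<lambda>\<omega>. (V m \<omega>, W (Suc m) \<omega>)) \<in> blocks {0, 2, 3} \<rightarrow>\<^sub>M (Omega Q m \<Otimes>\<^sub>M PXn (Suc m))"
    by (intro measurable_Pair V_blocks W_blocks) auto
  from measurable_sets[OF this below_sets, of c]
  show "(\<lambda>\<omega>. (V m \<omega>, W (Suc m) \<omega>)) -` below c m \<inter> space M \<in> sets (blocks {0, 2, 3})"
    by (simp add: space_blocks)
qed auto

text \<open>The first \<open>n\<close> indices form a list with countably many possible values; for
  each value \<open>betas_entry_measurable\<close> applies with fixed indices.\<close>

lemma betas_measurable:
  "(\<lambda>\<omega>. betas (\<lambda>n. LR n \<omega>) (\<lambda>n. I n \<omega>) n ! j) \<in> borel_measurable M"
proof -
  define J where "J \<omega> = map (\<lambda>i. I i \<omega>) [1..<Suc n]" for \<omega>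
  have [measurable]: "(\<lambda>\<omega>. map (\<lambda>i. I i \<omega>) [1..<Suc k]) \<in> M \<rightarrow>\<^sub>M count_space UNIV" for k
  proof (induction k)
    case (Suc k)
    note [measurable] = Suc I_rv[of "Suc k"]
    have "(\<lambda>\<omega>. (\<lambda>l i. l @ [i]) (map (\<lambda>i. I i \<omega>) [1..<Suc k]) (I (Suc k) \<omega>)) \<in> M \<rightarrow>\<^sub>M count_space UNIV"
      by measurable
    then show ?case by simp
  qed simp
  have J: "J \<in> M \<rightarrow>\<^sub>M count_space UNIV" unfolding J_def by measurable
  have cong: "betas L I1 k = betas L I2 k" if "\<And>i. 1 \<le> i \<Longrightarrow> i \<le> k \<Longrightarrow> I1 i = I2 i" for L I1 I2 k
    using that by (induction L I1 k rule: betas.induct) (auto simp: Let_def)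
  have "betas (\<lambda>n. LR n \<omega>) (\<lambda>n. I n \<omega>) n = betas (\<lambda>n. LR n \<omega>) (\<lambda>i. J \<omega> ! (i - 1)) n" for \<omega>
    
  proof (rule cong)
    fix i assume "1 \<le> i" "i \<le> n"
    then show "I i \<omega> = J \<omega> ! (i - 1)" by (cases i) (simp_all add: J_def del: upt_Suc)
  qed
  then have "(\<lambda>\<omega>. betas (\<lambda>n. LR n \<omega>) (\<lambda>n. I n \<omega>) n ! j) =
      (\<lambda>\<omega>. (\<lambda>l \<omega>. betas (\<lambda>n. LR n \<omega>) (\<lambda>i. l ! (i - 1)) n ! j) (J \<omega>) \<omega>)"
    by simp
  also have "\<dots> \<in> borel_measurable M"
    by (rule measurable_compose_countable[OF _ J]) (rule betas_entry_measurable[OF LR_rv, THEN conjunct1, rule_format])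
  finally show ?thesis .
qed

lemma Hproc_measurable [measurable]:
  assumes t: "0 \<le> t"
  shows "Hproc LR I X nu t \<in> borel_measurable M"
proof -
  have "(\<lambda>\<omega>. (\<lambda>n \<omega>. Max ((\<lambda>j. \<bar>betas (\<lambda>n. LR n \<omega>) (\<lambda>n. I n \<omega>) n ! (j - 1) * X j \<omega>\<bar>) ` {1..n})) (nu t \<omega>) \<omega>) \<in> borel_measurable M"
  proof (rule measurable_compose_countable[OF _ nu_rv[OF t]])
    show "(\<lambda>\<omega>. Max ((\<lambda>j. \<bar>betas (\<lambda>n. LR n \<omega>) (\<lambda>n. I n \<omega>) n ! (j - 1) * X j \<omega>\<bar>) ` {1..n})) \<in> borel_measurable M" for n
    proof (rule borel_measurable_Max)
      fix j assume "j \<in> {1..n}"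
      then show "(\<lambda>\<omega>. \<bar>betas (\<lambda>n. LR n \<omega>) (\<lambda>n. I n \<omega>) n ! (j - 1) * X j \<omega>\<bar>) \<in> borel_measurable M"
        by (intro borel_measurable_abs borel_measurable_times betas_measurable X_rv) simp
    qed simp
  qed
  then show ?thesis by (simp add: Hproc_def[abs_def])
qed

lemma AE_I_valid: "AE \<omega> in M. \<forall>i\<ge>1. 1 \<le> I i \<omega> \<and> I i \<omega> \<le> i"
proof -
  have "AE \<omega> in M. i \<ge> 1 \<longrightarrow> 1 \<le> I i \<omega> \<and> I i \<omega> \<le> i" for i
  proof (cases "i \<ge> 1")
    case True
    have "AE k in distr M (count_space UNIV) (I i). 1 \<le> k \<and> k \<le> i"
      unfolding I_law[OF True] using True by (auto simp: AE_measure_pmf_iff)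
    then show ?thesis
      using I_rv[OF True] by (subst (asm) AE_distr_iff) (auto elim: eventually_mono)
  qed simp
  then show ?thesis by (simp add: AE_all_countable)
qed

text \<open>The number of leaves is independent of the tree and of the variables, so decomposing by
  its value produces the geometric weights of \<open>Emix\<close>.\<close>

theorem prob_Hproc_le:
  assumes t: "0 < t"
  shows "complex_of_real (prob {\<omega> \<in> space M. Hproc LR I X nu t \<omega> \<le> c}) = Q.Emix (exp (- t)) (\<lambda>b. of_real (cover c b))"
proof -
  note [measurable] = nu_rv[OF less_imp_le[OF t]] Hproc_measurable[OF less_imp_le[OF t]]
  define A where "A n = {\<omega> \<in> space M. nu t \<omega> = n \<and> Hproc LR I X nu t \<omega> \<le> c}" for n
  have A [measurable]: "A n \<in> events" for n
    unfolding A_def using t by measurable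
  have A_Suc: "prob (A (Suc m)) = exp (- t) * (1 - exp (- t)) ^ m *
      prob ((\<lambda>\<omega>. (V m \<omega>, W (Suc m) \<omega>)) -` below c m \<inter> space M)" for m
  proof -
    have "prob (A (Suc m)) = prob ({\<omega> \<in> space M. nu t \<omega> = Suc m} \<inter> ((\<lambda>\<omega>. (V m \<omega>, W (Suc m) \<omega>)) -` below c m \<inter> space M))"
    proof (rule measure_eq_AE)
      \<comment> \<open>Only an almost sure identity is available, since \<open>betas\<close> and
        \<open>wts\<close> are compared for indices in range.\<close>
      show "AE \<omega> in M. (\<omega> \<in> A (Suc m)) = (\<omega> \<in> {\<omega> \<in> space M. nu t \<omega> = Suc m} \<inter> ((\<lambda>\<omega>. (V m \<omega>, W (Suc m) \<omega>)) -` below c m \<inter> space M))"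
        using AE_I_valid AE_space
      proof eventually_elim
        case (elim \<omega>)
        let ?b = "betas (\<lambda>n. LR n \<omega>) (\<lambda>n. I n \<omega>) (Suc m)"
        have b: "?b ! (j - 1) = wts (V m \<omega>) m j" if "j \<in> {1..Suc m}" for j
        proof -
          have "?b ! (j - 1) = wts (\<lambda>i. (I i \<omega>, LR i \<omega>)) m j"
            using betas_wts[of m "\<lambda>n. I n \<omega>" "\<lambda>n. LR n \<omega>"] elim that by auto
          also have "\<dots> = wts (V m \<omega>) m j"
            by (rule wts_cong) (auto simp: V_def U_def)
          finally show ?thesis .
        qed
        have "Max ((\<lambda>j. \<bar>?b ! (j - 1) * X j \<omega>\<bar>) ` {1..Suc m}) \<le> c \<longleftrightarrow> (\<forall>j\<in>{1..Suc m}. \<bar>?b ! (j - 1) * X j \<omega>\<bar> \<le> c)"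
          by (subst Max_le_iff) auto
        also have "\<dots> \<longleftrightarrow> (\<forall>j\<in>{1..Suc m}. \<bar>wts (V m \<omega>) m j * W (Suc m) \<omega> j\<bar> \<le> c)"
        proof (rule ball_cong)
          fix j assume j: "j \<in> {1..Suc m}"
          then have "W (Suc m) \<omega> j = X j \<omega>" by (simp add: W_def)
          then show "\<bar>?b ! (j - 1) * X j \<omega>\<bar> \<le> c \<longleftrightarrow> \<bar>wts (V m \<omega>) m j * W (Suc m) \<omega> j\<bar> \<le> c"
            by (simp only: b[OF j])
        qed simp
        also have "\<dots> \<longleftrightarrow> (V m \<omega>, W (Suc m) \<omega>) \<in> below c m"
          using measurable_space[OF V_rv] measurable_space[OF W_rv] elim
          by (simp add: below_def space_pair_measure)
        finally have "Hproc LR I X nu t \<omega> \<le> c \<longleftrightarrow> (V m \<omega>, W (Suc m) \<omega>) \<in> below c m" if "nu t \<omega> = Suc m"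
          by (simp only: Hproc_def that)
        then show ?case
          using elim(2) by (cases "nu t \<omega> = Suc m") (simp_all add: A_def)
      qed
    qed (use t in measurable)
    then show ?thesis
      using t by (simp add: prob_nu_below prob_nu)
  qed
  \<comment> \<open>For \<open>nu t \<omega> = 0\<close> the maximum runs over the empty set and its
    value is unspecified, but this event is null.\<close>
  have "A 0 \<subseteq> {\<omega> \<in> space M. nu t \<omega> = 0}" by (auto simp: A_def)
  then have "prob (A 0) \<le> prob {\<omega> \<in> space M. nu t \<omega> = 0}"
    using t by (intro finite_measure_mono) auto
  then have A0: "prob (A 0) = 0"
    using t prob_nu(1)[of t] by (simp add: measure_le_0_iff)
  have "(\<lambda>n. prob (A n)) sums prob (\<Union>n. A n)"
    by (rule finite_measure_UNION) (auto simp: disjoint_family_on_def A_def[of _, abs_def] intro: A)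
  also have "(\<Union>n. A n) = {\<omega> \<in> space M. Hproc LR I X nu t \<omega> \<le> c}"
    by (auto simp: A_def)
  finally have "(\<lambda>m. prob (A (Suc m))) sums prob {\<omega> \<in> space M. Hproc LR I X nu t \<omega> \<le> c}"
    using A0 by (subst sums_Suc_iff) simp
  then have "(\<lambda>m. complex_of_real (prob (A (Suc m)))) sums complex_of_real (prob {\<omega> \<in> space M. Hproc LR I X nu t \<omega> \<le> c})"
    by (rule sums_of_real)
  then show ?thesis
    unfolding Q.Emix_def A_Suc of_real_mult prob_below by (simp add: sums_iff)
qed

end

section \<open>Moments, tails and the limit law\<close>

text \<open>For \<open>y \<ge> 0\<close>, \<open>P(\<bar>X\<bar> > y)\<close> is the sum of
  \<open>1 - F(y)\<close> and the left limit of \<open>F\<close> at \<open>-y\<close>.\<close>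

lemma tail_two_sided:
  fixes PX :: "real measure"
  assumes PX: "prob_space PX" "sets PX = sets borel" and \<alpha>: "0 < \<alpha>"
    and pos: "((\<lambda>x. x powr \<alpha> * (1 - measure PX {..x})) \<longlongrightarrow> c0p) at_top"
    and neg: "((\<lambda>x. \<bar>x\<bar> powr \<alpha> * measure PX {..x}) \<longlongrightarrow> c0m) at_bot"
  shows "((\<lambda>y. y powr \<alpha> * (1 - measure PX {z. \<bar>z\<bar> \<le> y})) \<longlongrightarrow> c0p + c0m) at_top"
proof -
  interpret prob_space PX by fact
  have sets [simp]: "A \<in> events \<longleftrightarrow> A \<in> sets borel" for A by (simp add: PX)
  have space [simp]: "space PX = UNIV" using sets_eq_imp_space_eq[OF PX(2)] by simp
  have neg': "((\<lambda>y. y powr \<alpha> * prob {..-y}) \<longlongrightarrow> c0m) at_top"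
    using filterlim_compose[OF neg filterlim_uminus_at_bot_at_top]
    by (rule tendsto_cong[THEN iffD1, rotated])
      (auto intro!: eventually_mono[OF eventually_ge_at_top[of 0]])
  \<comment> \<open>The strict inequality is squeezed between the values of \<open>F\<close> at
    \<open>-(y + 1)\<close> and at \<open>-y\<close>, whose rescaled limits agree since
    \<open>(y / (y + 1))^\<alpha>\<close> tends to \<open>1\<close>.\<close>
  have strict: "((\<lambda>y. y powr \<alpha> * prob {..<-y}) \<longlongrightarrow> c0m) at_top"
  proof (rule tendsto_sandwich)
    show "\<forall>\<^sub>F y in at_top. y powr \<alpha> * prob {..-(y+1)} \<le> y powr \<alpha> * prob {..<-y}"
      by (intro always_eventually allI mult_left_mono finite_measure_mono) auto
    show "\<forall>\<^sub>F y in at_top. y powr \<alpha> * prob {..<-y} \<le> y powr \<alpha> * prob {..-y}"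
      by (intro always_eventually allI mult_left_mono finite_measure_mono) auto
    have shift: "filterlim (\<lambda>y::real. y + 1) at_top at_top"
      using filterlim_tendsto_add_at_top[OF tendsto_const filterlim_ident, of "1::real"] by (simp add: add.commute)
    have "((\<lambda>y::real. 1 - inverse (y + 1)) \<longlongrightarrow> 1 - 0) at_top"
      by (intro tendsto_diff tendsto_const tendsto_inverse_0_at_top shift)
    then have "((\<lambda>y::real. (1 - inverse (y + 1)) powr \<alpha>) \<longlongrightarrow> (1 - 0) powr \<alpha>) at_top"
      by (intro tendsto_powr tendsto_const) auto
    then have "((\<lambda>y. (1 - inverse (y + 1)) powr \<alpha> * ((y + 1) powr \<alpha> * prob {..-(y + 1)})) \<longlongrightarrow> (1 - 0) powr \<alpha> * c0m) at_top"
      by (intro tendsto_mult filterlim_compose[OF neg' shift])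
    moreover have "\<forall>\<^sub>F y::real in at_top. (1 - inverse (y + 1)) powr \<alpha> * ((y + 1) powr \<alpha> * prob {..-(y + 1)}) =
        y powr \<alpha> * prob {..-(y+1)}"
      using eventually_ge_at_top[of 0]
    proof eventually_elim
      case (elim y)
      then have "(1 - inverse (y + 1)) * (y + 1) = y" by (simp add: field_simps)
      then have "(1 - inverse (y + 1)) powr \<alpha> * (y + 1) powr \<alpha> = y powr \<alpha>"
        by (simp flip: powr_mult)
      then show ?case by (simp flip: mult.assoc)
    qed
    ultimately have "((\<lambda>y. y powr \<alpha> * prob {..-(y+1)}) \<longlongrightarrow> (1 - 0) powr \<alpha> * c0m) at_top"
      by (rule tendsto_cong[THEN iffD1, rotated])
    then show "((\<lambda>y. y powr \<alpha> * prob {..-(y+1)}) \<longlongrightarrow> c0m) at_top"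
      by simp
  qed (rule neg')
  have "((\<lambda>y. y powr \<alpha> * (1 - prob {..y}) + y powr \<alpha> * prob {..<-y}) \<longlongrightarrow> c0p + c0m) at_top"
    by (intro tendsto_add pos strict)
  moreover have "\<forall>\<^sub>F y in at_top. y powr \<alpha> * (1 - prob {..y}) + y powr \<alpha> * prob {..<-y} = y powr \<alpha> * (1 - prob {z. \<bar>z\<bar> \<le> y})"
    using eventually_ge_at_top[of 0]
  proof eventually_elim
    case (elim y)
    have "{z. \<bar>z\<bar> \<le> y} = {..y} - {..<-y}" by (auto simp: abs_le_iff)
    moreover have "prob ({..y} - {..<-y}) = prob {..y} - prob {..<-y}"
    proof (rule finite_measure_Diff)
      show "{..<-y} \<subseteq> {..y}"
      proof
        fix z assume "z \<in> {..<-y}"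
        with elim show "z \<in> {..y}" unfolding lessThan_iff atMost_iff by linarith
      qed
    qed simp_all
    ultimately show ?case by (simp only: right_diff_distrib)
  qed
  ultimately show ?thesis by (rule tendsto_cong[THEN iffD1, rotated])
qed

section \<open>Choice of the exponent from the moment hypotheses\<close>

lemma powr_convex:
  fixes x :: real
  assumes "0 \<le> u" "0 \<le> v" "u + v = 1"
  shows "x powr (u * s + v * t) \<le> u * x powr s + v * x powr t"
proof (cases "x = 0")
  case False
  then have "(x powr s) powr u * (x powr t) powr v \<le> u * x powr s + v * x powr t"
    using assms by (intro Youngs_inequality_0) auto
  then show ?thesis by (simp add: powr_powr powr_add mult.commute)
qed simp

text \<open>By \<open>powr_convex\<close> the moment \<open>E[L^s + R^s]\<close> is convex in
  \<open>s\<close>, and \<open>\<mu>(\<delta>) < \<mu>(\<alpha>)\<close> puts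
  \<open>S(\<delta>)\<close> strictly below the line through the origin and
  \<open>(\<alpha>, S(\<alpha>))\<close>. Interpolating between \<open>\<alpha>\<close> and
  \<open>\<delta>\<close> gives \<open>Sp < p * S\<close>.\<close>

lemma smoothing_cascade_of_mu:
  fixes Q :: "(real \<times> real) measure"
  assumes Q: "prob_space Q" "sets Q = sets borel"
    and LR_pos: "measure Q {p. fst p > 0} + measure Q {p. snd p > 0} > 1"
    and \<alpha>: "0 < \<alpha>" and \<delta>: "\<alpha> < \<delta>" "mu Q \<delta> < mu Q \<alpha>" "mu Q \<alpha> < \<infinity>"
  obtains p Sp where "smoothing_cascade Q \<alpha> (real_of_ereal (calS Q \<alpha>)) p Sp"
proof -
  interpret cascade Q using Q by (simp add: cascade_def cascade_axioms_def)
  define N where "N s = (\<integral>\<^sup>+p. ennreal (fst p powr s + snd p powr s) \<partial>Q)" for s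
  have calS: "calS Q s = enn2ereal (N s) - 1" for s by (simp add: calS_def N_def)
  have finite: "N s < \<infinity>" if "0 < s" "mu Q s < \<infinity>" for s
  proof (rule ccontr)
    assume "\<not> N s < \<infinity>"
    then have "N s = \<infinity>" by (simp add: less_top[symmetric])
    then show False using that by (simp add: mu_def calS)
  qed
  have val: "N s = ennreal (1 + real_of_ereal (calS Q s))" "calS Q s = ereal (real_of_ereal (calS Q s))" if fin: "N s < \<infinity>" for s
  proof -
    obtain r where r: "N s = ennreal r" "0 \<le> r" using fin by (cases "N s") auto
    then have "calS Q s = ereal (r - 1)"
      by (simp add: calS enn2ereal_ennreal one_ereal_def)
    with r show "N s = ennreal (1 + real_of_ereal (calS Q s))" "calS Q s = ereal (real_of_ereal (calS Q s))" by auto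
  qed
  \<comment> \<open>If a moment vanished, both weights would be \<open>0\<close> almost surely,
    against \<open>LR_pos\<close>. As \<open>ennreal\<close> sends nonpositive numbers to
    \<open>0\<close>, this yields \<open>-1 < r\<close> in \<open>gt\<close>.\<close>
  have positive: "N s \<noteq> 0" for s
  proof
    assume "N s = 0"
    then have "AE q in Q. ennreal (fst q powr s + snd q powr s) = 0"
      unfolding N_def by (subst (asm) nn_integral_0_iff_AE) auto
    then have zero: "AE q in Q. fst q = 0 \<and> snd q = 0"
    proof (rule eventually_mono)
      fix q :: "real \<times> real" assume "ennreal (fst q powr s + snd q powr s) = 0"
      then have "fst q powr s = 0" "snd q powr s = 0"
        using powr_ge_zero[of "fst q" s] powr_ge_zero[of "snd q" s] by (simp_all add: ennreal_eq_0_iff)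
      then show "fst q = 0 \<and> snd q = 0" by simp
    qed
    have space: "space Q = UNIV" using sets_eq_imp_space_eq[OF sets_Q] by simp
    have "{p. fst p > 0} \<in> events" "{p. snd p > 0} \<in> events"
      using measurable_sets[OF fst_Q, of "{0<..}"] measurable_sets[OF snd_Q, of "{0<..}"] by (auto simp: space vimage_def)
    then have "prob {p. fst p > 0} = 0" "prob {p. snd p > 0} = 0"
      using zero by (auto simp: prob_eq_0 elim: eventually_mono)
    with LR_pos show False by simp
  qed
  have gt: "-1 < r" if "N s = ennreal (1 + r)" for s r
    using positive[of s] that by (auto simp: not_less[symmetric] intro: ccontr simp: ennreal_neg)
  have \<delta>0: "0 < \<delta>" using \<alpha> \<delta> by simp
  define S where "S = real_of_ereal (calS Q \<alpha>)"
  define D where "D = real_of_ereal (calS Q \<delta>)"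
  have NS: "N \<alpha> = ennreal (1 + S)" and ND: "N \<delta> = ennreal (1 + D)"
    and cS: "calS Q \<alpha> = ereal S" and cD: "calS Q \<delta> = ereal D"
    using val[OF finite[OF \<alpha> \<delta>(3)]] val[OF finite[OF \<delta>0 order.strict_trans[OF \<delta>(2,3)]]]
    by (simp_all only: S_def D_def)
  have "D / \<delta> < S / \<alpha>"
    using \<delta>(2) \<alpha> \<delta>0 unfolding mu_def cS cD by simp
  then have D: "D < \<delta> / \<alpha> * S"
    using \<alpha> \<delta>0 by (simp add: field_simps)
  \<comment> \<open>\<open>\<alpha> * p\<close> has to stay between \<open>\<alpha>\<close> and
    \<open>\<delta>\<close>, and \<open>p\<close> must not exceed \<open>2\<close>; \<open>v\<close>
    is the weight of \<open>\<delta>\<close> in the convex combination that equals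
    \<open>\<alpha> * p\<close>.\<close>
  define p where "p = min (\<delta> / \<alpha>) 2"
  have p: "1 < p" "p \<le> 2" "p \<le> \<delta> / \<alpha>" using \<alpha> \<delta> by (auto simp: p_def)
  define v where "v = (p - 1) / (\<delta> / \<alpha> - 1)"
  have \<delta>\<alpha>: "1 < \<delta> / \<alpha>" using \<alpha> \<delta> by simp
  have v: "0 < v" "v \<le> 1" using p \<delta>\<alpha> by (auto simp: v_def)
  have vp: "(1 - v) * 1 + v * (\<delta> / \<alpha>) = p"
  proof -
    have "(p - 1) / c * c = p - 1" if "c \<noteq> 0" for c :: real using that by simp
    from this[of "\<delta> / \<alpha> - 1"] have "v * (\<delta> / \<alpha> - 1) = p - 1" using \<delta>\<alpha> unfolding v_def by linarith
    then show ?thesis by (simp add: right_diff_distrib)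
  qed
  then have ap: "(1 - v) * \<alpha> + v * \<delta> = \<alpha> * p"
    using \<alpha> by (simp add: field_simps)
  have Np: "N (\<alpha> * p) \<le> ennreal (1 + ((1 - v) * S + v * D))"
  proof -
    have "N (\<alpha> * p) \<le> (\<integral>\<^sup>+q. ennreal (1 - v) * ennreal (fst q powr \<alpha> + snd q powr \<alpha>) + ennreal v * ennreal (fst q powr \<delta> + snd q powr \<delta>) \<partial>Q)"
      unfolding N_def
    proof (rule nn_integral_mono)
      fix q :: "real \<times> real"
      have "fst q powr (\<alpha> * p) + snd q powr (\<alpha> * p) \<le> (1 - v) * (fst q powr \<alpha> + snd q powr \<alpha>) + v * (fst q powr \<delta> + snd q powr \<delta>)"
        using powr_convex[of "1 - v" v "fst q" \<alpha> \<delta>] powr_convex[of "1 - v" v "snd q" \<alpha> \<delta>] v unfolding ap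
        by (simp add: algebra_simps)
      then have "ennreal (fst q powr (\<alpha> * p) + snd q powr (\<alpha> * p)) \<le> ennreal ((1 - v) * (fst q powr \<alpha> + snd q powr \<alpha>) + v * (fst q powr \<delta> + snd q powr \<delta>))"
        by (rule ennreal_leI)
      also have "\<dots> = ennreal (1 - v) * ennreal (fst q powr \<alpha> + snd q powr \<alpha>) + ennreal v * ennreal (fst q powr \<delta> + snd q powr \<delta>)"
        using v by (subst ennreal_plus) (auto simp: ennreal_mult simp del: ennreal_plus)
      finally show "ennreal (fst q powr (\<alpha> * p) + snd q powr (\<alpha> * p)) \<le> \<dots>" .
    qed
    also have "\<dots> = ennreal (1 - v) * N \<alpha> + ennreal v * N \<delta>"
      unfolding N_def by (simp add: nn_integral_add nn_integral_cmult)
    also have "\<dots> = ennreal (1 + ((1 - v) * S + v * D))"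
    proof -
      have "ennreal (1 - v) * N \<alpha> + ennreal v * N \<delta> = ennreal ((1 - v) * (1 + S) + v * (1 + D))"
        using v gt[OF NS] gt[OF ND] unfolding NS ND
        by (subst ennreal_plus) (auto simp: ennreal_mult simp del: ennreal_plus)
      also have "(1 - v) * (1 + S) + v * (1 + D) = 1 + ((1 - v) * S + v * D)" by (simp add: algebra_simps)
      finally show ?thesis .
    qed
    finally show ?thesis .
  qed
  then have fin: "N (\<alpha> * p) < \<infinity>" by (rule order.strict_trans1) simp
  define Sp where "Sp = real_of_ereal (calS Q (\<alpha> * p))"
  have NSp: "N (\<alpha> * p) = ennreal (1 + Sp)" using val(1)[OF fin] by (simp add: Sp_def)
  have "1 + Sp \<le> 1 + ((1 - v) * S + v * D)"
    using Np gt[OF NSp] gt[OF NS] gt[OF ND] v unfolding NSp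
    by (subst (asm) ennreal_le_iff2) (auto simp: not_le)
  also have "\<dots> < 1 + ((1 - v) * S + v * (\<delta> / \<alpha> * S))"
    using mult_strict_left_mono[OF D v(1)] by simp
  also have "\<dots> = 1 + p * S"
    unfolding vp[symmetric] by (simp add: algebra_simps)
  finally have "Sp < p * S" by simp
  then have "smoothing_cascade Q \<alpha> S p Sp"
    using NS NSp gt[OF NS] gt[OF NSp] p
    by (unfold_locales) (auto simp: N_def)
  then show thesis using that by (simp add: S_def)
qed

section \<open>The limiting distribution function\<close>

context
  fixes ZL :: "real measure" and c0 \<alpha> :: real
  assumes ZL: "nonneg_law ZL" and c0: "0 < c0" and \<alpha>: "0 < \<alpha>"
begin

interpretation ZL: prob_space ZL using ZL by (simp add: nonneg_law_def)

lemma sets_ZL [measurable_cong]: "sets ZL = sets borel" using ZL by (simp add: nonneg_law_def)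

text \<open>With \<open>\<bar>z\<bar>\<close> the integrand is bounded by \<open>1\<close> for every
  real \<open>z\<close>, so that a constant dominates it in the limits below.\<close>

lemma Hlim_cdf_pos: "0 < x \<Longrightarrow> Hlim_cdf c0 \<alpha> ZL x = (\<integral>z. exp (- c0 * x powr (- \<alpha>) * \<bar>z\<bar>) \<partial>ZL)"
  unfolding Hlim_cdf_def using ZL
  by (auto simp: nonneg_law_def intro!: integral_cong_AE elim!: eventually_mono)

lemma Hlim_cdf_0: "Hlim_cdf c0 \<alpha> ZL 0 = (\<integral>z. indicator {0} z \<partial>ZL)"
  by (simp add: Hlim_cdf_def)

lemma Hlim_cdf_neg: "x < 0 \<Longrightarrow> Hlim_cdf c0 \<alpha> ZL x = 0"
  by (simp add: Hlim_cdf_def)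

lemma Hlim_integrand_bounded: "norm (exp (- c0 * x powr (- \<alpha>) * \<bar>z\<bar>)) \<le> 1"
  using c0 by simp

lemma integrable_Hlim: "integrable ZL (\<lambda>z. exp (- c0 * x powr (- \<alpha>) * \<bar>z\<bar>))"
  using Hlim_integrand_bounded by (intro ZL.integrable_const_bound[of _ 1]) auto

lemma Hlim_cdf_nonneg: "0 \<le> Hlim_cdf c0 \<alpha> ZL x"
  by (simp add: Hlim_cdf_def)

lemma Hlim_cdf_mono:
  assumes "x \<le> y"
  shows "Hlim_cdf c0 \<alpha> ZL x \<le> Hlim_cdf c0 \<alpha> ZL y"
proof -
  consider "x < 0" | "x = 0" "y = 0" | "x = 0" "0 < y" | "0 < x" "0 < y" using assms by linarith
  then show ?thesis
  proof cases
    case 1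
    then show ?thesis by (simp add: Hlim_cdf_neg Hlim_cdf_nonneg)
  next
    case 3
    have "(\<integral>z. indicator {0} z \<partial>ZL) \<le> (\<integral>z. exp (- c0 * y powr (- \<alpha>) * \<bar>z\<bar>) \<partial>ZL)"
    proof (rule integral_mono)
      show "integrable ZL (indicator {0} :: real \<Rightarrow> real)"
        by (rule ZL.integrable_const_bound[of _ 1]) auto
    qed (rule integrable_Hlim, auto split: split_indicator)
    then show ?thesis using 3 by (simp only: Hlim_cdf_pos Hlim_cdf_0)
  next
    case 4
    have "y powr (- \<alpha>) \<le> x powr (- \<alpha>)"
      using 4 assms \<alpha> by (intro powr_mono2') auto
    then have "(\<integral>z. exp (- c0 * x powr (- \<alpha>) * \<bar>z\<bar>) \<partial>ZL) \<le> (\<integral>z. exp (- c0 * y powr (- \<alpha>) * \<bar>z\<bar>) \<partial>ZL)"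
      using c0 by (intro integral_mono integrable_Hlim) (auto intro!: mult_right_mono mult_left_mono)
    then show ?thesis using 4 by (simp only: Hlim_cdf_pos)
  qed simp
qed

text \<open>As \<open>x\<close> decreases to \<open>0\<close> the integrand tends to
  \<open>0\<close> unless \<open>z = 0\<close>, so the mass that \<open>ZL\<close> gives to
  \<open>{0}\<close> is the value at \<open>0\<close> that right continuity demands.\<close>

lemma Hlim_cdf_at_right_0: "(Hlim_cdf c0 \<alpha> ZL \<longlongrightarrow> Hlim_cdf c0 \<alpha> ZL 0) (at_right 0)"
proof -
  have "((\<lambda>x. \<integral>z. exp (- c0 * x powr (- \<alpha>) * \<bar>z\<bar>) \<partial>ZL) \<longlongrightarrow> (\<integral>z. indicator {0} z \<partial>ZL)) (at_right 0)"
  proof (rule ZL.tendsto_integral_bounded[where B=1])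
    fix z :: real
    show "((\<lambda>x. exp (- c0 * x powr (- \<alpha>) * \<bar>z\<bar>)) \<longlongrightarrow> indicator {0} z) (at_right 0)"
    proof (cases "z = 0")
      case False
      have "((\<lambda>x::real. x powr \<alpha>) \<longlongrightarrow> 0 powr \<alpha>) (at_right 0)"
        using \<alpha> by (intro tendsto_powr') (auto simp: eventually_at_filter)
      then have "filterlim (\<lambda>x::real. inverse (x powr \<alpha>)) at_top (at_right 0)"
        by (intro filterlim_inverse_at_top) (auto simp: eventually_at_filter)
      then have "filterlim (\<lambda>x::real. (c0 * \<bar>z\<bar>) * inverse (x powr \<alpha>)) at_top (at_right 0)"
        using c0 False by (intro filterlim_tendsto_pos_mult_at_top[OF tendsto_const]) auto
      then have "((\<lambda>x::real. exp (- ((c0 * \<bar>z\<bar>) * inverse (x powr \<alpha>)))) \<longlongrightarrow> 0) (at_right 0)"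
        by (intro filterlim_compose[OF exp_at_bot] filterlim_compose[OF filterlim_uminus_at_bot_at_top])
      then show ?thesis using False by (simp add: powr_minus ac_simps)
    qed simp
  qed (use Hlim_integrand_bounded in auto)
  then show ?thesis
    unfolding Hlim_cdf_0
    by (rule tendsto_cong[THEN iffD1, rotated])
      (auto simp: eventually_at_filter Hlim_cdf_pos)
qed

lemma Hlim_cdf_at_right_pos:
  assumes "0 < x"
  shows "(Hlim_cdf c0 \<alpha> ZL \<longlongrightarrow> Hlim_cdf c0 \<alpha> ZL x) (at_right x)"
proof -
  have "((\<lambda>x. \<integral>z. exp (- c0 * x powr (- \<alpha>) * \<bar>z\<bar>) \<partial>ZL) \<longlongrightarrow> (\<integral>z. exp (- c0 * x powr (- \<alpha>) * \<bar>z\<bar>) \<partial>ZL)) (at_right x)"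
    using assms Hlim_integrand_bounded
    by (intro ZL.tendsto_integral_bounded[where B=1]) (auto intro!: tendsto_intros)
  then show ?thesis
    unfolding Hlim_cdf_pos[OF assms]
    by (rule tendsto_cong[THEN iffD1, rotated])
      (use assms in \<open>auto simp: eventually_at_filter Hlim_cdf_pos\<close>)
qed

lemma Hlim_cdf_at_top: "(Hlim_cdf c0 \<alpha> ZL \<longlongrightarrow> 1) at_top"
proof -
  have "((\<lambda>x. \<integral>z. exp (- c0 * x powr (- \<alpha>) * \<bar>z\<bar>) \<partial>ZL) \<longlongrightarrow> (\<integral>z. 1 \<partial>ZL)) at_top"
  proof (rule integral_dominated_convergence_at_top[where w="\<lambda>_. 1"])
    show "AE z in ZL. ((\<lambda>x. exp (- c0 * x powr (- \<alpha>) * \<bar>z\<bar>)) \<longlongrightarrow> 1) at_top"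
    proof (rule AE_I2)
      fix z :: real
      have "((\<lambda>x::real. x powr (- \<alpha>)) \<longlongrightarrow> 0) at_top"
        using \<alpha> by (intro tendsto_neg_powr filterlim_ident) auto
      then have "((\<lambda>x. exp (- c0 * x powr (- \<alpha>) * \<bar>z\<bar>)) \<longlongrightarrow> exp (- c0 * 0 * \<bar>z\<bar>)) at_top"
        by (intro tendsto_intros)
      then show "((\<lambda>x. exp (- c0 * x powr (- \<alpha>) * \<bar>z\<bar>)) \<longlongrightarrow> 1) at_top" by simp
    qed
    show "\<forall>\<^sub>F x in at_top. AE z in ZL. norm (exp (- c0 * x powr (- \<alpha>) * \<bar>z\<bar>)) \<le> 1"
      using Hlim_integrand_bounded by (intro always_eventually allI AE_I2)
  qed auto
  then have "((\<lambda>x. \<integral>z. exp (- c0 * x powr (- \<alpha>) * \<bar>z\<bar>) \<partial>ZL) \<longlongrightarrow> 1) at_top"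
    by (simp add: ZL.prob_space)
  then show ?thesis
    by (rule tendsto_cong[THEN iffD1, rotated])
      (auto intro!: eventually_mono[OF eventually_gt_at_top[of 0]] simp: Hlim_cdf_pos)
qed

lemma Hlim_cdf_is_cdf: "\<exists>HL. real_distribution HL \<and> (\<forall>x. cdf HL x = Hlim_cdf c0 \<alpha> ZL x)"
proof -
  let ?F = "Hlim_cdf c0 \<alpha> ZL"
  have right: "continuous (at_right x) ?F" for x
  proof -
    have "(?F \<longlongrightarrow> ?F x) (at_right x)"
    proof (cases x "0::real" rule: linorder_cases)
      case less
      then have "\<forall>\<^sub>F y in at_right x. ?F x = ?F y"
        using eventually_at_right_real[OF less] by (auto elim!: eventually_mono simp: Hlim_cdf_neg)
      then show ?thesis by (rule Lim_transform_eventually[OF tendsto_const])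
    qed (auto simp: Hlim_cdf_at_right_0 Hlim_cdf_at_right_pos)
    then show ?thesis by (simp add: continuous_within)
  qed
  have bot: "(?F \<longlongrightarrow> 0) at_bot"
    by (rule Lim_transform_eventually[OF tendsto_const])
      (auto intro!: eventually_mono[OF eventually_gt_at_bot[of "0::real"]] simp: Hlim_cdf_neg)
  have "real_distribution (interval_measure ?F)"
    by (rule real_distribution_interval_measure[OF Hlim_cdf_mono right bot Hlim_cdf_at_top])
  moreover have "cdf (interval_measure ?F) = ?F"
    by (rule cdf_interval_measure[OF Hlim_cdf_mono right bot])
  ultimately show ?thesis by auto
qed

lemma Hlim_cdf_eq_ray:
  "0 < x \<Longrightarrow> complex_of_real (Hlim_cdf c0 \<alpha> ZL x) = ray ZL (- of_real (c0 * x powr (- \<alpha>))) 1"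
  unfolding Hlim_cdf_pos ray_def integral_complex_of_real[symmetric]
  by (simp add: exp_of_real[symmetric] mult.assoc)

end

lemma smoothing_fp_iff:
  "smoothing_fp Q a ZL \<longleftrightarrow> nonneg_law ZL \<and> integrable ZL (\<lambda>z. z) \<and> (\<integral>z. z \<partial>ZL) = 1 \<and>
     smoothing_map Q a (real_of_ereal (calS Q a)) ZL = ZL"
  unfolding smoothing_fp_def nonneg_law_def smoothing_map_def by blast

section \<open>Convergence of the rescaled maximum\<close>

context cascade_process begin

lemma cover_scale: "0 < k \<Longrightarrow> cover (c / k) b = cover c (k * b)"
  unfolding cover_def by (simp add: pos_le_divide_eq abs_mult mult_ac)

lemma cover_abs: "cover c \<bar>b\<bar> = cover c b"
  unfolding cover_def by (simp add: abs_mult)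

lemma prob_Hproc_neg:
  assumes "0 < t" "c < 0"
  shows "prob {\<omega> \<in> space M. Hproc LR I X nu t \<omega> \<le> c} = 0"
proof -
  have "{y. \<bar>b * y\<bar> \<le> c} = {}" for b
    using assms(2) by auto
  then have "cover c b = 0" for b by (simp add: cover_def)
  then have "complex_of_real (prob {\<omega> \<in> space M. Hproc LR I X nu t \<omega> \<le> c}) = Q.Emix (exp (- t)) (\<lambda>_. 0)"
    using prob_Hproc_le[OF assms(1), of c] by simp
  also have "\<dots> = 0" by (simp add: Q.Emix_def Q.Eprod_def)
  finally show ?thesis by simp
qed

text \<open>\<open>1 - cover x (v powr (1 / \<alpha>))\<close> is
  \<open>P(\<bar>X\<bar> > y)\<close> for \<open>y = x v^(- 1 / \<alpha>)\<close>, and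
  \<open>1 / v = x^(- \<alpha>) y^\<alpha>\<close>. As \<open>v\<close> tends to \<open>0\<close>,
  \<open>y\<close> tends to infinity and the tail hypothesis applies.\<close>

lemma cover_tail:
  assumes \<alpha>: "0 < \<alpha>" and x: "0 < x"
    and tail: "((\<lambda>y. y powr \<alpha> * (1 - measure PX {z. \<bar>z\<bar> \<le> y})) \<longlongrightarrow> c0) at_top"
  shows "((\<lambda>v. (1 - cover x (v powr (1 / \<alpha>))) / v) \<longlongrightarrow> c0 * x powr (- \<alpha>)) (at_right 0)"
proof -
  let ?y = "\<lambda>v. x * inverse (v powr (1 / \<alpha>))"
  have "((\<lambda>v::real. v powr (1 / \<alpha>)) \<longlongrightarrow> 0 powr (1 / \<alpha>)) (at_right 0)"
    using \<alpha> by (intro tendsto_powr') (auto simp: eventually_at_filter)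
  then have "filterlim (\<lambda>v::real. inverse (v powr (1 / \<alpha>))) at_top (at_right 0)"
    by (intro filterlim_inverse_at_top) (auto simp: eventually_at_filter)
  then have y: "filterlim ?y at_top (at_right 0)"
    using x by (intro filterlim_tendsto_pos_mult_at_top[OF tendsto_const])
  have "((\<lambda>v. x powr (- \<alpha>) * (?y v powr \<alpha> * (1 - measure PX {z. \<bar>z\<bar> \<le> ?y v}))) \<longlongrightarrow> x powr (- \<alpha>) * c0) (at_right 0)"
    by (intro tendsto_mult tendsto_const filterlim_compose[OF tail y])
  moreover have "\<forall>\<^sub>F v in at_right 0. x powr (- \<alpha>) * (?y v powr \<alpha> * (1 - measure PX {z. \<bar>z\<bar> \<le> ?y v})) =
      (1 - cover x (v powr (1 / \<alpha>))) / v"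
    unfolding eventually_at_filter
  proof (intro always_eventually allI impI)
    fix v :: real assume "v \<noteq> 0" "v \<in> {0<..}"
    then have v: "0 < v" by simp
    have "?y v powr \<alpha> = x powr \<alpha> * inverse v"
      using v \<alpha> by (simp add: powr_mult inverse_powr powr_powr)
    then have "x powr (- \<alpha>) * ?y v powr \<alpha> = inverse v"
      using x by (simp add: powr_minus)
    moreover have "{z. \<bar>z\<bar> \<le> ?y v} = {z. \<bar>v powr (1 / \<alpha>) * z\<bar> \<le> x}"
      using v by (simp add: abs_mult field_simps)
    ultimately show "x powr (- \<alpha>) * (?y v powr \<alpha> * (1 - measure PX {z. \<bar>z\<bar> \<le> ?y v})) = (1 - cover x (v powr (1 / \<alpha>))) / v"
      by (simp add: cover_def divide_inverse flip: mult.assoc)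
  qed
  ultimately have "((\<lambda>v. (1 - cover x (v powr (1 / \<alpha>))) / v) \<longlongrightarrow> x powr (- \<alpha>) * c0) (at_right 0)"
    by (rule tendsto_cong[THEN iffD1, rotated])
  then show ?thesis by (simp add: mult.commute)
qed

theorem prob_Hproc_tendsto:
  assumes casc: "smoothing_cascade Q \<alpha> S p Sp" and \<alpha>: "0 < \<alpha>" and c0: "0 < c0" and x: "0 < x"
    and tail: "((\<lambda>y. y powr \<alpha> * (1 - measure PX {z. \<bar>z\<bar> \<le> y})) \<longlongrightarrow> c0) at_top"
    and ZL: "nonneg_law ZL" "integrable ZL (\<lambda>z. z)" "(\<integral>z. z \<partial>ZL) = 1" "smoothing_map Q \<alpha> S ZL = ZL"
  shows "((\<lambda>t. prob {\<omega> \<in> space M. exp (- (S / \<alpha>) * t) * Hproc LR I X nu t \<omega> \<le> x}) \<longlongrightarrow> Hlim_cdf c0 \<alpha> ZL x) at_top"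
proof -
  interpret C: smoothing_cascade Q \<alpha> S p Sp by fact
  \<comment> \<open>The slope of \<open>ray ZL ?\<zeta>\<close> at \<open>0\<close> is
    \<open>?\<zeta>\<close>, the mean of \<open>ZL\<close> being \<open>1\<close>; this choice
    matches the slope of \<open>?g\<close> found in \<open>cover_tail\<close>, as
    \<open>Emix_tendsto\<close> requires.\<close>
  let ?\<zeta> = "- complex_of_real (c0 * x powr (- \<alpha>))"
  let ?g = "\<lambda>v. complex_of_real (cover x (v powr (1 / \<alpha>)))"
  have \<zeta>: "Re ?\<zeta> \<le> 0" using c0 by simp
  have prob_ZL: "prob_space ZL" using ZL by (simp add: nonneg_law_def)
  have cover0: "cover x 0 = 1"
    using x PX.prob_space sets_eq_imp_space_eq[OF sets_PX] by (simp add: cover_def)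
  have "((\<lambda>u. Q.Emix u (\<lambda>b. ?g (u powr S * b powr \<alpha>))) \<longlongrightarrow> ray ZL ?\<zeta> 1) (at_right 0)"
  proof (rule C.Emix_tendsto)
    show "Q.smoothing_eq \<alpha> S (ray ZL ?\<zeta>)"
      using Q.smoothing_eq_ray[OF ZL(1) \<zeta> ZL(4)] .
    show "?g \<in> borel_measurable borel" by measurable
    show "norm (?g b) \<le> 1" for b using cover_bounds[of x "b powr (1 / \<alpha>)"] by simp
    show "?g 0 = ray ZL ?\<zeta> 0" by (simp add: ray_0[OF prob_ZL] cover0)
    have "((\<lambda>v. complex_of_real ((1 - cover x (v powr (1 / \<alpha>))) / v)) \<longlongrightarrow> of_real (c0 * x powr (- \<alpha>))) (at_right 0)"
      by (intro tendsto_of_real cover_tail \<alpha> x tail)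
    from tendsto_add[OF ray_derivative[OF ZL(1) \<zeta> ZL(2)] this]
    have "((\<lambda>v. (ray ZL ?\<zeta> v - 1) /\<^sub>R v + complex_of_real ((1 - cover x (v powr (1 / \<alpha>))) / v)) \<longlongrightarrow> 0) (at_right 0)"
      by (simp add: ZL(3))
    moreover have "(ray ZL ?\<zeta> v - 1) /\<^sub>R v + complex_of_real ((1 - cover x (v powr (1 / \<alpha>))) / v) =
        (ray ZL ?\<zeta> v - ?g v) /\<^sub>R v" for v
      by (simp add: scaleR_conv_of_real divide_inverse algebra_simps)
    ultimately show "((\<lambda>v. (ray ZL ?\<zeta> v - ?g v) /\<^sub>R v) \<longlongrightarrow> 0) (at_right 0)" by simp
  qed
  moreover have "filterlim (\<lambda>t::real. exp (- t)) (at_right 0) at_top"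
    by (auto simp: filterlim_at intro!: filterlim_compose[OF exp_at_bot] filterlim_uminus_at_bot_at_top)
  ultimately have lim: "((\<lambda>t. Q.Emix (exp (- t)) (\<lambda>b. ?g (exp (- t) powr S * b powr \<alpha>))) \<longlongrightarrow> ray ZL ?\<zeta> 1) at_top"
    by (rule filterlim_compose)
  have "\<forall>\<^sub>F t in at_top. Q.Emix (exp (- t)) (\<lambda>b. ?g (exp (- t) powr S * b powr \<alpha>)) =
      complex_of_real (prob {\<omega> \<in> space M. exp (- (S / \<alpha>) * t) * Hproc LR I X nu t \<omega> \<le> x})"
    using eventually_gt_at_top[of 0]
  proof eventually_elim
    case (elim t)
    let ?k = "exp (- (S / \<alpha>) * t)"
    \<comment> \<open>Here \<open>powr\<close> ignores the sign of \<open>b\<close>, so taking the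
      root returns \<open>\<bar>b\<bar>\<close>; this is harmless because \<open>cover\<close> is
      even in \<open>b\<close>.\<close>
    have "(exp (- t) powr S * b powr \<alpha>) powr (1 / \<alpha>) = ?k * \<bar>b\<bar>" for b
      using \<alpha> by (simp add: powr_mult powr_powr exp_powr_real)
    then have "?g (exp (- t) powr S * b powr \<alpha>) = of_real (cover (x / ?k) b)" for b
      using cover_scale[of ?k x "\<bar>b\<bar>"] by (simp add: cover_abs)
    moreover have "{\<omega> \<in> space M. ?k * Hproc LR I X nu t \<omega> \<le> x} = {\<omega> \<in> space M. Hproc LR I X nu t \<omega> \<le> x / ?k}"
      by (simp add: pos_le_divide_eq mult.commute)
    ultimately show ?case
      using prob_Hproc_le[OF elim, of "x / ?k"] by simp
  qed
  from lim[THEN tendsto_cong[OF this, THEN iffD1]]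
  have "((\<lambda>t. complex_of_real (prob {\<omega> \<in> space M. exp (- (S / \<alpha>) * t) * Hproc LR I X nu t \<omega> \<le> x})) \<longlongrightarrow>
      complex_of_real (Hlim_cdf c0 \<alpha> ZL x)) at_top"
    unfolding Hlim_cdf_eq_ray[OF ZL(1) c0 \<alpha> x] .
  then show ?thesis by (simp only: tendsto_of_real_iff)
qed

end

theorem theorem2p6:
  fixes M :: "'a measure" and Q :: "(real \<times> real) measure" and PX :: "real measure"
    and LR :: "nat \<Rightarrow> 'a \<Rightarrow> real \<times> real" and I :: "nat \<Rightarrow> 'a \<Rightarrow> nat"
    and nu :: "real \<Rightarrow> 'a \<Rightarrow> nat" and X :: "nat \<Rightarrow> 'a \<Rightarrow> real"
    and \<alpha> c0p c0m :: real
  assumes M: "prob_space M"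
    and Q: "prob_space Q" "sets Q = sets borel"
    and LR_nonneg: "AE p in Q. 0 \<le> fst p \<and> 0 \<le> snd p"
    and LR_pos: "measure Q {p. fst p > 0} + measure Q {p. snd p > 0} > 1"
    and LR_rv: "\<And>n. n \<ge> 1 \<Longrightarrow> LR n \<in> borel_measurable M"
    and LR_law: "\<And>n. n \<ge> 1 \<Longrightarrow> distr M borel (LR n) = Q"
    and LR_indep: "prob_space.indep_vars M (\<lambda>_. borel) LR {1..}"
    and I_rv: "\<And>n. n \<ge> 1 \<Longrightarrow> I n \<in> measurable M (count_space UNIV)"
    and I_law: "\<And>n. n \<ge> 1 \<Longrightarrow> distr M (count_space UNIV) (I n) = measure_pmf (pmf_of_set {1..n})"
    and I_indep: "prob_space.indep_vars M (\<lambda>_. count_space UNIV) I {1..}"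
    and nu_yule: "yule_process M nu"
    and PX: "prob_space PX" "sets PX = sets borel"
    and X_rv: "\<And>j. j \<ge> 1 \<Longrightarrow> X j \<in> borel_measurable M"
    and X_law: "\<And>j. j \<ge> 1 \<Longrightarrow> distr M borel (X j) = PX"
    and X_indep: "prob_space.indep_vars M (\<lambda>_. borel) X {1..}"
    and blocks_indep: "prob_space.indep_sets M
        (\<lambda>k::nat. if k = 0 then fam_events M (\<lambda>_. borel) X {1..}
                  else if k = 1 then fam_events M (\<lambda>_. count_space UNIV) nu {0..}
                  else if k = 2 then fam_events M (\<lambda>_. borel) LR {1..}
                  else fam_events M (\<lambda>_. count_space UNIV) I {1..}) {0..3}"
    and tail_pos: "((\<lambda>x. x powr \<alpha> * (1 - measure PX {..x})) \<longlongrightarrow> c0p) at_top"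
    and tail_neg: "((\<lambda>x. \<bar>x\<bar> powr \<alpha> * measure PX {..x}) \<longlongrightarrow> c0m) at_bot"
    and alpha: "0 < \<alpha>" "\<alpha> < 2"
    and H_alpha:
      "(\<alpha> \<noteq> 1 \<and> c0p + c0m > 0 \<and>
          (\<alpha> > 1 \<longrightarrow> integrable PX (\<lambda>x. x) \<and> (\<integral>x. x \<partial>PX) = 0) \<and>
          (\<exists>\<delta>>\<alpha>. mu Q \<delta> < mu Q \<alpha> \<and> mu Q \<alpha> < \<infinity>))
     \<or> (\<alpha> = 1 \<and> c0p = c0m \<and> c0p > 0 \<and>
          (\<exists>\<gamma>0::real. ((\<lambda>R. LINT x:{-R<..<R}|PX. x) \<longlongrightarrow> \<gamma>0) at_top) \<and>
          (\<exists>\<delta>>1. mu Q \<delta> < mu Q 1 \<and> mu Q 1 < \<infinity>))"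
    and c0_pos: "c0p + c0m > 0"
  shows "(\<exists>!ZL. smoothing_fp Q \<alpha> ZL) \<and>
         (\<forall>ZL. smoothing_fp Q \<alpha> ZL \<longrightarrow>
            (\<exists>HL. real_distribution HL \<and> (\<forall>x. cdf HL x = Hlim_cdf (c0p + c0m) \<alpha> ZL x)) \<and>
            (\<forall>x. isCont (Hlim_cdf (c0p + c0m) \<alpha> ZL) x \<longrightarrow>
               ((\<lambda>t. measure M {\<omega>\<in>space M.
                    exp (- real_of_ereal (mu Q \<alpha>) * t) * Hproc LR I X nu t \<omega> \<le> x})
                 \<longlongrightarrow> Hlim_cdf (c0p + c0m) \<alpha> ZL x) at_top))"
proof -
  interpret M: prob_space M by fact
  interpret Q: cascade Q using Q by (simp add: cascade_def cascade_axioms_def)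
  interpret PX: prob_space PX by fact
  interpret P: cascade_process M Q PX LR I nu X
    by unfold_locales (fact LR_rv LR_law LR_indep I_rv I_law I_indep nu_yule PX X_rv X_law X_indep blocks_indep)+
  define S where "S = real_of_ereal (calS Q \<alpha>)"
  obtain \<delta> where \<delta>: "\<alpha> < \<delta>" "mu Q \<delta> < mu Q \<alpha>" "mu Q \<alpha> < \<infinity>"
    using H_alpha by auto
  obtain p Sp where casc: "smoothing_cascade Q \<alpha> S p Sp"
    using smoothing_cascade_of_mu[OF Q LR_pos alpha(1) \<delta>] unfolding S_def .
  interpret C: smoothing_cascade Q \<alpha> S p Sp by fact
  have mu: "real_of_ereal (mu Q \<alpha>) = S / \<alpha>"
    using alpha(1) by (cases "calS Q \<alpha>") (auto simp: mu_def S_def)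
  note fp = smoothing_fp_iff[of Q \<alpha>, folded S_def]
  have ex1: "\<exists>!ZL. smoothing_fp Q \<alpha> ZL"
    unfolding fp using C.smoothing_fixed_point_exists C.smoothing_fixed_point_unique by metis
  note tail = tail_two_sided[OF PX alpha(1) tail_pos tail_neg]
  let ?F = "Hlim_cdf (c0p + c0m) \<alpha>"
  let ?P = "\<lambda>t x. measure M {\<omega> \<in> space M. exp (- (S / \<alpha>) * t) * Hproc LR I X nu t \<omega> \<le> x}"
  have "((\<lambda>t. ?P t x) \<longlongrightarrow> ?F ZL x) at_top" if ZL: "smoothing_fp Q \<alpha> ZL" and cont: "isCont (?F ZL) x" for ZL x
  proof -
    from ZL have law: "nonneg_law ZL" and rest: "integrable ZL (\<lambda>z. z)" "(\<integral>z. z \<partial>ZL) = 1" "smoothing_map Q \<alpha> S ZL = ZL"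
      by (simp_all add: fp)
    have pos: "((\<lambda>t. ?P t x) \<longlongrightarrow> ?F ZL x) at_top" if "0 < x" for x
      by (rule P.prob_Hproc_tendsto[OF casc alpha(1) c0_pos that tail law rest])
    consider "x < 0" | "x = 0" | "0 < x" by linarith
    then show ?thesis
    proof cases
      case 1
      have "\<forall>\<^sub>F t in at_top. 0 = ?P t x"
        using eventually_gt_at_top[of 0]
      proof eventually_elim
        case (elim t)
        let ?k = "exp (- (S / \<alpha>) * t)"
        have "{\<omega> \<in> space M. ?k * Hproc LR I X nu t \<omega> \<le> x} = {\<omega> \<in> space M. Hproc LR I X nu t \<omega> \<le> x / ?k}"
          by (simp add: pos_le_divide_eq mult.commute)
        moreover have "x / ?k < 0" using 1 by (simp add: divide_neg_pos)
        ultimately show ?case using P.prob_Hproc_neg[OF elim, of "x / ?k"] by simp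
      qed
      then show ?thesis using 1 by (simp add: Hlim_cdf_neg[OF law c0_pos alpha(1)] Lim_transform_eventually[OF tendsto_const])
    next
      \<comment> \<open>Continuity at \<open>0\<close> forces \<open>?F ZL 0 = 0\<close>, since the
        function vanishes on the negative axis. Monotonicity then bounds the probability at
        \<open>0\<close> by that at a small \<open>y > 0\<close>, where the limit is already
        known.\<close>
      case 2
      have "(?F ZL \<longlongrightarrow> ?F ZL 0) (at_left 0)"
        using cont 2 by (simp add: isCont_def filterlim_at_split)
      moreover have "(?F ZL \<longlongrightarrow> 0) (at_left 0)"
        by (rule Lim_transform_eventually[OF tendsto_const])
          (simp add: eventually_at_filter Hlim_cdf_neg[OF law c0_pos alpha(1)])
      ultimately have F0: "?F ZL 0 = 0"
        by (rule tendsto_unique[OF trivial_limit_at_left_real])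
      have "((\<lambda>t. ?P t 0) \<longlongrightarrow> 0) at_top"
      proof (rule tendstoI)
        fix e :: real assume e: "0 < e"
        have "\<forall>\<^sub>F y in at_right 0. ?F ZL y < e"
          using order_tendstoD(2)[OF Hlim_cdf_at_right_0[OF law c0_pos alpha(1)]] e F0 by simp
        then have "\<forall>\<^sub>F y in at_right 0. ?F ZL y < e \<and> 0 < y"
          by (rule eventually_conj) (simp add: eventually_at_filter)
        then obtain y where y: "?F ZL y < e" "0 < y"
          using eventually_happens'[OF trivial_limit_at_right_real] by blast
        have "\<forall>\<^sub>F t in at_top. ?P t y < e"
          by (rule order_tendstoD(2)[OF pos[OF y(2)] y(1)])
        then show "\<forall>\<^sub>F t in at_top. dist (?P t 0) 0 < e"
          using eventually_gt_at_top[of 0]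
        proof eventually_elim
          case (elim t)
          note [measurable] = P.Hproc_measurable[OF less_imp_le[OF elim(2)]]
          have "?P t 0 \<le> ?P t y"
            using y(2) by (intro M.finite_measure_mono) (auto, measurable)
          with elim(1) show ?case by simp
        qed
      qed
      then show ?thesis using 2 F0 by simp
    qed (rule pos)
  qed
  then show ?thesis
    unfolding mu using ex1 Hlim_cdf_is_cdf[OF _ c0_pos alpha(1)] by (simp add: fp)
qed

end
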